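(* There exist absolute constants $C, c, \varepsilon_0 > 0$ such that the following holds. Let $\varepsilon \in (0, \varepsilon_0]$ and let $x_1, \dots, x_n$ be i.i.d. samples from a centered elliptical distribution on $\mathbb{R}^p$ with shape matrix $\Sigma$, where $n \geq C p \log^2 p / \varepsilon^2$. Then with probability at least $1 - \exp(-c\, n \varepsilon^2 / \log^2 p)$, Tyler's M-estimator $\widehat{\Sigma}$ of $x_1,\dots,x_n$ exists and satisfies $$\|I_p - \Sigma^{1/2} \widehat{\Sigma}^{-1} \Sigma^{1/2}\|_{op} \leq \varepsilon.$$
   Context: A centered elliptical distribution on $\mathbb{R}^p$ with shape matrix $\Sigma$ is the law of $X = u\, \Sigma^{1/2} V$, where $\Sigma$ is a fixed $p \times p$ positive-definite matrix normalized so that $\operatorname{tr}\Sigma = p$, $V$ is uniformly distributed on the unit sphere $\mathbb{S}^{p-1}$, and $u$ is a real random scalar independent of $V$ with $u \neq 0$ almost surely. Given $x_1, \dots, x_n \in \mathbb{R}^p$, Tyler's M-estimator $\widehat{\Sigma}$ is the unique positive-definite $p\times p$ matrix satisfying $$\frac{p}{n}\sum_{i=1}^n \frac{x_i x_i^\top}{x_i^\top \widehat{\Sigma}^{-1} x_i} = \widehat{\Sigma}, \qquad \operatorname{tr}\widehat{\Sigma} = p,$$ when such a solution exists and is unique. $\|\cdot\|_{op}$ is the spectral norm. *)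

theory Defs
  imports
    "HOL-Probability.Probability"
    "Jordan_Normal_Form.Gauss_Jordan_Elimination"
begin

unbundle no vec_syntax

section \<open>Real matrices\<close>

text \<open>
  The constants of the theorem are absolute, so the dimension \<open>p\<close> is quantified inside the
  statement. Vectors and matrices are therefore those of \<open>Jordan_Normal_Form\<close>, whose dimensions
  are natural numbers.
\<close>

definition vnorm :: "real vec \<Rightarrow> real" where
  "vnorm v = sqrt (v \<bullet> v)"

definition op_norm :: "real mat \<Rightarrow> real" where
  "op_norm A = Sup {vnorm (A *\<^sub>v v) | v. v \<in> carrier_vec (dim_col A) \<and> vnorm v \<le> 1}"

definition mat_trace :: "real mat \<Rightarrow> real" where
  "mat_trace A = (\<Sum>i<dim_row A. A $$ (i, i))"

definition pos_def :: "nat \<Rightarrow> real mat \<Rightarrow> bool" where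
  "pos_def p A \<longleftrightarrow> A \<in> carrier_mat p p \<and> A\<^sup>T = A \<and>
     (\<forall>v \<in> carrier_vec p. v \<noteq> 0\<^sub>v p \<longrightarrow> v \<bullet> (A *\<^sub>v v) > 0)"

text \<open>The unique positive-definite square root; meaningful only for positive-definite \<open>A\<close>.\<close>
definition mat_sqrt :: "real mat \<Rightarrow> real mat" where
  "mat_sqrt A = (THE B. pos_def (dim_row A) B \<and> B * B = A)"

abbreviation mat_inv :: "real mat \<Rightarrow> real mat" where
  "mat_inv A \<equiv> the (mat_inverse A)"


section \<open>Elliptical distributions\<close>

text \<open>The Borel sigma-algebra of \<open>\<real>\<^sup>p\<close>, generated by the coordinates.\<close>
definition borel_vec :: "nat \<Rightarrow> real vec measure" where
  "borel_vec p = vimage_algebra (carrier_vec p) (\<lambda>v. \<lambda>i\<in>{..<p}. v $ i)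
     (\<Pi>\<^sub>M i\<in>{..<p}. borel)"

definition lborel_vec :: "nat \<Rightarrow> real vec measure" where
  "lborel_vec p = distr (\<Pi>\<^sub>M i\<in>{..<p}. lborel) (borel_vec p) (vec p)"

text \<open>
  Normalized surface measure on the unit sphere, as cone measure: the measure of a set \<open>B\<close> of unit
  vectors is the fraction of the volume of the unit ball occupied by the cone over \<open>B\<close>.
\<close>
definition sphere_uniform :: "nat \<Rightarrow> real vec measure" where
  "sphere_uniform p =
     distr (uniform_measure (lborel_vec p) {v \<in> carrier_vec p. vnorm v \<le> 1}) (borel_vec p)
       (\<lambda>v. (1 / vnorm v) \<cdot>\<^sub>v v)"

text \<open>
  \<open>D\<close> is the law of \<open>u \<Sigma>\<^sup>1\<^sup>/\<^sup>2 V\<close>. Independence of \<open>u\<close> and \<open>V\<close> means that their joint law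
  is the product of the law \<open>U\<close> of \<open>u\<close> and the law of \<open>V\<close>.
\<close>
definition centered_elliptical :: "nat \<Rightarrow> real mat \<Rightarrow> real vec measure \<Rightarrow> bool" where
  "centered_elliptical p \<Sigma> D \<longleftrightarrow>
     pos_def p \<Sigma> \<and> mat_trace \<Sigma> = real p \<and>
     (\<exists>U :: real measure. prob_space U \<and> sets U = sets borel \<and> (AE u in U. u \<noteq> 0) \<and>
        D = distr (U \<Otimes>\<^sub>M sphere_uniform p) (borel_vec p)
              (\<lambda>(u, v). u \<cdot>\<^sub>v (mat_sqrt \<Sigma> *\<^sub>v v)))"


section \<open>Tyler's M-estimator\<close>

text \<open>
  The defining equation is written entrywise. It presupposes nonzero denominators, i.e. nonzero
  samples; this has to be demanded explicitly because division by zero is total.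
\<close>
definition tyler_solution :: "nat \<Rightarrow> nat \<Rightarrow> (nat \<Rightarrow> real vec) \<Rightarrow> real mat \<Rightarrow> bool" where
  "tyler_solution p n x T \<longleftrightarrow>
     pos_def p T \<and> mat_trace T = real p \<and> (\<forall>i<n. x i \<noteq> 0\<^sub>v p) \<and>
     mat p p (\<lambda>(a, b). real p / real n *
       (\<Sum>i<n. (x i $ a * x i $ b) / (x i \<bullet> (mat_inv T *\<^sub>v x i)))) = T"

definition tyler_exists :: "nat \<Rightarrow> nat \<Rightarrow> (nat \<Rightarrow> real vec) \<Rightarrow> bool" where
  "tyler_exists p n x \<longleftrightarrow> (\<exists>!T. tyler_solution p n x T)"

definition tyler :: "nat \<Rightarrow> nat \<Rightarrow> (nat \<Rightarrow> real vec) \<Rightarrow> real mat" where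
  "tyler p n x = (THE T. tyler_solution p n x T)"

text \<open>
  For \<open>p = 1\<close> the exponent is \<open>-\<infinity>\<close>, since \<open>ln 1 = 0\<close>. The case is separated because
  \<open>x / 0 = 0\<close> would turn the bound into the vacuous value \<open>1\<close>.
\<close>
definition failure_bound :: "real \<Rightarrow> nat \<Rightarrow> nat \<Rightarrow> real \<Rightarrow> real" where
  "failure_bound c p n \<epsilon> =
     (if p = 1 then 0 else exp (- (c * real n * \<epsilon>\<^sup>2 / (ln (real p))\<^sup>2)))"

end

theory Submission
  imports Defs "Jordan_Normal_Form.Determinant"
begin

unbundle no inner_syntax

text \<open>
  After whitening, the samples become independent uniform unit vectors \<open>y\<^sub>i\<close>, and Tyler's estimator is
  a fixed point of \<open>\<Phi>(T) = (p/n) \<Sum> y\<^sub>i y\<^sub>i\<^sup>T / (y\<^sub>i\<^sup>T T\<^sup>-\<^sup>1 y\<^sub>i)\<close>. This map is monotone and homogeneous, so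
  it can be treated as in nonlinear Perron--Frobenius theory. Two properties of the sample suffice:
  the covariance \<open>(p/n) \<Sum> y\<^sub>i y\<^sub>i\<^sup>T\<close> is within \<open>\<delta>\<close> of the identity, and for every unit vector \<open>v\<close> at least three
  quarters of the \<open>y\<^sub>i\<close> satisfy \<open>p (v \<bullet> y\<^sub>i)\<^sup>2 \<ge> a\<close> for a constant \<open>a\<close>. Any two unit vectors then share half
  of the indices. Quantitatively this makes \<open>\<Phi>\<close> preserve the set of matrices of condition
  number at most \<open>1 + O(\<delta>)\<close>; qualitatively it makes \<open>\<Phi>\<close> strictly contracting, which gives existence in that
  set and uniqueness up to scaling.

  Both properties hold with probability \<open>1 - exp(-c n \<delta>\<^sup>2)\<close> once \<open>n \<ge> C p / \<delta>\<^sup>2\<close>, by a net argument. A uniform unit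
  vector is a normalised Gaussian \<open>G\<close> whose direction is independent of its length, hence
  \<open>E (p (e \<bullet> y)\<^sup>2)\<^sup>k \<le> E (e \<bullet> G)\<^sup>2\<^sup>k\<close>, which yields the Chernoff bounds for a fixed direction \<open>e\<close>.
\<close>

section \<open>Quadratic forms\<close>

text \<open>The covariance estimate alone cannot confine the fixed-point map: from condition number
  \<open>k\<close> it only yields \<open>k (1 + d) / (1 - d)\<close>. The shared half of the indices
  supplies the missing gain, proportional to \<open>a (k - 1)\<close>, which outweighs the loss of
  order \<open>d k\<close> as soon as \<open>4 d k <= a (k - 1)\<close>. With
  \<open>k = 1 + \<epsilon>\<close> this asks for an error \<open>d\<close> of order
  \<open>a \<epsilon>\<close>.

  The logarithms enter only at the very end: \<open>ln p >= ln 2\<close> for \<open>p >= 2\<close>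
  weakens a bound free of logarithms to the stated form. For \<open>p = 1\<close> the failure bound
  is zero, and the argument there is deterministic on nonzero samples.

  A separate obstacle is that the event speaks of existence and uniqueness of a solution.
  \<open>measure\<close> is zero off the sigma-algebra, so measurability must be proved; the event
  is expressed through compact sets of candidate matrices stored together with their inverses. The
  fixed point is found by minimising over a compact set and not by iterating the map, so that
  strictness without a rate suffices.\<close>

definition sym_mat :: "nat \<Rightarrow> real mat \<Rightarrow> bool" where
  "sym_mat p A \<longleftrightarrow> A \<in> carrier_mat p p \<and> A\<^sup>T = A"

definition bil :: "real mat \<Rightarrow> real vec \<Rightarrow> real vec \<Rightarrow> real" where
  "bil A u v = u \<bullet> (A *\<^sub>v v)"

lemma sym_matD: "sym_mat p A \<Longrightarrow> A \<in> carrier_mat p p" "sym_mat p A \<Longrightarrow> A\<^sup>T = A"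
  by (auto simp: sym_mat_def)

lemma pos_def_sym: "pos_def p A \<Longrightarrow> sym_mat p A"
  by (auto simp: pos_def_def sym_mat_def)

lemma pos_defD: "pos_def p A \<Longrightarrow> v \<in> carrier_vec p \<Longrightarrow> v \<noteq> 0\<^sub>v p \<Longrightarrow> 0 < bil A v v"
  by (auto simp: pos_def_def bil_def)

lemma pos_defI:
  "sym_mat p A \<Longrightarrow> (\<And>v. v \<in> carrier_vec p \<Longrightarrow> v \<noteq> 0\<^sub>v p \<Longrightarrow> 0 < bil A v v) \<Longrightarrow> pos_def p A"
  by (auto simp: pos_def_def bil_def sym_mat_def)

lemma scalar_prod_nonneg: "0 \<le> (v :: real vec) \<bullet> v"
  by (auto simp: scalar_prod_def intro: sum_nonneg)

lemma scalar_prod_eq_0: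
  assumes "(v :: real vec) \<in> carrier_vec p" "v \<bullet> v = 0" shows "v = 0\<^sub>v p"
proof (rule eq_vecI)
  fix i assume "i < dim_vec (0\<^sub>v p :: real vec)"
  then have i: "i < p" by simp
  have "(\<Sum>i\<in>{0..<p}. v $ i * v $ i) = 0" using assms by (auto simp: scalar_prod_def)
  then have "v $ i * v $ i = 0" using i by (subst (asm) sum_nonneg_eq_0_iff) auto
  then show "v $ i = 0\<^sub>v p $ i" using i by simp
qed (use assms in auto)

lemma scalar_prod_pos:
  "(v :: real vec) \<in> carrier_vec p \<Longrightarrow> v \<noteq> 0\<^sub>v p \<Longrightarrow> 0 < v \<bullet> v"
  using scalar_prod_eq_0[of v p] scalar_prod_nonneg[of v] by (auto simp: less_le)

lemma vnorm_sq: "(vnorm v)\<^sup>2 = v \<bullet> v"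
  by (simp add: vnorm_def scalar_prod_nonneg)

lemma vnorm_nonneg [simp]: "0 \<le> vnorm v"
  by (simp add: vnorm_def scalar_prod_nonneg)

lemma vnorm_smult: "vnorm (c \<cdot>\<^sub>v v) = \<bar>c\<bar> * vnorm v"
proof -
  have "(c \<cdot>\<^sub>v v) \<bullet> (c \<cdot>\<^sub>v v) = c\<^sup>2 * (v \<bullet> v)"
    by (simp add: scalar_prod_def sum_distrib_left power2_eq_square algebra_simps)
  then show ?thesis by (simp add: vnorm_def real_sqrt_mult)
qed

lemma vnorm_pos: "v \<in> carrier_vec p \<Longrightarrow> v \<noteq> 0\<^sub>v p \<Longrightarrow> 0 < vnorm v"
  using scalar_prod_pos by (simp add: vnorm_def)

lemma vnorm_eq_0_iff: "v \<in> carrier_vec p \<Longrightarrow> vnorm v = 0 \<longleftrightarrow> v = 0\<^sub>v p"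
  using vnorm_pos[of v p] by (cases "v = 0\<^sub>v p") (auto simp: vnorm_def)

lemma vnorm_eq_1: "vnorm v = 1 \<longleftrightarrow> v \<bullet> v = 1"
  by (simp add: vnorm_def)

lemma sym_mat_entry:
  assumes "sym_mat p A" "i < p" "j < p"
  shows "A $$ (j, i) = A $$ (i, j)"
  using assms unfolding sym_mat_def by (metis carrier_matD index_transpose_mat(1))

lemma sym_mat_entryI:
  assumes "A \<in> carrier_mat p p" "\<And>i j. i < p \<Longrightarrow> j < p \<Longrightarrow> A $$ (j, i) = A $$ (i, j)"
  shows "sym_mat p A"
  using assms unfolding sym_mat_def by (auto intro!: eq_matI)

lemma bil_sum:
  assumes "A \<in> carrier_mat p p" "u \<in> carrier_vec p" "v \<in> carrier_vec p"
  shows "bil A u v = (\<Sum>a<p. \<Sum>b<p. u $ a * A $$ (a, b) * v $ b)"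
  using assms by (auto simp: bil_def scalar_prod_def sum_distrib_left lessThan_atLeast0
      mult.assoc intro!: sum.cong)

lemma bil_add_left:
  assumes "A \<in> carrier_mat p p" "u \<in> carrier_vec p" "w \<in> carrier_vec p" "v \<in> carrier_vec p"
  shows "bil A (u + w) v = bil A u v + bil A w v"
  using assms by (auto simp: bil_def intro!: add_scalar_prod_distrib)

lemma bil_add_right:
  assumes "A \<in> carrier_mat p p" "u \<in> carrier_vec p" "w \<in> carrier_vec p" "v \<in> carrier_vec p"
  shows "bil A v (u + w) = bil A v u + bil A v w"
  using assms by (auto simp: bil_def mult_add_distrib_mat_vec intro!: scalar_prod_add_distrib)

lemma bil_smult_left:
  assumes "A \<in> carrier_mat p p" "u \<in> carrier_vec p" "v \<in> carrier_vec p"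
  shows "bil A (c \<cdot>\<^sub>v u) v = c * bil A u v"
  using assms by (auto simp: bil_def)

lemma bil_smult_right:
  assumes "A \<in> carrier_mat p p" "u \<in> carrier_vec p" "v \<in> carrier_vec p"
  shows "bil A u (c \<cdot>\<^sub>v v) = c * bil A u v"
  using assms by (auto simp: bil_def mult_mat_vec)

lemma bil_smult_mat:
  assumes "A \<in> carrier_mat p p" "u \<in> carrier_vec p" "v \<in> carrier_vec p"
  shows "bil (c \<cdot>\<^sub>m A) u v = c * bil A u v"
  using assms by (simp add: bil_sum[where p = p] sum_distrib_left algebra_simps)

lemma bil_minus_mat:
  assumes "A \<in> carrier_mat p p" "B \<in> carrier_mat p p" "u \<in> carrier_vec p" "v \<in> carrier_vec p"
  shows "bil (A - B) u v = bil A u v - bil B u v"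
  using assms
  by (subst (1 2 3) bil_sum[where p = p]) (auto simp: sum_subtractf[symmetric] algebra_simps intro!: sum.cong)

lemma bil_one: "u \<in> carrier_vec p \<Longrightarrow> v \<in> carrier_vec p \<Longrightarrow> bil (1\<^sub>m p) u v = u \<bullet> v"
  by (simp add: bil_def)

lemma mult_mat_zero_vec: "A \<in> carrier_mat n p \<Longrightarrow> A *\<^sub>v 0\<^sub>v p = (0\<^sub>v n :: real vec)"
  by (intro eq_vecI) (auto simp: scalar_prod_def)

lemma bil_commute:
  assumes "sym_mat p A" "u \<in> carrier_vec p" "v \<in> carrier_vec p"
  shows "bil A u v = bil A v u"
proof -
  have "(A\<^sup>T *\<^sub>v u) \<bullet> v = u \<bullet> (A *\<^sub>v v)"
    by (rule transpose_vec_mult_scalar) (use assms in \<open>auto simp: sym_mat_def\<close>)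
  moreover have "(A *\<^sub>v u) \<bullet> v = v \<bullet> (A *\<^sub>v u)"
    by (rule comm_scalar_prod[of _ p]) (use assms in \<open>auto simp: sym_mat_def\<close>)
  ultimately show ?thesis using assms by (simp add: bil_def sym_mat_def)
qed

lemmas bil_linear = bil_add_left bil_add_right bil_smult_left bil_smult_right

lemma bil_quadratic:
  assumes "sym_mat p A" "u \<in> carrier_vec p" "w \<in> carrier_vec p"
  shows "bil A (u + t \<cdot>\<^sub>v w) (u + t \<cdot>\<^sub>v w) = bil A u u + 2 * t * bil A u w + t\<^sup>2 * bil A w w"
  using assms bil_commute[of p A u w]
  by (simp add: bil_linear[where p = p] sym_matD(1) power2_eq_square algebra_simps)

lemma bil_unit_vec:
  assumes "A \<in> carrier_mat p p" "a < p" "b < p"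
  shows "bil A (unit_vec p a) (unit_vec p b) = A $$ (a, b)"
  using assms by (simp add: bil_def)

section \<open>Semidefinite forms, inverses and norms\<close>

lemma psd_null_vector:
  assumes M: "sym_mat p M" and psd: "\<And>v. v \<in> carrier_vec p \<Longrightarrow> 0 \<le> bil M v v"
    and x: "x \<in> carrier_vec p" "bil M x x = 0"
  shows "M *\<^sub>v x = 0\<^sub>v p"
proof -
  define y where "y = M *\<^sub>v x"
  have y: "y \<in> carrier_vec p" using M x by (auto simp: y_def sym_mat_def)
  have b: "bil M x y = y \<bullet> y"
    using bil_commute[OF M x(1) y] by (simp add: bil_def y_def)
  have *: "0 \<le> 2 * t * (y \<bullet> y) + t\<^sup>2 * bil M y y" for t
    using psd[of "x + t \<cdot>\<^sub>v y"] x y bil_quadratic[OF M x(1) y, of t] b by auto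
  have "y \<bullet> y \<le> 0"
  proof (rule ccontr)
    assume "\<not> y \<bullet> y \<le> 0"
    then have pos: "0 < y \<bullet> y" by simp
    \<comment> \<open>A small negative step along \<open>y = M x\<close>: were \<open>y\<close>
      nonzero, the linear term would beat the quadratic one and make the form negative. The
      \<open>+ 1\<close> keeps the denominator positive when \<open>bil M y y = 0\<close>.\<close>
    define t where "t = - (y \<bullet> y) / (bil M y y + 1)"
    have d: "0 < bil M y y + 1" using psd[OF y] by simp
    have t: "t < 0" using pos d by (simp add: t_def divide_neg_pos)
    have "0 \<le> t * (2 * (y \<bullet> y) + t * bil M y y)"
      using *[of t] by (simp add: power2_eq_square algebra_simps)
    then have "2 * (y \<bullet> y) + t * bil M y y \<le> 0"
      using t by (simp add: zero_le_mult_iff)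
    moreover have "- t * bil M y y \<le> y \<bullet> y"
      using d pos psd[OF y] by (simp add: t_def field_simps)
    ultimately show False using pos by linarith
  qed
  then have "y \<bullet> y = 0" using scalar_prod_nonneg[of y] by linarith
  from scalar_prod_eq_0[OF y this] show ?thesis by (simp add: y_def)
qed

text \<open>Definiteness passes to the inverse by the substitution \<open>v = A z\<close>, under
  which the two forms agree. Symmetry follows because the transpose of the inverse is again a left
  inverse of \<open>A\<close>.\<close>

lemma pos_def_inverse:
  assumes "pos_def p A"
  shows "mat_inverse A = Some (mat_inv A)" "pos_def p (mat_inv A)"
    "A * mat_inv A = 1\<^sub>m p" "mat_inv A * A = 1\<^sub>m p"
proof -
  have A: "A \<in> carrier_mat p p" and s: "sym_mat p A" using assms by (auto simp: pos_def_def sym_mat_def)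
  have "det A \<noteq> 0"
  proof
    assume "det A = 0"
    then obtain v where v: "v \<in> carrier_vec p" "v \<noteq> 0\<^sub>v p" "A *\<^sub>v v = 0\<^sub>v p"
      using det_0_iff_vec_prod_zero[OF A] by auto
    then show False using pos_defD[OF assms v(1,2)] by (simp add: bil_def)
  qed
  then have "A \<in> Units (ring_mat TYPE(real) p ())" using det_non_zero_imp_unit[OF A] by simp
  then show S: "mat_inverse A = Some (mat_inv A)" using mat_inverse(1)[OF A, of "()"] by (cases "mat_inverse A") auto
  note I = mat_inverse(2)[OF A S]
  then show 1: "A * mat_inv A = 1\<^sub>m p" "mat_inv A * A = 1\<^sub>m p" by auto
  have C: "mat_inv A \<in> carrier_mat p p" using I by auto
  have "(mat_inv A)\<^sup>T * A = 1\<^sub>m p"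
    using arg_cong[OF 1(1), of transpose_mat] transpose_mult[OF A C] sym_matD(2)[OF s] by simp
  then have "(mat_inv A)\<^sup>T * A * mat_inv A = mat_inv A" using C by simp
  moreover have "(mat_inv A)\<^sup>T * A * mat_inv A = (mat_inv A)\<^sup>T"
    using A C 1(1) assoc_mult_mat[of "(mat_inv A)\<^sup>T" p p A p "mat_inv A" p] by simp
  ultimately have sC: "sym_mat p (mat_inv A)" using C by (simp add: sym_mat_def)
  show "pos_def p (mat_inv A)"
  proof (rule pos_defI[OF sC])
    fix v :: "real vec" assume v: "v \<in> carrier_vec p" "v \<noteq> 0\<^sub>v p"
    define z where "z = mat_inv A *\<^sub>v v"
    have z: "z \<in> carrier_vec p" using C v by (auto simp: z_def)
    have Az: "A *\<^sub>v z = v" unfolding z_def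
      by (metis A C v(1) 1(1) assoc_mult_mat_vec one_mult_mat_vec)
    have "z \<noteq> 0\<^sub>v p" using Az v A by auto
    then have "0 < bil A z z" using pos_defD[OF assms z] by simp
    also have "bil A z z = bil (mat_inv A) v v"
      using z v by (simp add: bil_def Az z_def[symmetric] comm_scalar_prod[of z p v])
    finally show "0 < bil (mat_inv A) v v" .
  qed
qed

lemma mat_inverse_eqI:
  assumes "A \<in> carrier_mat p p" "B \<in> carrier_mat p p" "A * B = 1\<^sub>m p" "pos_def p A"
  shows "mat_inv A = B"
proof -
  have C: "mat_inv A \<in> carrier_mat p p" using pos_def_inverse(2)[OF assms(4)] by (simp add: pos_def_def)
  have "mat_inv A * (A * B) = mat_inv A * A * B" by (rule assoc_mult_mat[symmetric, OF C assms(1,2)])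
  then show ?thesis using pos_def_inverse(4)[OF assms(4)] assms(2,3) C by simp
qed

text \<open>The nonnegative form \<open>T'\<close> is evaluated at \<open>z - b y\<close> with
  \<open>z = P x\<close> and \<open>y = P' x\<close>: the mixed term is the form of \<open>P\<close>
  at \<open>x\<close>, the term in \<open>y\<close> is that of \<open>P'\<close>, and the term in
  \<open>z\<close> is controlled by \<open>le\<close>. The argument is free of square roots and
  diagonalisation.\<close>

lemma inverse_antimono:
  assumes T: "sym_mat p T" and T': "sym_mat p T'" and P: "sym_mat p P" and P': "sym_mat p P'"
    and inv: "T * P = 1\<^sub>m p" "T' * P' = 1\<^sub>m p" and b: "0 < b"
    and psd: "\<And>v. v \<in> carrier_vec p \<Longrightarrow> 0 \<le> bil T' v v"
    and le: "\<And>v. v \<in> carrier_vec p \<Longrightarrow> bil T' v v \<le> b * bil T v v"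
    and x: "x \<in> carrier_vec p"
  shows "bil P x x \<le> b * bil P' x x"
proof -
  note c = sym_matD(1)[OF T] sym_matD(1)[OF T'] sym_matD(1)[OF P] sym_matD(1)[OF P']
  define z where "z = P *\<^sub>v x"
  define y where "y = P' *\<^sub>v x"
  have z: "z \<in> carrier_vec p" and y: "y \<in> carrier_vec p" using c x by (auto simp: z_def y_def)
  have Tz: "T *\<^sub>v z = x" unfolding z_def by (metis c(1,3) x inv(1) assoc_mult_mat_vec one_mult_mat_vec)
  have Ty: "T' *\<^sub>v y = x" unfolding y_def by (metis c(2,4) x inv(2) assoc_mult_mat_vec one_mult_mat_vec)
  have 1: "bil T z z = bil P x x"
    using z x by (simp add: bil_def Tz z_def[symmetric] comm_scalar_prod[of z p x])
  have 2: "bil T' z y = bil P x x"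
    using z x by (simp add: bil_def Ty z_def[symmetric] comm_scalar_prod[of z p x])
  have 3: "bil T' y y = bil P' x x"
    using y x by (simp add: bil_def Ty y_def[symmetric] comm_scalar_prod[of y p x])
  have "0 \<le> bil T' (z + (-b) \<cdot>\<^sub>v y) (z + (-b) \<cdot>\<^sub>v y)" using psd z y by simp
  also have "\<dots> = bil T' z z - 2 * b * bil P x x + b\<^sup>2 * bil P' x x"
    by (subst bil_quadratic[OF T' z y]) (simp add: 2 3)
  also have "\<dots> \<le> b * bil P x x - 2 * b * bil P x x + b\<^sup>2 * bil P' x x"
    using le[OF z] 1 by simp
  also have "\<dots> = b * (b * bil P' x x - bil P x x)" by (simp add: power2_eq_square algebra_simps)
  finally show ?thesis using b by (simp add: zero_le_mult_iff)
qed

text \<open>Polarisation: \<open>4 bil M x y\<close> is a difference of two values of the quadratic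
  form, and the parallelogram law bounds them by squared norms; normalising \<open>u\<close> and
  \<open>v\<close> turns the sum of squares into a product. The case of the identity matrix with
  \<open>t = 1\<close> is the Cauchy-Schwarz inequality.\<close>

lemma symmetric_bil_bound:
  assumes M: "sym_mat p M" and t: "0 \<le> t" and q: "\<And>v. v \<in> carrier_vec p \<Longrightarrow> \<bar>bil M v v\<bar> \<le> t * (v \<bullet> v)"
    and u: "u \<in> carrier_vec p" and v: "v \<in> carrier_vec p"
  shows "\<bar>bil M u v\<bar> \<le> t * vnorm u * vnorm v"
proof -
  have *: "\<bar>bil M x y\<bar> \<le> t * (x \<bullet> x + y \<bullet> y) / 2" if x: "x \<in> carrier_vec p" and y: "y \<in> carrier_vec p" for x y
  proof -
    have I: "sym_mat p (1\<^sub>m p)" by (simp add: sym_mat_def)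
    have "bil M (x + 1 \<cdot>\<^sub>v y) (x + 1 \<cdot>\<^sub>v y) - bil M (x + (-1) \<cdot>\<^sub>v y) (x + (-1) \<cdot>\<^sub>v y) = 4 * bil M x y"
      unfolding bil_quadratic[OF M x y] by simp
    moreover have "bil (1\<^sub>m p) (x + 1 \<cdot>\<^sub>v y) (x + 1 \<cdot>\<^sub>v y) + bil (1\<^sub>m p) (x + (-1) \<cdot>\<^sub>v y) (x + (-1) \<cdot>\<^sub>v y)
       = 2 * (x \<bullet> x + y \<bullet> y)"
      unfolding bil_quadratic[OF I x y] using x y by (simp add: bil_one)
    moreover have "\<bar>bil M (x + 1 \<cdot>\<^sub>v y) (x + 1 \<cdot>\<^sub>v y)\<bar> \<le> t * bil (1\<^sub>m p) (x + 1 \<cdot>\<^sub>v y) (x + 1 \<cdot>\<^sub>v y)"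
      "\<bar>bil M (x + (-1) \<cdot>\<^sub>v y) (x + (-1) \<cdot>\<^sub>v y)\<bar> \<le> t * bil (1\<^sub>m p) (x + (-1) \<cdot>\<^sub>v y) (x + (-1) \<cdot>\<^sub>v y)"
      using q x y by (simp_all add: bil_one)
    ultimately have "\<bar>4 * bil M x y\<bar> \<le> t * (2 * (x \<bullet> x + y \<bullet> y))"
      by (smt (verit, ccfv_SIG) distrib_left)
    then show ?thesis by (simp add: algebra_simps)
  qed
  show ?thesis
  proof (cases "u = 0\<^sub>v p \<or> v = 0\<^sub>v p")
    case True
    then have "bil M u v = 0" using u v sym_matD(1)[OF M] by (auto simp: bil_def mult_mat_zero_vec)
    then show ?thesis using t by simp
  next
    case False
    then have nu: "0 < vnorm u" and nv: "0 < vnorm v" using vnorm_pos u v by auto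
    have uu: "((1 / vnorm u) \<cdot>\<^sub>v u) \<bullet> ((1 / vnorm u) \<cdot>\<^sub>v u) = 1"
      and vv: "((1 / vnorm v) \<cdot>\<^sub>v v) \<bullet> ((1 / vnorm v) \<cdot>\<^sub>v v) = 1"
      unfolding vnorm_eq_1[symmetric] vnorm_smult using nu nv by auto
    have "\<bar>bil M ((1 / vnorm u) \<cdot>\<^sub>v u) ((1 / vnorm v) \<cdot>\<^sub>v v)\<bar> \<le> t * (1 + 1) / 2"
      using *[of "(1 / vnorm u) \<cdot>\<^sub>v u" "(1 / vnorm v) \<cdot>\<^sub>v v"] u v uu vv by auto
    moreover have "bil M ((1 / vnorm u) \<cdot>\<^sub>v u) ((1 / vnorm v) \<cdot>\<^sub>v v) = bil M u v / (vnorm u * vnorm v)"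
      using u v sym_matD(1)[OF M] by (simp add: bil_linear[where p = p])
    ultimately have "\<bar>bil M u v\<bar> / (vnorm u * vnorm v) \<le> t" using nu nv by (simp add: abs_divide)
    then show ?thesis using nu nv by (simp add: field_simps)
  qed
qed

lemma scalar_prod_cauchy_schwarz:
  assumes "u \<in> carrier_vec p" "v \<in> carrier_vec p"
  shows "\<bar>u \<bullet> v\<bar> \<le> vnorm u * vnorm v"
  using symmetric_bil_bound[of p "1\<^sub>m p" 1 u v] assms
  by (auto simp: sym_mat_def bil_one scalar_prod_nonneg)

lemma symmetric_vnorm_bound:
  assumes M: "sym_mat p M" and t: "0 \<le> t" and q: "\<And>v. v \<in> carrier_vec p \<Longrightarrow> \<bar>bil M v v\<bar> \<le> t * (v \<bullet> v)"
    and v: "v \<in> carrier_vec p"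
  shows "vnorm (M *\<^sub>v v) \<le> t * vnorm v"
proof -
  define y where "y = M *\<^sub>v v"
  have y: "y \<in> carrier_vec p" using sym_matD(1)[OF M] v by (auto simp: y_def)
  have "(vnorm y)\<^sup>2 = bil M y v" by (simp add: vnorm_sq bil_def y_def)
  also have "\<dots> \<le> t * vnorm y * vnorm v" using symmetric_bil_bound[OF M t q y v] by simp
  finally have "vnorm y * vnorm y \<le> vnorm y * (t * vnorm v)" by (simp add: power2_eq_square algebra_simps)
  then have "vnorm y \<le> t * vnorm v \<or> vnorm y = 0"
    by (metis mult_le_cancel_left_pos less_le vnorm_nonneg)
  then show ?thesis using t by (auto simp: y_def)
qed

lemma op_norm_le:
  assumes M: "sym_mat p M" and t: "0 \<le> t" and q: "\<And>v. v \<in> carrier_vec p \<Longrightarrow> \<bar>bil M v v\<bar> \<le> t * (v \<bullet> v)"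
  shows "op_norm M \<le> t"
  unfolding op_norm_def
proof (rule cSup_least)
  \<comment> \<open>A supremum of reals is only informative on a nonempty set; the zero vector
    supplies an element for every \<open>p\<close>.\<close>
  have "vnorm (0\<^sub>v p :: real vec) \<le> 1" by (simp add: vnorm_def)
  then show "{vnorm (M *\<^sub>v v) | v. v \<in> carrier_vec (dim_col M) \<and> vnorm v \<le> 1} \<noteq> {}"
    using sym_matD(1)[OF M] zero_carrier_vec[of p] by blast
next
  fix x assume "x \<in> {vnorm (M *\<^sub>v v) | v. v \<in> carrier_vec (dim_col M) \<and> vnorm v \<le> 1}"
  then obtain v where v: "x = vnorm (M *\<^sub>v v)" "v \<in> carrier_vec p" "vnorm v \<le> 1"
    using sym_matD(1)[OF M] by auto
  show "x \<le> t" using symmetric_vnorm_bound[OF M t q v(2)] v t mult_left_mono[OF v(3) t] by simp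
qed

section \<open>Compactness and generalised Rayleigh quotients\<close>

lemma mat_trace_mult:
  assumes "A \<in> carrier_mat p q" "B \<in> carrier_mat q p"
  shows "mat_trace (A * B) = (\<Sum>i<p. \<Sum>j<q. A $$ (i, j) * B $$ (j, i))"
  using assms by (auto simp: mat_trace_def scalar_prod_def lessThan_atLeast0 intro!: sum.cong)

lemma mat_trace_mult_commute:
  assumes "A \<in> carrier_mat p q" "B \<in> carrier_mat q p"
  shows "mat_trace (A * B) = mat_trace (B * A)"
  unfolding mat_trace_mult[OF assms] mat_trace_mult[OF assms(2,1)]
  by (subst sum.swap) (simp add: mult.commute)

lemma mat_trace_add:
  assumes "A \<in> carrier_mat p p" "B \<in> carrier_mat p p"
  shows "mat_trace (A + B) = mat_trace A + mat_trace B"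
  using assms by (simp add: mat_trace_def sum.distrib)

lemma mat_trace_smult:
  assumes "A \<in> carrier_mat p p"
  shows "mat_trace (c \<cdot>\<^sub>m A) = c * mat_trace A"
  using assms by (simp add: mat_trace_def sum_distrib_left)

lemma mat_trace_bil:
  assumes "A \<in> carrier_mat p p"
  shows "mat_trace A = (\<Sum>a<p. bil A (unit_vec p a) (unit_vec p a))"
  using assms by (simp add: mat_trace_def bil_unit_vec)

lemma bil_conj:
  assumes B: "sym_mat p B" and A: "A \<in> carrier_mat p p" and u: "u \<in> carrier_vec p" and v: "v \<in> carrier_vec p"
  shows "bil (B * A * B) u v = bil A (B *\<^sub>v u) (B *\<^sub>v v)"
proof -
  have c: "B \<in> carrier_mat p p" by (rule sym_matD(1)[OF B])
  have Bu: "B *\<^sub>v u \<in> carrier_vec p" by (rule mult_mat_vec_carrier[OF c u])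
  have Bv: "B *\<^sub>v v \<in> carrier_vec p" by (rule mult_mat_vec_carrier[OF c v])
  have ABv: "A *\<^sub>v (B *\<^sub>v v) \<in> carrier_vec p" by (rule mult_mat_vec_carrier[OF A Bv])
  have "(B * A * B) *\<^sub>v v = B *\<^sub>v (A *\<^sub>v (B *\<^sub>v v))"
    by (simp only: assoc_mult_mat_vec[OF mult_carrier_mat[OF c A] c v] assoc_mult_mat_vec[OF c A Bv])
  then have "bil (B * A * B) u v = bil B u (A *\<^sub>v (B *\<^sub>v v))" by (simp only: bil_def)
  also have "\<dots> = bil B (A *\<^sub>v (B *\<^sub>v v)) u" by (rule bil_commute[OF B u ABv])
  also have "\<dots> = bil A (B *\<^sub>v u) (B *\<^sub>v v)"
    unfolding bil_def by (rule comm_scalar_prod[OF ABv Bu])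
  finally show ?thesis .
qed

lemma mat_trace_conj:
  assumes B: "sym_mat p B" and A: "A \<in> carrier_mat p p"
  shows "mat_trace (B * A * B) = (\<Sum>a<p. bil A (B *\<^sub>v unit_vec p a) (B *\<^sub>v unit_vec p a))"
proof -
  have c: "B \<in> carrier_mat p p" by (rule sym_matD(1)[OF B])
  show ?thesis
    by (simp only: mat_trace_bil[OF mult_carrier_mat[OF mult_carrier_mat[OF c A] c]]
        bil_conj[OF B A unit_vec_carrier unit_vec_carrier])
qed

text \<open>Bolzano-Weierstrass in finitely many coordinates, one extraction per coordinate. Since
  the dimension is a value, convergence of vectors and matrices is expressed through such
  coordinatewise limits.\<close>

lemma bounded_family_convergent_subseq:
  fixes f :: "nat \<Rightarrow> 'c \<Rightarrow> real"
  assumes "finite I" "\<And>k c. c \<in> I \<Longrightarrow> \<bar>f k c\<bar> \<le> B"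
  shows "\<exists>l r. strict_mono (r :: nat \<Rightarrow> nat) \<and> (\<forall>c\<in>I. (\<lambda>k. f (r k) c) \<longlonglongrightarrow> l c)"
  using assms
proof (induction I rule: finite_induct)
  case empty
  show ?case by (auto intro: exI[of _ id] strict_mono_id)
next
  case (insert x I)
  then obtain l r where r: "strict_mono (r :: nat \<Rightarrow> nat)" "\<forall>c\<in>I. (\<lambda>k. f (r k) c) \<longlonglongrightarrow> l c" by auto
  have "bounded (range (\<lambda>k. f (r k) x))" using insert.prems[of x] by (auto simp: bounded_iff)
  from bounded_imp_convergent_subsequence[OF this]
  obtain m s where s: "strict_mono (s :: nat \<Rightarrow> nat)" "((\<lambda>k. f (r k) x) \<circ> s) \<longlonglongrightarrow> m" by auto
  have "(\<lambda>k. f ((r \<circ> s) k) c) \<longlonglongrightarrow> (if c = x then m else l c)" if "c \<in> insert x I" for c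
  proof (cases "c = x")
    case True then show ?thesis using s by (simp add: o_def)
  next
    case False
    then have "((\<lambda>k. f (r k) c) \<circ> s) \<longlonglongrightarrow> l c" using that r by (intro LIMSEQ_subseq_LIMSEQ s) auto
    then show ?thesis using False by (simp add: o_def)
  qed
  moreover have "strict_mono (r \<circ> s)" by (rule strict_mono_o[OF r(1) s(1)])
  ultimately show ?case by (intro exI[of _ "\<lambda>c. if c = x then m else l c"] exI[of _ "r \<circ> s"]) (simp add: o_def)
qed

text \<open>Membership in the carrier is part of the notion, so that a convergent sequence never
  changes its dimension.\<close>

definition vconv :: "nat \<Rightarrow> (nat \<Rightarrow> real vec) \<Rightarrow> real vec \<Rightarrow> bool" where
  "vconv p f l \<longleftrightarrow> (\<forall>k. f k \<in> carrier_vec p) \<and> l \<in> carrier_vec p \<and> (\<forall>a<p. (\<lambda>k. f k $ a) \<longlonglongrightarrow> l $ a)"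

definition mconv :: "nat \<Rightarrow> (nat \<Rightarrow> real mat) \<Rightarrow> real mat \<Rightarrow> bool" where
  "mconv p f l \<longleftrightarrow> (\<forall>k. f k \<in> carrier_mat p p) \<and> l \<in> carrier_mat p p \<and>
     (\<forall>a<p. \<forall>b<p. (\<lambda>k. f k $$ (a, b)) \<longlonglongrightarrow> l $$ (a, b))"

lemma vconv_const: "v \<in> carrier_vec p \<Longrightarrow> vconv p (\<lambda>_. v) v"
  by (simp add: vconv_def)

lemma mconv_const: "A \<in> carrier_mat p p \<Longrightarrow> mconv p (\<lambda>_. A) A"
  by (simp add: mconv_def)

lemma mconv_subseq: "mconv p f l \<Longrightarrow> strict_mono r \<Longrightarrow> mconv p (f \<circ> r) l"
  unfolding mconv_def using LIMSEQ_subseq_LIMSEQ[of "\<lambda>k. f k $$ _"] by (auto simp: o_def)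

lemma bil_tendsto:
  assumes "mconv p A L" "vconv p u m" "vconv p v n"
  shows "(\<lambda>k. bil (A k) (u k) (v k)) \<longlonglongrightarrow> bil L m n"
proof -
  have "(\<lambda>k. \<Sum>a<p. \<Sum>b<p. u k $ a * A k $$ (a, b) * v k $ b) \<longlonglongrightarrow> (\<Sum>a<p. \<Sum>b<p. m $ a * L $$ (a, b) * n $ b)"
    using assms by (intro tendsto_intros) (auto simp: vconv_def mconv_def)
  then show ?thesis
    using assms by (auto simp: bil_sum[where p = p] vconv_def mconv_def)
qed

lemma scalar_prod_tendsto:
  assumes "vconv p u m" "vconv p v n"
  shows "(\<lambda>k. u k \<bullet> v k) \<longlonglongrightarrow> m \<bullet> n"
  using bil_tendsto[OF mconv_const[of "1\<^sub>m p"] assms] assms by (auto simp: bil_one vconv_def)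

lemma mconv_mult:
  assumes "mconv p A L" "mconv p B M"
  shows "mconv p (\<lambda>k. A k * B k) (L * M)"
proof -
  have "(\<lambda>k. \<Sum>j<p. A k $$ (a, j) * B k $$ (j, b)) \<longlonglongrightarrow> (\<Sum>j<p. L $$ (a, j) * M $$ (j, b))"
    if "a < p" "b < p" for a b
    using assms that by (intro tendsto_intros) (auto simp: mconv_def)
  moreover have "(A k * B k) $$ (a, b) = (\<Sum>j<p. A k $$ (a, j) * B k $$ (j, b))"
    "(L * M) $$ (a, b) = (\<Sum>j<p. L $$ (a, j) * M $$ (j, b))" if "a < p" "b < p" for a b k
  proof -
    have "A k \<in> carrier_mat p p" "B k \<in> carrier_mat p p" "L \<in> carrier_mat p p" "M \<in> carrier_mat p p"
      using assms by (auto simp: mconv_def)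
    then show "(A k * B k) $$ (a, b) = (\<Sum>j<p. A k $$ (a, j) * B k $$ (j, b))"
    "(L * M) $$ (a, b) = (\<Sum>j<p. L $$ (a, j) * M $$ (j, b))"
      using that by (auto simp: scalar_prod_def lessThan_atLeast0)
  qed
  moreover have "A k * B k \<in> carrier_mat p p" "L * M \<in> carrier_mat p p" for k
    using assms by (auto simp: mconv_def intro!: mult_carrier_mat[of _ p p])
  ultimately show ?thesis by (simp add: mconv_def)
qed

lemma mconv_unique:
  assumes "mconv p A L" "mconv p A M"
  shows "L = M"
proof (rule eq_matI)
  fix i j assume "i < dim_row M" "j < dim_col M"
  then have "i < p" "j < p" using assms by (auto simp: mconv_def)
  then have "(\<lambda>k. A k $$ (i, j)) \<longlonglongrightarrow> L $$ (i, j)" "(\<lambda>k. A k $$ (i, j)) \<longlonglongrightarrow> M $$ (i, j)"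
    using assms by (auto simp: mconv_def)
  then show "L $$ (i, j) = M $$ (i, j)" by (rule LIMSEQ_unique)
qed (use assms in \<open>auto simp: mconv_def\<close>)

lemma mconv_sym:
  assumes "mconv p A L" "\<And>k. sym_mat p (A k)"
  shows "sym_mat p L"
proof -
  have "L\<^sup>T = L"
  proof (rule eq_matI)
    fix i j assume "i < dim_row L" "j < dim_col L"
    then have ij: "i < p" "j < p" using assms(1) by (auto simp: mconv_def)
    have "A k $$ (i, j) = A k $$ (j, i)" for k
    proof -
      have "(A k)\<^sup>T $$ (i, j) = A k $$ (j, i)" using ij sym_matD(1)[OF assms(2)[of k]] by simp
      then show ?thesis using sym_matD(2)[OF assms(2)[of k]] by simp
    qed
    then have "(\<lambda>k. A k $$ (i, j)) \<longlonglongrightarrow> L $$ (j, i)" using assms(1) ij by (simp add: mconv_def)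
    moreover have "(\<lambda>k. A k $$ (i, j)) \<longlonglongrightarrow> L $$ (i, j)" using assms(1) ij by (simp add: mconv_def)
    ultimately have "L $$ (j, i) = L $$ (i, j)" by (rule LIMSEQ_unique)
    then show "L\<^sup>T $$ (i, j) = L $$ (i, j)" using ij assms(1) by (auto simp: mconv_def)
  qed (use assms in \<open>auto simp: mconv_def\<close>)
  then show ?thesis using assms by (auto simp: sym_mat_def mconv_def)
qed

lemma mconv_trace:
  assumes "mconv p A L"
  shows "(\<lambda>k. mat_trace (A k)) \<longlonglongrightarrow> mat_trace L"
proof -
  have "(\<lambda>k. \<Sum>i<p. A k $$ (i, i)) \<longlonglongrightarrow> (\<Sum>i<p. L $$ (i, i))"
    using assms by (intro tendsto_intros) (auto simp: mconv_def)
  moreover have "dim_row (A k) = p" "dim_row L = p" for k using assms by (auto simp: mconv_def)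
  ultimately show ?thesis by (simp add: mat_trace_def)
qed

lemma bounded_mat_convergent_subseq:
  assumes "\<And>k. A k \<in> carrier_mat p p" "\<And>k a b. a < p \<Longrightarrow> b < p \<Longrightarrow> \<bar>A k $$ (a, b)\<bar> \<le> B"
  shows "\<exists>L r. strict_mono (r :: nat \<Rightarrow> nat) \<and> mconv p (A \<circ> r) L"
proof -
  have "\<exists>l r. strict_mono (r :: nat \<Rightarrow> nat) \<and> (\<forall>c\<in>{..<p} \<times> {..<p}. (\<lambda>k. A (r k) $$ c) \<longlonglongrightarrow> l c)"
    by (rule bounded_family_convergent_subseq[where B = B]) (use assms in auto)
  then obtain l r where r: "strict_mono (r :: nat \<Rightarrow> nat)"
    "\<forall>c\<in>{..<p} \<times> {..<p}. (\<lambda>k. A (r k) $$ c) \<longlonglongrightarrow> l c" by auto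
  then have "mconv p (A \<circ> r) (mat p p l)" using assms by (auto simp: mconv_def)
  then show ?thesis using r by blast
qed

lemma unit_vec_coord_bound:
  assumes "v \<in> carrier_vec p" "v \<bullet> v = (1 :: real)" "a < p"
  shows "\<bar>v $ a\<bar> \<le> 1"
proof -
  have "(v $ a)\<^sup>2 \<le> (\<Sum>i\<in>{0..<p}. (v $ i)\<^sup>2)"
    using assms by (intro member_le_sum) auto
  also have "\<dots> = 1" using assms by (simp add: scalar_prod_def power2_eq_square)
  finally show ?thesis by (simp add: abs_square_le_1)
qed

text \<open>Compactness is claimed for the real image of the sphere, so that sequential continuity
  of \<open>F\<close> along coordinatewise limits is enough to make maxima attained.\<close>

lemma sphere_image_compact:
  assumes cont: "\<And>f l. (\<And>k. f k \<bullet> f k = 1) \<Longrightarrow> l \<bullet> l = 1 \<Longrightarrow> vconv p f l \<Longrightarrow> (\<lambda>k. F (f k) :: real) \<longlonglongrightarrow> F l"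
  shows "compact {F v | v. v \<in> carrier_vec p \<and> v \<bullet> v = (1 :: real)}" (is "compact ?S")
proof (rule iffD2[OF compact_def], intro allI impI)
  fix g :: "nat \<Rightarrow> real" assume "\<forall>n. g n \<in> ?S"
  then have "\<forall>n. \<exists>v. g n = F v \<and> v \<in> carrier_vec p \<and> v \<bullet> v = 1" by blast
  then obtain f where f: "\<And>n. g n = F (f n)" "\<And>n. f n \<in> carrier_vec p" "\<And>n. f n \<bullet> f n = 1" by metis
  have "\<exists>l r. strict_mono (r :: nat \<Rightarrow> nat) \<and> (\<forall>c\<in>{..<p}. (\<lambda>k. f (r k) $ c) \<longlonglongrightarrow> l c)"
    by (rule bounded_family_convergent_subseq[where B = 1]) (simp, use unit_vec_coord_bound[OF f(2,3)] in blast)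
  then obtain l r where r: "strict_mono (r :: nat \<Rightarrow> nat)" "\<forall>c\<in>{..<p}. (\<lambda>k. f (r k) $ c) \<longlonglongrightarrow> l c" by auto
  have c: "vconv p (\<lambda>k. f (r k)) (vec p l)" using r f by (auto simp: vconv_def)
  have u: "vec p l \<bullet> vec p l = 1"
    using scalar_prod_tendsto[OF c c] f(3) by (simp add: LIMSEQ_const_iff)
  have "(g \<circ> r) \<longlonglongrightarrow> F (vec p l)" using cont[OF _ u c] f(1,3) by (simp add: o_def)
  then show "\<exists>l\<in>?S. \<exists>r. strict_mono r \<and> (g \<circ> r) \<longlonglongrightarrow> l" using r(1) u by fastforce
qed

lemma unit_vec_sphere: "1 \<le> p \<Longrightarrow> \<exists>v. v \<in> carrier_vec p \<and> v \<bullet> v = (1 :: real)"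
  by (rule exI[of _ "unit_vec p 0"]) auto

lemma normalized_bil:
  assumes "A \<in> carrier_mat p p" "v \<in> carrier_vec p" "v \<noteq> 0\<^sub>v p"
  shows "bil A ((1 / vnorm v) \<cdot>\<^sub>v v) ((1 / vnorm v) \<cdot>\<^sub>v v) = bil A v v / (v \<bullet> v)"
    "((1 / vnorm v) \<cdot>\<^sub>v v) \<bullet> ((1 / vnorm v) \<cdot>\<^sub>v v) = 1"
  using assms vnorm_pos[OF assms(2,3)]
  by (simp_all add: bil_linear[where p = p] vnorm_eq_1[symmetric] vnorm_smult vnorm_sq[symmetric]
      power2_eq_square del: smult_scalar_prod_distrib scalar_prod_smult_distrib
      scalar_prod_smult_left scalar_prod_smult_right)

text \<open>\<open>b\<close> is the largest eigenvalue of \<open>T'\<close> relative to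
  \<open>T\<close>, found as the maximum of a quotient on the sphere. Attainment at some
  \<open>v\<close> matters as much as the bound: a strict inequality at this \<open>v\<close> is
  what later contradicts extremality.\<close>

lemma generalized_rayleigh_max:
  assumes p: "1 \<le> p" and T: "pos_def p T" and T': "T' \<in> carrier_mat p p"
  shows "\<exists>b v. v \<in> carrier_vec p \<and> v \<noteq> 0\<^sub>v p \<and> bil T' v v = b * bil T v v \<and>
    (\<forall>u \<in> carrier_vec p. bil T' u u \<le> b * bil T u u)"
proof -
  have Tc: "T \<in> carrier_mat p p" using T by (simp add: pos_def_def)
  define F where "F v = bil T' v v / bil T v v" for v
  let ?S = "{F v | v. v \<in> carrier_vec p \<and> v \<bullet> v = (1 :: real)}"
  have nz: "v \<noteq> 0\<^sub>v p" if "v \<bullet> v = (1 :: real)" for v using that by auto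
  have pos: "0 < bil T v v" if "v \<in> carrier_vec p" "v \<bullet> v = 1" for v using pos_defD[OF T] nz that by auto
  have "compact ?S"
  proof (rule sphere_image_compact)
    fix f l assume "l \<bullet> l = (1 :: real)" "vconv p f l"
    then show "(\<lambda>k. F (f k)) \<longlonglongrightarrow> F l" unfolding F_def
      using pos[of l] by (intro tendsto_divide bil_tendsto mconv_const T' Tc) (use T' Tc in \<open>auto simp: vconv_def\<close>)
  qed
  moreover have "?S \<noteq> {}" using unit_vec_sphere[OF p] by blast
  ultimately obtain b where "b \<in> ?S" and max: "\<forall>t\<in>?S. t \<le> b" using compact_attains_sup by blast
  then obtain v where v: "b = F v" "v \<in> carrier_vec p" "v \<bullet> v = 1" by auto
  have "bil T' u u \<le> b * bil T u u" if u: "u \<in> carrier_vec p" for u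
  proof (cases "u = 0\<^sub>v p")
    case True then show ?thesis using T' Tc by (simp add: bil_def mult_mat_zero_vec)
  next
    case False
    let ?w = "(1 / vnorm u) \<cdot>\<^sub>v u"
    have "F ?w \<le> b" using max normalized_bil(2)[OF Tc u False] u by (metis (mono_tags, lifting) mem_Collect_eq smult_carrier_vec)
    moreover have "F ?w = bil T' u u / bil T u u"
      unfolding F_def normalized_bil(1)[OF Tc u False] normalized_bil(1)[OF T' u False]
      using scalar_prod_pos[OF u False] by simp
    ultimately show ?thesis using pos_defD[OF T u False] by (simp add: field_simps)
  qed
  then show ?thesis using v nz[OF v(3)] pos[OF v(2,3)] by (intro exI[of _ b] exI[of _ v]) (auto simp: F_def)
qed

text \<open>The roles are exchanged: the maximum of the identity relative to \<open>A\<close>,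
  inverted, is the smallest eigenvalue.\<close>

lemma pos_def_lower:
  assumes p: "1 \<le> p" and A: "pos_def p A"
  shows "\<exists>e>0. \<forall>v \<in> carrier_vec p. e * (v \<bullet> v) \<le> bil A v v"
proof -
  obtain b v where v: "v \<in> carrier_vec p" "v \<noteq> 0\<^sub>v p" "bil (1\<^sub>m p) v v = b * bil A v v"
    and le: "\<forall>u \<in> carrier_vec p. bil (1\<^sub>m p) u u \<le> b * bil A u u"
    using generalized_rayleigh_max[OF p A, of "1\<^sub>m p"] by auto
  have "0 < b" using v scalar_prod_pos[OF v(1,2)] pos_defD[OF A v(1,2)] by (simp add: bil_one zero_less_mult_iff)
  then show ?thesis using le by (intro exI[of _ "1 / b"]) (auto simp: bil_one field_simps)
qed

lemma pos_def_one: "pos_def p (1\<^sub>m p)"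
  by (rule pos_defI) (auto simp: sym_mat_def bil_one scalar_prod_pos)

lemma pos_def_upper:
  assumes p: "1 \<le> p" and A: "pos_def p A"
  shows "\<exists>c>0. \<forall>v \<in> carrier_vec p. bil A v v \<le> c * (v \<bullet> v)"
proof -
  obtain b v where v: "v \<in> carrier_vec p" "v \<noteq> 0\<^sub>v p" "bil A v v = b * bil (1\<^sub>m p) v v"
    and le: "\<forall>u \<in> carrier_vec p. bil A u u \<le> b * bil (1\<^sub>m p) u u"
    using generalized_rayleigh_max[OF p pos_def_one, of A] A by (auto simp: pos_def_def)
  have "0 < b" using v scalar_prod_pos[OF v(1,2)] pos_defD[OF A v(1,2)] by (simp add: bil_one zero_less_mult_iff)
  then show ?thesis using le by (intro exI[of _ b]) (auto simp: bil_one)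
qed

section \<open>Square roots of positive-definite matrices\<close>

lemma mult_mat_entry:
  assumes "A \<in> carrier_mat n q" "B \<in> carrier_mat q m" "i < n" "j < m"
  shows "(A * B) $$ (i, j) = (\<Sum>l<q. A $$ (i, l) * B $$ (l, j))"
  using assms by (auto simp: scalar_prod_def lessThan_atLeast0)

lemma pow_mat_vnorm_bound:
  assumes N: "sym_mat p N" and t: "0 \<le> t" and q: "\<And>v. v \<in> carrier_vec p \<Longrightarrow> \<bar>bil N v v\<bar> \<le> t * (v \<bullet> v)"
    and v: "v \<in> carrier_vec p"
  shows "vnorm ((N ^\<^sub>m k) *\<^sub>v v) \<le> t ^ k * vnorm v"
  using v
proof (induction k arbitrary: v)
  case 0
  then show ?case using sym_matD(1)[OF N] by simp
next
  case (Suc k)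
  have c: "N \<in> carrier_mat p p" by (rule sym_matD(1)[OF N])
  have ck: "N ^\<^sub>m k \<in> carrier_mat p p" using c by simp
  have Nv: "N *\<^sub>v v \<in> carrier_vec p" by (rule mult_mat_vec_carrier[OF c Suc.prems])
  have "vnorm ((N ^\<^sub>m Suc k) *\<^sub>v v) = vnorm ((N ^\<^sub>m k) *\<^sub>v (N *\<^sub>v v))"
    by (simp only: pow_mat.simps assoc_mult_mat_vec[OF ck c Suc.prems])
  also have "\<dots> \<le> t ^ k * vnorm (N *\<^sub>v v)" by (rule Suc.IH[OF Nv])
  also have "\<dots> \<le> t ^ k * (t * vnorm v)"
    using symmetric_vnorm_bound[OF N t q Suc.prems] t by (intro mult_left_mono) auto
  finally show ?case by (simp add: algebra_simps)
qed

lemma pow_mat_bil_bound: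
  assumes N: "sym_mat p N" and t: "0 \<le> t" and q: "\<And>v. v \<in> carrier_vec p \<Longrightarrow> \<bar>bil N v v\<bar> \<le> t * (v \<bullet> v)"
    and u: "u \<in> carrier_vec p" and v: "v \<in> carrier_vec p"
  shows "\<bar>bil (N ^\<^sub>m k) u v\<bar> \<le> t ^ k * vnorm u * vnorm v"
proof -
  have c: "N ^\<^sub>m k \<in> carrier_mat p p" using sym_matD(1)[OF N] by simp
  have "\<bar>bil (N ^\<^sub>m k) u v\<bar> \<le> vnorm u * vnorm ((N ^\<^sub>m k) *\<^sub>v v)"
    unfolding bil_def by (rule scalar_prod_cauchy_schwarz[OF u mult_mat_vec_carrier[OF c v]])
  also have "\<dots> \<le> vnorm u * (t ^ k * vnorm v)"
    by (intro mult_left_mono pow_mat_vnorm_bound[OF N t q v]) auto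
  finally show ?thesis by (simp add: algebra_simps)
qed

lemma pow_mat_add:
  assumes N: "(N :: real mat) \<in> carrier_mat p p"
  shows "N ^\<^sub>m (k + l) = N ^\<^sub>m k * N ^\<^sub>m l"
proof (induction l)
  case 0 show ?case using N by simp
next
  case (Suc l)
  have "N ^\<^sub>m (k + Suc l) = N ^\<^sub>m k * N ^\<^sub>m l * N" using Suc by simp
  also have "\<dots> = N ^\<^sub>m k * (N ^\<^sub>m l * N)" by (rule assoc_mult_mat[of _ p p _ p _ p]) (use N in auto)
  finally show ?case by simp
qed

lemma pow_mat_sym:
  assumes N: "sym_mat p N"
  shows "sym_mat p (N ^\<^sub>m k)"
proof (induction k)
  case 0 show ?case using sym_matD(1)[OF N] by (simp add: sym_mat_def)
next
  case (Suc k)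
  have c: "N \<in> carrier_mat p p" by (rule sym_matD(1)[OF N])
  then have ck: "N ^\<^sub>m k \<in> carrier_mat p p" by simp
  have "(N ^\<^sub>m k * N)\<^sup>T = N\<^sup>T * (N ^\<^sub>m k)\<^sup>T" by (rule transpose_mult[OF ck c])
  also have "\<dots> = N ^\<^sub>m 1 * N ^\<^sub>m k" using sym_matD(2)[OF N] sym_matD(2)[OF Suc] c by simp
  also have "\<dots> = N ^\<^sub>m Suc k" using pow_mat_add[OF c, of 1 k] by simp
  finally show ?case using mult_carrier_mat[OF ck c] by (simp add: sym_mat_def)
qed

text \<open>Successive coefficients have ratio \<open>|1/2 - k| / (k + 1) <= 1\<close>. Boundedness
  is all the series asks for, because the powers of \<open>N\<close> decay geometrically.\<close>

lemma abs_half_gbinomial_le: "\<bar>(1/2 :: real) gchoose k\<bar> \<le> 1"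
proof (induction k)
  case (Suc k)
  have "\<bar>(1/2 :: real) gchoose Suc k\<bar> = \<bar>(1/2) gchoose k\<bar> * (\<bar>1/2 - real k\<bar> / (real k + 1))"
    by (simp add: gbinomial_Suc_rec gbinomial_rec field_simps gbinomial_mult_1 abs_mult
        gbinomial_absorption' flip: abs_mult)
  also have "\<dots> \<le> 1 * 1" by (rule mult_mono) (use Suc in auto)
  finally show ?case by simp
qed simp

text \<open>These are the coefficients of \<open>sqrt (1 - z)\<close> after the constant one. Their
  sign converts upper bounds on the powers of \<open>N\<close> into a lower bound on the form of the
  square root.\<close>

lemma half_gbinomial_alt_nonpos: "((1/2 :: real) gchoose Suc k) * (-1) ^ Suc k \<le> 0"
proof (induction k)
  case (Suc k)
  have rec: "((1/2 :: real) gchoose Suc (Suc k)) = ((1/2) gchoose Suc k) * ((1/2 - real (Suc k)) / (real (Suc k) + 1))"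
    by (simp add: gbinomial_Suc_rec)
  have "((1/2 :: real) gchoose Suc (Suc k)) * (-1) ^ Suc (Suc k)
    = (((1/2) gchoose Suc k) * (-1) ^ Suc k) * ((real (Suc k) - 1/2) / (real (Suc k) + 1))"
  proof -
    have "(1/2 - real (Suc k)) / (real (Suc k) + 1) = - ((real (Suc k) - 1/2) / (real (Suc k) + 1))"
      by (metis minus_diff_eq minus_divide_left)
    moreover have "(x * - s) * (- 1 * y) = (x * y) * s" for x s y :: real by simp
    ultimately show ?thesis by (simp only: rec power_Suc[of _ "Suc k"])
  qed
  also have "\<dots> \<le> 0" by (rule mult_nonpos_nonneg[OF Suc]) auto
  finally show ?case .
qed simp

text \<open>Vandermonde's identity, read as \<open>sqrt (1 - z) * sqrt (1 - z) = 1 - z\<close> for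
  coefficient sequences.\<close>

lemma half_gbinomial_convolution:
  "(\<Sum>k\<le>m. (((1/2 :: real) gchoose k) * (-1) ^ k) * (((1/2) gchoose (m - k)) * (-1) ^ (m - k)))
    = (if m = 0 then 1 else if m = 1 then -1 else 0)"
proof -
  have "(\<Sum>k\<le>m. (((1/2 :: real) gchoose k) * (-1) ^ k) * (((1/2) gchoose (m - k)) * (-1) ^ (m - k)))
    = (-1) ^ m * (\<Sum>k\<le>m. ((1/2 :: real) gchoose k) * ((1/2) gchoose (m - k)))"
    unfolding sum_distrib_left
  proof (rule sum.cong[OF refl])
    fix k assume "k \<in> {..m}"
    then have "(-1 :: real) ^ m = (-1) ^ k * (-1) ^ (m - k)" by (simp flip: power_add)
    then show "(((1/2 :: real) gchoose k) * (-1) ^ k) * (((1/2) gchoose (m - k)) * (-1) ^ (m - k))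
      = (-1) ^ m * (((1/2 :: real) gchoose k) * ((1/2) gchoose (m - k)))" by simp
  qed
  also have "(\<Sum>k\<le>m. ((1/2 :: real) gchoose k) * ((1/2) gchoose (m - k))) = (1/2 + 1/2) gchoose m"
    using gbinomial_Vandermonde[of "1/2 :: real" "1/2" m] by (simp add: atMost_atLeast0)
  also have "(1/2 + 1/2 :: real) gchoose m = real (1 choose m)" by (simp add: binomial_gbinomial)
  finally show ?thesis by (cases m rule: nat.exhaust) (auto simp: numeral_eq_Suc split: if_splits)
qed

text \<open>The square root of \<open>A\<close> is \<open>\<surd>c\<close> times the binomial series of \<open>(1 - N)\<^sup>1\<^sup>/\<^sup>2\<close>, where \<open>A = c (1 - N)\<close>.\<close>
lemma pos_def_sqrt_exists:
  assumes p: "1 \<le> p" and A: "pos_def p A"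
  shows "\<exists>B. pos_def p B \<and> B * B = A"
proof -
  have Ac: "A \<in> carrier_mat p p" and As: "sym_mat p A" using A by (auto simp: pos_def_def sym_mat_def)
  obtain e where e: "0 < e" "\<And>v. v \<in> carrier_vec p \<Longrightarrow> e * (v \<bullet> v) \<le> bil A v v"
    using pos_def_lower[OF p A] by auto
  obtain c where c: "0 < c" "\<And>v. v \<in> carrier_vec p \<Longrightarrow> bil A v v \<le> c * (v \<bullet> v)"
    using pos_def_upper[OF p A] by auto
  have ec: "e \<le> c"
  proof -
    obtain v :: "real vec" where v: "v \<in> carrier_vec p" "v \<bullet> v = 1" using unit_vec_sphere[OF p] by auto
    show ?thesis using e(2)[OF v(1)] c(2)[OF v(1)] v(2) by simp
  qed
  \<comment> \<open>Dividing by the upper form bound \<open>c\<close> makes \<open>N\<close>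
    positive semidefinite with form at most \<open>t = 1 - e / c < 1\<close>, so the binomial series
    converges geometrically.\<close>
  define N where "N = 1\<^sub>m p - (1 / c) \<cdot>\<^sub>m A"
  have Nc: "N \<in> carrier_mat p p" unfolding N_def by (rule minus_carrier_mat) (use Ac in simp)
  have Ns: "sym_mat p N"
    by (rule sym_mat_entryI[OF Nc]) (use Ac sym_mat_entry[OF As] in \<open>auto simp: N_def\<close>)
  define t where "t = 1 - e / c"
  have t: "0 \<le> t" "t < 1" using e c ec by (auto simp: t_def)
  have Nb: "bil N v v = v \<bullet> v - bil A v v / c" if "v \<in> carrier_vec p" for v
    using that Ac by (simp add: N_def bil_minus_mat[where p = p] bil_smult_mat[where p = p] bil_one)
  have N0: "0 \<le> bil N v v" if "v \<in> carrier_vec p" for v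
    using Nb[OF that] c(2)[OF that] c(1) by (simp add: divide_le_eq mult.commute)
  have N1: "bil N v v \<le> t * (v \<bullet> v)" if "v \<in> carrier_vec p" for v
    using Nb[OF that] e(2)[OF that] c(1) by (simp add: t_def field_simps)
  have q: "\<bar>bil N v v\<bar> \<le> t * (v \<bullet> v)" if "v \<in> carrier_vec p" for v using N0 N1 that by fastforce
  define b where "b k = ((1/2 :: real) gchoose k) * (-1) ^ k" for k
  have b1: "\<bar>b k\<bar> \<le> 1" for k using abs_half_gbinomial_le[of k] by (simp add: b_def abs_mult)
  have ck: "N ^\<^sub>m k \<in> carrier_mat p p" for k using Nc by simp
  have ent: "\<bar>(N ^\<^sub>m k) $$ (i, j)\<bar> \<le> t ^ k" if "i < p" "j < p" for i j k
    using pow_mat_bil_bound[OF Ns t(1) q, of "unit_vec p i" "unit_vec p j" k] that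
    by (simp add: bil_unit_vec[OF ck] vnorm_def)
  have summ: "summable (\<lambda>k. norm (b k * (N ^\<^sub>m k) $$ (i, j)))" if "i < p" "j < p" for i j
  proof (rule summable_comparison_test')
    show "summable (\<lambda>k. t ^ k)" using t by (simp add: summable_geometric)
    show "norm (norm (b k * (N ^\<^sub>m k) $$ (i, j))) \<le> t ^ k" for k
      using mult_mono[OF b1[of k] ent[OF that, of k]] t by (simp add: abs_mult)
  qed
  define B where "B = mat p p (\<lambda>(i, j). \<Sum>k. b k * (N ^\<^sub>m k) $$ (i, j))"
  have Bc: "B \<in> carrier_mat p p" by (simp add: B_def)
  have Bs: "sym_mat p B"
    by (rule sym_mat_entryI[OF Bc]) (simp add: B_def sym_mat_entry[OF pow_mat_sym[OF Ns]])
  have BB: "B * B = 1\<^sub>m p - N"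
  proof (rule eq_matI)
    fix i j assume "i < dim_row (1\<^sub>m p - N)" "j < dim_col (1\<^sub>m p - N)"
    then have ij: "i < p" "j < p" using Nc by auto
    let ?f = "\<lambda>l k. b k * (N ^\<^sub>m k) $$ (i, l)" and ?g = "\<lambda>l k. b k * (N ^\<^sub>m k) $$ (l, j)"
    \<comment> \<open>Cauchy products for every inner index \<open>l\<close>. After summing over
      \<open>l\<close> and exchanging the sums, the term of order \<open>m\<close> is a convolution
      coefficient times the \<open>m\<close>-th power of \<open>N\<close>, and only
      \<open>m = 0\<close> and \<open>m = 1\<close> survive.\<close>
    have cp: "(\<lambda>m. \<Sum>k\<le>m. ?f l k * ?g l (m - k)) sums ((\<Sum>k. ?f l k) * (\<Sum>k. ?g l k))" if "l < p" for l
      by (rule Cauchy_product_sums[OF summ[OF ij(1) that] summ[OF that ij(2)]])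
    have "(\<lambda>m. \<Sum>l<p. \<Sum>k\<le>m. ?f l k * ?g l (m - k)) sums (\<Sum>l<p. (\<Sum>k. ?f l k) * (\<Sum>k. ?g l k))"
      by (rule sums_sum) (use cp in auto)
    moreover have "(\<Sum>l<p. (\<Sum>k. ?f l k) * (\<Sum>k. ?g l k)) = (B * B) $$ (i, j)"
      using ij by (simp add: B_def scalar_prod_def lessThan_atLeast0)
    moreover have "(\<Sum>l<p. \<Sum>k\<le>m. ?f l k * ?g l (m - k)) = (if m = 0 then (1\<^sub>m p) $$ (i, j) else if m = 1 then - N $$ (i, j) else 0)" for m
    proof -
      have "(\<Sum>l<p. \<Sum>k\<le>m. ?f l k * ?g l (m - k)) = (\<Sum>k\<le>m. \<Sum>l<p. ?f l k * ?g l (m - k))" by (rule sum.swap)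
      also have "\<dots> = (\<Sum>k\<le>m. b k * b (m - k) * (N ^\<^sub>m m) $$ (i, j))"
      proof (rule sum.cong[OF refl])
        fix k assume k: "k \<in> {..m}"
        have "(N ^\<^sub>m m) $$ (i, j) = (N ^\<^sub>m k * N ^\<^sub>m (m - k)) $$ (i, j)"
          using pow_mat_add[OF Nc, of k "m - k"] k by simp
        also have "\<dots> = (\<Sum>l<p. (N ^\<^sub>m k) $$ (i, l) * (N ^\<^sub>m (m - k)) $$ (l, j))"
          by (rule mult_mat_entry[OF ck ck ij])
        finally show "(\<Sum>l<p. ?f l k * ?g l (m - k)) = b k * b (m - k) * (N ^\<^sub>m m) $$ (i, j)"
          by (simp add: sum_distrib_left algebra_simps)
      qed
      also have "\<dots> = (\<Sum>k\<le>m. b k * b (m - k)) * (N ^\<^sub>m m) $$ (i, j)" by (simp add: sum_distrib_right)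
      also have "(\<Sum>k\<le>m. b k * b (m - k)) = (if m = 0 then 1 else if m = 1 then -1 else 0)"
        unfolding b_def by (rule half_gbinomial_convolution)
      finally show ?thesis using Nc ij by (auto)
    qed
    ultimately have "(\<lambda>m. if m = 0 then (1\<^sub>m p) $$ (i, j) else if m = 1 then - N $$ (i, j) else 0) sums (B * B) $$ (i, j)"
      by simp
    moreover have "(\<lambda>m. if m = 0 then (1\<^sub>m p) $$ (i, j) else if m = 1 then - N $$ (i, j) else 0) sums
       (\<Sum>m\<in>{0, 1::nat}. if m = 0 then (1\<^sub>m p) $$ (i, j) else if m = 1 then - N $$ (i, j) else 0)"
      by (rule sums_finite) auto
    ultimately have "(B * B) $$ (i, j) = (1\<^sub>m p) $$ (i, j) + - N $$ (i, j)"
      by (subst sums_unique2) auto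
    then show "(B * B) $$ (i, j) = (1\<^sub>m p - N) $$ (i, j)" using ij Nc by simp
  qed (use Nc Bc in auto)
  \<comment> \<open>Termwise comparison with the scalar series at \<open>- t\<close>: the
    coefficients beyond the first are nonpositive and the forms of the powers of \<open>N\<close>
    are at most \<open>t ^ k\<close>, so the form of \<open>B\<close> dominates
    \<open>sqrt (1 - t)\<close> times the squared norm.\<close>
  have Bpos: "0 < bil B v v" if v: "v \<in> carrier_vec p" "v \<noteq> 0\<^sub>v p" for v
  proof -
    have "(\<lambda>k. \<Sum>i<p. \<Sum>j<p. v $ i * (b k * (N ^\<^sub>m k) $$ (i, j)) * v $ j) sums
      (\<Sum>i<p. \<Sum>j<p. v $ i * (\<Sum>k. b k * (N ^\<^sub>m k) $$ (i, j)) * v $ j)"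
      by (intro sums_sum sums_mult sums_mult2 summable_sums summable_norm_cancel[OF summ]) auto
    moreover have "(\<Sum>i<p. \<Sum>j<p. v $ i * (b k * (N ^\<^sub>m k) $$ (i, j)) * v $ j) = b k * bil (N ^\<^sub>m k) v v" for k
      by (simp add: bil_sum[OF ck v(1) v(1)] sum_distrib_left algebra_simps)
    moreover have "(\<Sum>i<p. \<Sum>j<p. v $ i * (\<Sum>k. b k * (N ^\<^sub>m k) $$ (i, j)) * v $ j) = bil B v v"
      unfolding bil_sum[OF Bc v(1) v(1)] by (simp add: B_def)
    ultimately have 1: "(\<lambda>k. b k * bil (N ^\<^sub>m k) v v) sums bil B v v" by simp
    have "(\<lambda>k. ((1/2) gchoose k) * (- t) ^ k) sums (1 + - t) powr (1/2)"
      by (rule gen_binomial_real) (use t in auto)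
    moreover have "((1/2) gchoose k) * (- t) ^ k = b k * t ^ k" for k
      by (simp add: b_def power_minus[of t])
    ultimately have 2: "(\<lambda>k. b k * t ^ k * (v \<bullet> v)) sums ((1 + - t) powr (1/2) * (v \<bullet> v))"
      by (intro sums_mult2) simp
    have 3: "b k * t ^ k * (v \<bullet> v) \<le> b k * bil (N ^\<^sub>m k) v v" for k
    proof (cases k)
      case 0
      then show ?thesis using v Nc by (simp add: b_def bil_one)
    next
      case (Suc l)
      have "bil (N ^\<^sub>m k) v v \<le> t ^ k * (v \<bullet> v)"
        using pow_mat_bil_bound[OF Ns t(1) q v(1) v(1), of k] vnorm_sq[of v] by (simp add: power2_eq_square mult.assoc)
      moreover have "b k \<le> 0" unfolding b_def Suc by (rule half_gbinomial_alt_nonpos)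
      ultimately show ?thesis by (simp add: mult_left_mono_neg mult.assoc)
    qed
    have "(1 + - t) powr (1/2) * (v \<bullet> v) \<le> bil B v v" by (rule sums_le[OF 3 2 1])
    moreover have "0 < (1 + - t) powr (1/2) * (v \<bullet> v)" using t scalar_prod_pos[OF v] by simp
    ultimately show ?thesis by linarith
  qed
  define R where "R = sqrt c \<cdot>\<^sub>m B"
  have Rs: "sym_mat p R"
    by (rule sym_mat_entryI) (use Bc sym_mat_entry[OF Bs] in \<open>auto simp: R_def\<close>)
  have "pos_def p R"
    by (rule pos_defI[OF Rs]) (use Bpos c Bc in \<open>auto simp: R_def bil_smult_mat[where p = p]\<close>)
  moreover have "R * R = A"
  proof -
    have "R * R = sqrt c \<cdot>\<^sub>m (sqrt c \<cdot>\<^sub>m (B * B))"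
      unfolding R_def using mult_smult_assoc_mat[OF Bc, of "sqrt c \<cdot>\<^sub>m B" p "sqrt c"] mult_smult_distrib[OF Bc Bc, of "sqrt c"] Bc
      by simp
    also have "\<dots> = A"
    proof -
      have "sqrt c * (sqrt c * x) / c = x" for x using c(1) by (simp flip: mult.assoc)
      then show ?thesis unfolding BB N_def using Ac c(1) by (intro eq_matI) auto
    qed
    finally show ?thesis .
  qed
  ultimately show ?thesis by blast
qed

text \<open>With \<open>D = B - C\<close> one has \<open>B D + D C = B B - C C = 0\<close>.
  Multiplying by \<open>D\<close> and taking traces leaves
  \<open>tr (D B D) + tr (D C D) = 0\<close>, a sum of nonnegative form values at the columns of
  \<open>D\<close>; hence every column vanishes.\<close>

lemma pos_def_sqrt_unique:
  assumes B: "pos_def p B" and C: "pos_def p C" and eq: "B * B = C * C"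
  shows "B = C"
proof -
  have Bc: "B \<in> carrier_mat p p" and Cc: "C \<in> carrier_mat p p"
    and Bs: "sym_mat p B" and Cs: "sym_mat p C" using B C by (auto simp: pos_def_def sym_mat_def)
  define D where "D = B - C"
  have Dc: "D \<in> carrier_mat p p" unfolding D_def by (rule minus_carrier_mat[OF Cc])
  have Ds: "sym_mat p D" using Dc sym_matD(2)[OF Bs] sym_matD(2)[OF Cs]
    by (simp add: sym_mat_def D_def transpose_minus[OF Bc Cc])
  have "B * D = B * B - B * C" unfolding D_def by (rule mult_minus_distrib_mat[OF Bc Bc Cc])
  moreover have "D * C = B * C - C * C" unfolding D_def by (rule minus_mult_distrib_mat[OF Bc Cc Cc])
  ultimately have z: "B * D + D * C = 0\<^sub>m p p" unfolding eq using Bc Cc by (intro eq_matI) auto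
  have BD: "B * D \<in> carrier_mat p p" and DC: "D * C \<in> carrier_mat p p" using Bc Cc Dc by auto
  have "mat_trace (D * B * D) + mat_trace (D * C * D) = mat_trace (D * (B * D)) + mat_trace (D * (D * C))"
    by (simp only: mat_trace_mult_commute[OF DC Dc] assoc_mult_mat[OF Dc Bc Dc])
  also have "\<dots> = mat_trace (D * (B * D) + D * (D * C))"
    by (rule mat_trace_add[symmetric, OF mult_carrier_mat[OF Dc BD] mult_carrier_mat[OF Dc DC]])
  also have "D * (B * D) + D * (D * C) = D * (B * D + D * C)" by (rule mult_add_distrib_mat[symmetric, OF Dc BD DC])
  also have "mat_trace \<dots> = 0" unfolding z using Dc by (simp add: mat_trace_def)
  finally have s: "(\<Sum>a<p. bil B (D *\<^sub>v unit_vec p a) (D *\<^sub>v unit_vec p a) + bil C (D *\<^sub>v unit_vec p a) (D *\<^sub>v unit_vec p a)) = 0"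
    by (simp only: mat_trace_conj[OF Ds Bc] mat_trace_conj[OF Ds Cc] sum.distrib)
  have pos: "0 \<le> bil B w w + bil C w w \<and> (bil B w w + bil C w w = 0 \<longrightarrow> w = 0\<^sub>v p)" if w: "w \<in> carrier_vec p" for w
  proof (cases "w = 0\<^sub>v p")
    case True then show ?thesis using Bc Cc by (simp add: bil_def mult_mat_zero_vec)
  next
    case False then show ?thesis using pos_defD[OF B w False] pos_defD[OF C w False] by simp
  qed
  have w: "D *\<^sub>v unit_vec p a \<in> carrier_vec p" for a by (rule mult_mat_vec_carrier[OF Dc]) simp
  have "D *\<^sub>v unit_vec p a = 0\<^sub>v p" if "a < p" for a
  proof -
    have "bil B (D *\<^sub>v unit_vec p a) (D *\<^sub>v unit_vec p a) + bil C (D *\<^sub>v unit_vec p a) (D *\<^sub>v unit_vec p a) = 0"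
      using sum_nonneg_0[OF finite_lessThan _ s, of a] that pos[OF w] by blast
    then show ?thesis using pos[OF w] by blast
  qed
  then have "D $$ (i, a) = 0" if "i < p" "a < p" for i a
    using bil_unit_vec[OF Dc that] that by (simp add: bil_def)
  then have "B $$ (i, a) = C $$ (i, a)" if "i < p" "a < p" for i a
    using that Bc Cc by (force simp: D_def)
  then show ?thesis using Bc Cc by (intro eq_matI) auto
qed

lemma mat_sqrt:
  assumes p: "1 \<le> p" and A: "pos_def p A"
  shows "pos_def p (mat_sqrt A)" "mat_sqrt A * mat_sqrt A = A"
proof -
  have d: "dim_row A = p" using A by (auto simp: pos_def_def)
  have "\<exists>!B. pos_def (dim_row A) B \<and> B * B = A"
    using pos_def_sqrt_exists[OF p A] pos_def_sqrt_unique unfolding d by blast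
  from theI'[OF this] show "pos_def p (mat_sqrt A)" "mat_sqrt A * mat_sqrt A = A"
    unfolding mat_sqrt_def d by auto
qed

section \<open>The fixed-point map\<close>

lemma eq_mat_bilI:
  assumes A: "A \<in> carrier_mat p p" and B: "B \<in> carrier_mat p p"
    and eq: "\<And>u v. u \<in> carrier_vec p \<Longrightarrow> v \<in> carrier_vec p \<Longrightarrow> bil A u v = bil B u v"
  shows "A = B"
proof (rule eq_matI)
  fix i j assume "i < dim_row B" "j < dim_col B"
  then have ij: "i < p" "j < p" using B by auto
  show "A $$ (i, j) = B $$ (i, j)"
    using eq[of "unit_vec p i" "unit_vec p j"] by (simp add: bil_unit_vec[OF A ij] bil_unit_vec[OF B ij])
qed (use A B in auto)

lemma sym_mat_bilI:
  assumes A: "A \<in> carrier_mat p p"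
    and eq: "\<And>u v. u \<in> carrier_vec p \<Longrightarrow> v \<in> carrier_vec p \<Longrightarrow> bil A u v = bil A v u"
  shows "sym_mat p A"
proof (rule sym_mat_entryI[OF A])
  fix i j assume "i < p" "j < p"
  then show "A $$ (j, i) = A $$ (i, j)"
    using eq[of "unit_vec p j" "unit_vec p i"] by (simp add: bil_unit_vec[OF A])
qed

text \<open>\<open>P\<close> stands for the inverse of the candidate, which keeps the map free of
  matrix inversion; \<open>psi p n x (mat_inv T) = T\<close> is Tyler's equation for
  \<open>T\<close>.\<close>

definition psi :: "nat \<Rightarrow> nat \<Rightarrow> (nat \<Rightarrow> real vec) \<Rightarrow> real mat \<Rightarrow> real mat" where
  "psi p n x P = mat p p (\<lambda>(a, b). real p / real n *
     (\<Sum>i<n. (x i $ a * x i $ b) / (x i \<bullet> (P *\<^sub>v x i))))"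

text \<open>Geometrically, no two hyperplanes through the origin cover all samples. It acts as
  irreducibility does in Perron-Frobenius theory: a gain in one direction reaches every other
  direction in a single step of the map.\<close>

definition overlap :: "nat \<Rightarrow> nat \<Rightarrow> (nat \<Rightarrow> real vec) \<Rightarrow> bool" where
  "overlap p n x \<longleftrightarrow> (\<forall>u \<in> carrier_vec p. \<forall>v \<in> carrier_vec p. u \<noteq> 0\<^sub>v p \<longrightarrow> v \<noteq> 0\<^sub>v p \<longrightarrow>
     (\<exists>i<n. u \<bullet> x i \<noteq> 0 \<and> v \<bullet> x i \<noteq> 0))"

lemma psi_carrier [simp]: "psi p n x P \<in> carrier_mat p p"
  by (simp add: psi_def)

lemma psi_sym: "sym_mat p (psi p n x P)"
  by (auto simp: sym_mat_def psi_def mult.commute intro!: eq_matI)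

lemma bil_psi:
  assumes x: "\<And>i. i < n \<Longrightarrow> x i \<in> carrier_vec p" and u: "u \<in> carrier_vec p" and v: "v \<in> carrier_vec p"
  shows "bil (psi p n x P) u v = real p / real n * (\<Sum>i<n. (u \<bullet> x i) * (v \<bullet> x i) / bil P (x i) (x i))"
proof -
  have "bil (psi p n x P) u v = (\<Sum>a<p. \<Sum>b<p. u $ a * (real p / real n *
     (\<Sum>i<n. (x i $ a * x i $ b) / bil P (x i) (x i))) * v $ b)"
    unfolding bil_sum[OF psi_carrier u v] by (simp add: psi_def bil_def)
  also have "\<dots> = (\<Sum>a<p. \<Sum>b<p. \<Sum>i<n. real p / real n * ((u $ a * x i $ a) * (v $ b * x i $ b) / bil P (x i) (x i)))"
    unfolding sum_distrib_left sum_distrib_right by (intro sum.cong refl) (simp add: field_simps)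
  also have "\<dots> = (\<Sum>a<p. \<Sum>i<n. \<Sum>b<p. real p / real n * ((u $ a * x i $ a) * (v $ b * x i $ b) / bil P (x i) (x i)))"
    by (intro sum.cong refl sum.swap)
  also have "\<dots> = (\<Sum>i<n. \<Sum>a<p. \<Sum>b<p. real p / real n * ((u $ a * x i $ a) * (v $ b * x i $ b) / bil P (x i) (x i)))"
    by (rule sum.swap)
  also have "\<dots> = (\<Sum>i<n. real p / real n * ((u \<bullet> x i) * (v \<bullet> x i) / bil P (x i) (x i)))"
  proof (rule sum.cong[OF refl])
    fix i assume "i \<in> {..<n}"
    then have "dim_vec (x i) = p" using x by auto
    then have s: "u \<bullet> x i = (\<Sum>a<p. u $ a * x i $ a)" "v \<bullet> x i = (\<Sum>a<p. v $ a * x i $ a)"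
      by (simp_all add: scalar_prod_def lessThan_atLeast0)
    show "(\<Sum>a<p. \<Sum>b<p. real p / real n * ((u $ a * x i $ a) * (v $ b * x i $ b) / bil P (x i) (x i)))
      = real p / real n * ((u \<bullet> x i) * (v \<bullet> x i) / bil P (x i) (x i))"
      unfolding s sum_product by (simp add: sum_distrib_left sum_divide_distrib)
  qed
  finally show ?thesis by (simp add: sum_distrib_left)
qed

lemma psd_bil_nonneg:
  assumes "pos_def p P" "v \<in> carrier_vec p" shows "0 \<le> bil P v v"
proof (cases "v = 0\<^sub>v p")
  case True
  moreover have "P \<in> carrier_mat p p" using assms by (simp add: pos_def_def)
  ultimately show ?thesis by (simp add: bil_def mult_mat_zero_vec)
next
  case False then show ?thesis using pos_defD[OF assms False] by simp
qed

lemma overlap_nonzero: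
  assumes "overlap p n x" "u \<in> carrier_vec p" "u \<noteq> 0\<^sub>v p"
  shows "\<exists>i<n. u \<bullet> x i \<noteq> 0 \<and> x i \<noteq> 0\<^sub>v p"
  using assms unfolding overlap_def by fastforce

lemma psi_pos_def:
  assumes p: "1 \<le> p" and x: "\<And>i. i < n \<Longrightarrow> x i \<in> carrier_vec p" and ov: "overlap p n x" and P: "pos_def p P"
  shows "pos_def p (psi p n x P)"
proof (rule pos_defI[OF psi_sym])
  fix v :: "real vec" assume v: "v \<in> carrier_vec p" "v \<noteq> 0\<^sub>v p"
  obtain i where i: "i < n" "v \<bullet> x i \<noteq> 0" "x i \<noteq> 0\<^sub>v p" using overlap_nonzero[OF ov v] by auto
  have "0 < (\<Sum>i<n. (v \<bullet> x i) * (v \<bullet> x i) / bil P (x i) (x i))"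
  proof (rule sum_pos2[of _ i])
    show "0 < (v \<bullet> x i) * (v \<bullet> x i) / bil P (x i) (x i)"
      using i pos_defD[OF P x[OF i(1)] i(3)] by (simp add: zero_less_mult_iff linorder_neq_iff[symmetric])
    show "0 \<le> (v \<bullet> x j) * (v \<bullet> x j) / bil P (x j) (x j)" if "j \<in> {..<n}" for j
      using psd_bil_nonneg[OF P x] that by simp
  qed (use i in auto)
  moreover have bp: "bil (psi p n x Q) v v = real p / real n * (\<Sum>i<n. (v \<bullet> x i) * (v \<bullet> x i) / bil Q (x i) (x i))" for Q
    by (rule bil_psi[OF x v(1) v(1)])
  ultimately show "0 < bil (psi p n x P) v v" unfolding bp using p i by simp
qed

lemma mat_inv_sym: "pos_def p T \<Longrightarrow> sym_mat p (mat_inv T)"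
  using pos_def_inverse(2) pos_def_sym by blast

text \<open>Strictness everywhere: an index seen by both \<open>v\<close> and a vector in the range of \<open>b P' - P\<close> gains.\<close>
lemma psi_strict:
  assumes x: "\<And>i. i < n \<Longrightarrow> x i \<in> carrier_vec p" and ov: "overlap p n x"
    and T: "pos_def p T" and T': "pos_def p T'" and b: "0 < b"
    and le: "\<And>v. v \<in> carrier_vec p \<Longrightarrow> bil T' v v \<le> b * bil T v v"
    and ne: "b \<cdot>\<^sub>m mat_inv T' \<noteq> mat_inv T" and v: "v \<in> carrier_vec p" "v \<noteq> 0\<^sub>v p" and p: "1 \<le> p"
  shows "bil (psi p n x (mat_inv T')) v v < b * bil (psi p n x (mat_inv T)) v v"
proof -
  let ?P = "mat_inv T" and ?P' = "mat_inv T'"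
  have P: "pos_def p ?P" and P': "pos_def p ?P'" using pos_def_inverse(2) T T' by auto
  have Pc: "?P \<in> carrier_mat p p" "?P' \<in> carrier_mat p p" using P P' by (auto simp: pos_def_def)
  have Ple: "bil ?P y y \<le> b * bil ?P' y y" if "y \<in> carrier_vec p" for y
    by (rule inverse_antimono[OF pos_def_sym[OF T] pos_def_sym[OF T'] mat_inv_sym[OF T] mat_inv_sym[OF T']
        pos_def_inverse(3)[OF T] pos_def_inverse(3)[OF T'] b psd_bil_nonneg[OF T'] le that])
  \<comment> \<open>Order reversal of inverses makes \<open>M\<close> positive semidefinite, and
    \<open>ne\<close> makes it nonzero.\<close>
  define M where "M = b \<cdot>\<^sub>m ?P' - ?P"
  have Mc: "M \<in> carrier_mat p p" unfolding M_def by (rule minus_carrier_mat[OF Pc(1)])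
  have bM: "bil M y z = b * bil ?P' y z - bil ?P y z" if "y \<in> carrier_vec p" "z \<in> carrier_vec p" for y z
    using that Pc by (simp add: M_def bil_minus_mat[where p = p] bil_smult_mat[where p = p])
  have Ms: "sym_mat p M"
    by (rule sym_mat_bilI[OF Mc])
      (simp only: bM bil_commute[OF mat_inv_sym[OF T]] bil_commute[OF mat_inv_sym[OF T']])
  have Mpsd: "0 \<le> bil M y y" if "y \<in> carrier_vec p" for y using bM[OF that that] Ple[OF that] by simp
  have "\<exists>y \<in> carrier_vec p. M *\<^sub>v y \<noteq> 0\<^sub>v p"
  proof (rule ccontr)
    assume "\<not> ?thesis"
    then have "bil M u y = 0" if "u \<in> carrier_vec p" "y \<in> carrier_vec p" for u y
      using that by (simp add: bil_def)
    then have "b \<cdot>\<^sub>m ?P' = ?P"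
      using bM Pc by (intro eq_mat_bilI[of _ p]) (auto simp: bil_smult_mat[where p = p])
    then show False using ne by simp
  qed
  then obtain y where y: "y \<in> carrier_vec p" "M *\<^sub>v y \<noteq> 0\<^sub>v p" by auto
  define w where "w = M *\<^sub>v y"
  have w: "w \<in> carrier_vec p" "w \<noteq> 0\<^sub>v p" using y mult_mat_vec_carrier[OF Mc y(1)] by (auto simp: w_def)
  obtain i where i: "i < n" "w \<bullet> x i \<noteq> 0" "v \<bullet> x i \<noteq> 0" using ov w v unfolding overlap_def by blast
  have xi: "x i \<in> carrier_vec p" by (rule x[OF i(1)])
  have xi0: "x i \<noteq> 0\<^sub>v p" using i(3) v(1) by auto
  \<comment> \<open>\<open>x i\<close> is not orthogonal to the range vector \<open>w\<close>, hence
    not in the kernel of the symmetric matrix \<open>M\<close>; for a semidefinite form this already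
    makes the value at \<open>x i\<close> positive.\<close>
  have "M *\<^sub>v x i \<noteq> 0\<^sub>v p"
  proof
    assume z: "M *\<^sub>v x i = 0\<^sub>v p"
    have "w \<bullet> x i = bil M (x i) y"
      unfolding bil_def w_def[symmetric] by (rule comm_scalar_prod[OF w(1) xi])
    also have "\<dots> = bil M y (x i)" by (rule bil_commute[OF Ms xi y(1)])
    also have "\<dots> = 0" using y(1) z by (simp add: bil_def)
    finally show False using i(2) by simp
  qed
  then have "bil M (x i) (x i) \<noteq> 0" using psd_null_vector[OF Ms Mpsd xi] by auto
  then have lt: "bil ?P (x i) (x i) < b * bil ?P' (x i) (x i)" using bM[OF xi xi] Mpsd[OF xi] by simp
  let ?t = "\<lambda>j. (v \<bullet> x j) * (v \<bullet> x j) / bil ?P' (x j) (x j)"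
  let ?s = "\<lambda>j. b * ((v \<bullet> x j) * (v \<bullet> x j) / bil ?P (x j) (x j))"
  have "(\<Sum>j<n. ?t j) < (\<Sum>j<n. ?s j)"
  proof (rule sum_strict_mono_ex1)
    have "?t j \<le> ?s j" if "j \<in> {..<n}" for j
    proof (cases "x j = 0\<^sub>v p")
      case True then show ?thesis using v by simp
    next
      case False
      have xj: "x j \<in> carrier_vec p" using x that by simp
      have "0 < bil ?P (x j) (x j)" "0 < bil ?P' (x j) (x j)" using pos_defD[OF P xj False] pos_defD[OF P' xj False] .
      moreover from this have "1 / bil ?P' (x j) (x j) \<le> b / bil ?P (x j) (x j)"
        using Ple[OF xj] by (simp add: field_simps)
      then have "(v \<bullet> x j)\<^sup>2 * (1 / bil ?P' (x j) (x j)) \<le> (v \<bullet> x j)\<^sup>2 * (b / bil ?P (x j) (x j))"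
        by (rule mult_left_mono) simp
      ultimately show ?thesis by (simp add: power2_eq_square mult.commute)
    qed
    then show "\<forall>j\<in>{..<n}. ?t j \<le> ?s j" by blast
    have "0 < bil ?P (x i) (x i)" "0 < bil ?P' (x i) (x i)" using pos_defD[OF P xi xi0] pos_defD[OF P' xi xi0] .
    then have "1 / bil ?P' (x i) (x i) < b / bil ?P (x i) (x i)" using lt by (simp add: field_simps)
    then have "(v \<bullet> x i)\<^sup>2 * (1 / bil ?P' (x i) (x i)) < (v \<bullet> x i)\<^sup>2 * (b / bil ?P (x i) (x i))"
      using i(3) by (intro mult_strict_left_mono) auto
    then have "?t i < ?s i" by (simp add: power2_eq_square mult.commute)
    then show "\<exists>j\<in>{..<n}. ?t j < ?s j" using i(1) by blast
  qed simp
  then have "(\<Sum>j<n. ?t j) < b * (\<Sum>j<n. (v \<bullet> x j) * (v \<bullet> x j) / bil ?P (x j) (x j))"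
    by (simp only: sum_distrib_left)
  then have "real p / real n * (\<Sum>j<n. ?t j) < real p / real n * (b * (\<Sum>j<n. (v \<bullet> x j) * (v \<bullet> x j) / bil ?P (x j) (x j)))"
    using p i(1) by (intro mult_strict_left_mono) auto
  moreover have bp: "bil (psi p n x Q) v v = real p / real n * (\<Sum>i<n. (v \<bullet> x i) * (v \<bullet> x i) / bil Q (x i) (x i))" for Q
    by (rule bil_psi[OF x v(1) v(1)])
  ultimately show ?thesis unfolding bp by (simp only: mult.left_commute)
qed

lemma proportional_inverses:
  assumes T: "pos_def p T" and T': "pos_def p T'" and eq: "b \<cdot>\<^sub>m mat_inv T' = mat_inv T"
  shows "T' = b \<cdot>\<^sub>m T"
proof -
  have c: "T \<in> carrier_mat p p" "T' \<in> carrier_mat p p" "mat_inv T \<in> carrier_mat p p" "mat_inv T' \<in> carrier_mat p p"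
    using T T' pos_def_inverse(2)[OF T] pos_def_inverse(2)[OF T'] by (auto simp: pos_def_def)
  have "T' * mat_inv T = b \<cdot>\<^sub>m (T' * mat_inv T')" unfolding eq[symmetric] by (rule mult_smult_distrib[OF c(2,4)])
  then have "T' * mat_inv T = b \<cdot>\<^sub>m 1\<^sub>m p" using pos_def_inverse(3)[OF T'] by simp
  then have "T' * mat_inv T * T = b \<cdot>\<^sub>m (1\<^sub>m p * T)" using mult_smult_assoc_mat[OF one_carrier_mat c(1)] by simp
  moreover have "T' * mat_inv T * T = T' * (mat_inv T * T)" by (rule assoc_mult_mat[OF c(2,3,1)])
  ultimately show ?thesis using pos_def_inverse(4)[OF T] c by simp
qed

text \<open>At the vector where the ratio of \<open>T'\<close> to \<open>T\<close> attains its
  maximum \<open>b\<close>, strictness would give \<open>bil T' v v < b * bil T v v\<close>; so the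
  inverses are proportional. The scale stays free because the map is homogeneous of degree
  one.\<close>

lemma psi_fixpoint_unique:
  assumes p: "1 \<le> p" and x: "\<And>i. i < n \<Longrightarrow> x i \<in> carrier_vec p" and ov: "overlap p n x"
    and T: "pos_def p T" "psi p n x (mat_inv T) = T" and T': "pos_def p T'" "psi p n x (mat_inv T') = T'"
  shows "\<exists>b. T' = b \<cdot>\<^sub>m T"
proof -
  have c: "T' \<in> carrier_mat p p" using T' by (simp add: pos_def_def)
  obtain b v where v: "v \<in> carrier_vec p" "v \<noteq> 0\<^sub>v p" "bil T' v v = b * bil T v v"
    and le: "\<And>u. u \<in> carrier_vec p \<Longrightarrow> bil T' u u \<le> b * bil T u u"
    using generalized_rayleigh_max[OF p T(1) c] by auto
  have "0 < b" using v pos_defD[OF T(1) v(1,2)] pos_defD[OF T'(1) v(1,2)] by (simp add: zero_less_mult_iff)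
  then have "b \<cdot>\<^sub>m mat_inv T' = mat_inv T"
    using psi_strict[OF x ov T(1) T'(1) _ le _ v(1,2) p] T(2) T'(2) v(3) by force
  then show ?thesis using proportional_inverses[OF T(1) T'(1)] by blast
qed

text \<open>The condition number is at most \<open>k\<close>, written without eigenvalues or
  quotients: the inequalities are linear in \<open>T\<close>, so they survive limits, and zero
  vectors are no exception.\<close>

definition near_conformal :: "nat \<Rightarrow> real \<Rightarrow> real mat \<Rightarrow> bool" where
  "near_conformal p k T \<longleftrightarrow> sym_mat p T \<and> mat_trace T = real p \<and>
     (\<forall>u \<in> carrier_vec p. \<forall>v \<in> carrier_vec p. bil T v v * (u \<bullet> u) \<le> k * bil T u u * (v \<bullet> v))"

text \<open>The trace normalisation says that the diagonal entries average to one, so comparing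
  \<open>v\<close> with each coordinate vector and summing turns the ratio condition into absolute
  bounds.\<close>

lemma near_conformal_bounds:
  assumes p: "1 \<le> p" and k: "1 \<le> k" and T: "near_conformal p k T" and v: "v \<in> carrier_vec p"
  shows "bil T v v \<le> k * (v \<bullet> v)" "v \<bullet> v \<le> k * bil T v v"
proof -
  have c: "T \<in> carrier_mat p p" using T by (simp add: near_conformal_def sym_mat_def)
  have tr: "(\<Sum>a<p. T $$ (a, a)) = real p" using T c by (simp add: near_conformal_def mat_trace_def)
  have "(\<Sum>a<p. bil T v v) \<le> (\<Sum>a<p. k * T $$ (a, a) * (v \<bullet> v))"
  proof (rule sum_mono)
    fix a assume "a \<in> {..<p}"
    then have a: "a < p" by simp
    have "bil T v v * (unit_vec p a \<bullet> unit_vec p a) \<le> k * bil T (unit_vec p a) (unit_vec p a) * (v \<bullet> v)"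
      using T v unit_vec_carrier[of p a] unfolding near_conformal_def by blast
    then show "bil T v v \<le> k * T $$ (a, a) * (v \<bullet> v)" unfolding bil_unit_vec[OF c a a] using a by simp
  qed
  also have "\<dots> = k * (v \<bullet> v) * (\<Sum>a<p. T $$ (a, a))" by (simp add: sum_distrib_left sum_distrib_right algebra_simps)
  finally have "real p * bil T v v \<le> real p * (k * (v \<bullet> v))" unfolding tr by (simp add: mult.commute)
  then show "bil T v v \<le> k * (v \<bullet> v)" using p by simp
  have "(\<Sum>a<p. T $$ (a, a) * (v \<bullet> v)) \<le> (\<Sum>a<p. k * bil T v v)"
  proof (rule sum_mono)
    fix a assume "a \<in> {..<p}"
    then have a: "a < p" by simp
    have "bil T (unit_vec p a) (unit_vec p a) * (v \<bullet> v) \<le> k * bil T v v * (unit_vec p a \<bullet> unit_vec p a)"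
      using T v unit_vec_carrier[of p a] unfolding near_conformal_def by blast
    then show "T $$ (a, a) * (v \<bullet> v) \<le> k * bil T v v" unfolding bil_unit_vec[OF c a a] using a by simp
  qed
  also have "(\<Sum>a<p. T $$ (a, a) * (v \<bullet> v)) = (\<Sum>a<p. T $$ (a, a)) * (v \<bullet> v)" by (simp add: sum_distrib_right)
  finally have "real p * (v \<bullet> v) \<le> real p * (k * bil T v v)" unfolding tr by simp
  then show "v \<bullet> v \<le> k * bil T v v" using p by simp
qed

lemma near_conformal_pos_def:
  assumes p: "1 \<le> p" and k: "1 \<le> k" and T: "near_conformal p k T"
  shows "pos_def p T"
proof (rule pos_defI)
  show "sym_mat p T" using T by (simp add: near_conformal_def)
  fix v :: "real vec" assume v: "v \<in> carrier_vec p" "v \<noteq> 0\<^sub>v p"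
  have "0 < k * bil T v v" using near_conformal_bounds(2)[OF p k T v(1)] scalar_prod_pos[OF v] by linarith
  then show "0 < bil T v v" using k by (simp add: zero_less_mult_iff)
qed

lemma inverse_bounds:
  assumes T: "pos_def p T" and a: "0 < a" and b: "0 < b"
    and lo: "\<And>v :: real vec. v \<in> carrier_vec p \<Longrightarrow> a * (v \<bullet> v) \<le> bil T v v"
    and hi: "\<And>v. v \<in> carrier_vec p \<Longrightarrow> bil T v v \<le> b * (v \<bullet> v)"
    and v: "v \<in> carrier_vec p"
  shows "bil (mat_inv T) v v \<le> (v \<bullet> v) / a" "v \<bullet> v \<le> b * bil (mat_inv T) v v"
proof -
  have I: "sym_mat p (1\<^sub>m p)" by (simp add: sym_mat_def)
  have "bil (mat_inv T) v v \<le> 1 / a * bil (1\<^sub>m p) v v"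
    by (rule inverse_antimono[OF pos_def_sym[OF T] I mat_inv_sym[OF T] I pos_def_inverse(3)[OF T]])
      (use a v lo in \<open>auto simp: bil_one scalar_prod_nonneg field_simps\<close>)
  then show "bil (mat_inv T) v v \<le> (v \<bullet> v) / a" using v by (simp add: bil_one)
  have "bil (1\<^sub>m p) v v \<le> b * bil (mat_inv T) v v"
    by (rule inverse_antimono[OF I pos_def_sym[OF T] I mat_inv_sym[OF T] _ pos_def_inverse(3)[OF T] b psd_bil_nonneg[OF T]])
      (use v hi in \<open>auto simp: bil_one\<close>)
  then show "v \<bullet> v \<le> b * bil (mat_inv T) v v" using v by (simp add: bil_one)
qed

text \<open>\<open>a\<close> is the smallest eigenvalue, obtained as the reciprocal of the maximum
  of the identity relative to \<open>T\<close>; the ratio condition at the maximising vector gives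
  the upper bound.\<close>

lemma near_conformal_alpha:
  assumes p: "1 \<le> p" and k: "1 \<le> k" and T: "near_conformal p k T"
  shows "\<exists>a>0. \<forall>v \<in> carrier_vec p. a * (v \<bullet> v) \<le> bil T v v \<and> bil T v v \<le> k * a * (v \<bullet> v)"
proof -
  note pd = near_conformal_pos_def[OF p k T]
  obtain b u where u: "u \<in> carrier_vec p" "u \<noteq> 0\<^sub>v p" "bil (1\<^sub>m p) u u = b * bil T u u"
    and le: "\<And>v. v \<in> carrier_vec p \<Longrightarrow> bil (1\<^sub>m p) v v \<le> b * bil T v v"
    using generalized_rayleigh_max[OF p pd, of "1\<^sub>m p"] by auto
  have uu: "0 < u \<bullet> u" "0 < bil T u u" using scalar_prod_pos[OF u(1,2)] pos_defD[OF pd u(1,2)] .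
  have b: "0 < b" using u uu by (simp add: bil_one zero_less_mult_iff)
  show ?thesis
  proof (intro exI[of _ "1 / b"] conjI ballI)
    fix v :: "real vec" assume v: "v \<in> carrier_vec p"
    show "1 / b * (v \<bullet> v) \<le> bil T v v" using le[OF v] v b by (simp add: bil_one field_simps)
    have "bil T v v * (u \<bullet> u) \<le> k * bil T u u * (v \<bullet> v)" using T u v by (auto simp: near_conformal_def)
    also have "bil T u u = (u \<bullet> u) / b" using u b by (simp add: bil_one)
    finally have "bil T v v * (u \<bullet> u) \<le> (k * (1 / b) * (v \<bullet> v)) * (u \<bullet> u)" by (simp add: field_simps)
    then show "bil T v v \<le> k * (1 / b) * (v \<bullet> v)" using uu(1) by (simp only: mult_le_cancel_right_pos)
  qed (use b in simp)
qed

section \<open>Existence of a well-conditioned fixed point\<close>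

lemma card_majority_overlap:
  assumes "A \<subseteq> {..<n}" "B \<subseteq> {..<n}" "3 / 4 * real n \<le> real (card A)" "3 / 4 * real n \<le> real (card B)"
  shows "real n / 2 \<le> real (card (A \<inter> B))"
proof -
  have "finite A" "finite B" using assms(1,2) finite_subset by blast+
  then have "card A + card B = card (A \<union> B) + card (A \<inter> B)" by (rule card_Un_Int)
  moreover have "card (A \<union> B) \<le> n" using card_mono[of "{..<n}" "A \<union> B"] assms(1,2) by auto
  ultimately show ?thesis using assms(3,4) by linarith
qed

text \<open>The weights \<open>g i\<close> lie between \<alpha> and \<beta> \<open>= k\<close>
  \<alpha>. Bounding them by the endpoints costs a covariance error on each side. On the shared
  indices both \<open>A i\<close> and \<open>B i\<close> are at least \<open>a / n\<close>: there
  the numerator falls short of its bound by a multiple of \<open>\<beta> - g i\<close>, and the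
  denominator exceeds its own by a multiple of \<open>g i - \<alpha>\<close>. Together these
  corrections outweigh the errors.\<close>

lemma psi_ratio_bound:
  assumes p: "1 \<le> p" and n: "1 \<le> n" and y: "\<And>i. i < n \<Longrightarrow> y i \<in> carrier_vec p"
    and unit: "\<And>i. i < n \<Longrightarrow> y i \<bullet> y i = 1"
    and cov: "\<And>v. v \<in> carrier_vec p \<Longrightarrow> \<bar>real p / real n * (\<Sum>i<n. (v \<bullet> y i)\<^sup>2) - v \<bullet> v\<bar> \<le> d * (v \<bullet> v)"
    and spread: "\<And>v. v \<in> carrier_vec p \<Longrightarrow> 3 / 4 * real n \<le> real (card {i \<in> {..<n}. a * (v \<bullet> v) \<le> real p * (v \<bullet> y i)\<^sup>2})"
    and a: "0 < a" and k: "1 \<le> k" and dk: "4 * d * k \<le> a * (k - 1)"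
    and T: "near_conformal p k T"
    and u: "u \<in> carrier_vec p" "u \<bullet> u = 1" and v: "v \<in> carrier_vec p" "v \<bullet> v = 1"
  shows "bil (psi p n y (mat_inv T)) v v \<le> k * bil (psi p n y (mat_inv T)) u u"
proof -
  note pd = near_conformal_pos_def[OF p k T]
  obtain \<alpha> where \<alpha>: "0 < \<alpha>" and lo: "\<And>v. v \<in> carrier_vec p \<Longrightarrow> \<alpha> * (v \<bullet> v) \<le> bil T v v"
    and hi: "\<And>v. v \<in> carrier_vec p \<Longrightarrow> bil T v v \<le> k * \<alpha> * (v \<bullet> v)"
    using near_conformal_alpha[OF p k T] by blast
  define \<beta> where "\<beta> = k * \<alpha>"
  have \<beta>: "0 < \<beta>" using \<alpha> k by (simp add: \<beta>_def)
  define g where "g i = 1 / bil (mat_inv T) (y i) (y i)" for i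
  have g: "\<alpha> \<le> g i" "g i \<le> \<beta>" if "i < n" for i
  proof -
    have b: "bil (mat_inv T) (y i) (y i) \<le> 1 / \<alpha>" "1 \<le> \<beta> * bil (mat_inv T) (y i) (y i)"
      using inverse_bounds[OF pd \<alpha> \<beta> lo _ y[OF that]] hi unit[OF that] unfolding \<beta>_def by auto
    have pos: "0 < bil (mat_inv T) (y i) (y i)" using b(2) \<beta> by (smt (verit) mult_nonneg_nonpos)
    show "\<alpha> \<le> g i" "g i \<le> \<beta>" using b pos \<alpha> by (simp_all add: g_def field_simps)
  qed
  define A where "A i = real p / real n * (v \<bullet> y i)\<^sup>2" for i
  define B where "B i = real p / real n * (u \<bullet> y i)\<^sup>2" for i
  have A0: "0 \<le> A i" and B0: "0 \<le> B i" for i by (auto simp: A_def B_def)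
  have sA: "(\<Sum>i<n. A i) \<le> 1 + d" using cov[OF v(1)] v(2) by (simp add: A_def sum_distrib_left)
  have sB: "1 - d \<le> (\<Sum>i<n. B i)" using cov[OF u(1)] u(2) by (simp add: B_def sum_distrib_left)
  have V: "bil (psi p n y (mat_inv T)) v v = (\<Sum>i<n. A i * g i)"
    by (subst bil_psi[OF y v(1) v(1)]) (auto simp: A_def g_def sum_distrib_left power2_eq_square)
  have U: "bil (psi p n y (mat_inv T)) u u = (\<Sum>i<n. B i * g i)"
    by (subst bil_psi[OF y u(1) u(1)]) (auto simp: B_def g_def sum_distrib_left power2_eq_square)
  define JA where "JA = {i \<in> {..<n}. a * (v \<bullet> v) \<le> real p * (v \<bullet> y i)\<^sup>2}"
  define JB where "JB = {i \<in> {..<n}. a * (u \<bullet> u) \<le> real p * (u \<bullet> y i)\<^sup>2}"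
  have J: "real n / 2 \<le> real (card (JA \<inter> JB))"
    by (rule card_majority_overlap) (use spread[OF v(1)] spread[OF u(1)] in \<open>auto simp: JA_def JB_def\<close>)
  let ?J = "JA \<inter> JB"
  have Jn: "?J \<subseteq> {..<n}" by (auto simp: JA_def)
  have AJ: "a / real n \<le> A i" if "i \<in> ?J" for i using that v n by (auto simp: JA_def A_def field_simps)
  have BJ: "a / real n \<le> B i" if "i \<in> ?J" for i using that u n by (auto simp: JB_def B_def field_simps)
  have "(\<Sum>i\<in>?J. a / real n * (\<beta> - g i)) \<le> (\<Sum>i\<in>?J. A i * (\<beta> - g i))"
    using AJ g Jn by (intro sum_mono mult_right_mono) auto
  also have "\<dots> \<le> (\<Sum>i<n. A i * (\<beta> - g i))"
    using Jn A0 g by (intro sum_mono2) (auto intro!: mult_nonneg_nonneg)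
  also have "\<dots> = \<beta> * (\<Sum>i<n. A i) - (\<Sum>i<n. A i * g i)"
    by (simp add: sum_distrib_left sum_subtractf[symmetric] algebra_simps)
  also have "\<dots> \<le> \<beta> * (1 + d) - (\<Sum>i<n. A i * g i)" using mult_left_mono[OF sA, of \<beta>] \<beta> by simp
  finally have 1: "(\<Sum>i<n. A i * g i) \<le> \<beta> * (1 + d) - (\<Sum>i\<in>?J. a / real n * (\<beta> - g i))" by simp
  have "(\<Sum>i\<in>?J. a / real n * (g i - \<alpha>)) \<le> (\<Sum>i\<in>?J. B i * (g i - \<alpha>))"
    using BJ g Jn by (intro sum_mono mult_right_mono) auto
  also have "\<dots> \<le> (\<Sum>i<n. B i * (g i - \<alpha>))"
    using Jn B0 g by (intro sum_mono2) (auto intro!: mult_nonneg_nonneg)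
  also have "\<dots> = (\<Sum>i<n. B i * g i) - \<alpha> * (\<Sum>i<n. B i)"
    by (simp add: sum_distrib_left sum_subtractf[symmetric] algebra_simps)
  also have "\<dots> \<le> (\<Sum>i<n. B i * g i) - \<alpha> * (1 - d)" using mult_left_mono[OF sB, of \<alpha>] \<alpha> by simp
  finally have 2: "\<alpha> * (1 - d) + (\<Sum>i\<in>?J. a / real n * (g i - \<alpha>)) \<le> (\<Sum>i<n. B i * g i)" by simp
  have 3: "k * (\<alpha> * (1 - d) + (\<Sum>i\<in>?J. a / real n * (g i - \<alpha>))) \<le> k * (\<Sum>i<n. B i * g i)"
    using 2 k by (intro mult_left_mono) auto
  have 4: "(\<Sum>i\<in>?J. a / real n * (g i - \<alpha>)) \<le> k * (\<Sum>i\<in>?J. a / real n * (g i - \<alpha>))"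
  proof -
    have "0 \<le> (\<Sum>i\<in>?J. a / real n * (g i - \<alpha>))" using g Jn a by (intro sum_nonneg mult_nonneg_nonneg) auto
    then show ?thesis using k mult_right_mono[of 1 k "\<Sum>i\<in>?J. a / real n * (g i - \<alpha>)"] by simp
  qed
  \<comment> \<open>The unknown \<open>g i\<close> cancels, leaving
    \<open>\<beta> - \<alpha>\<close> for each of at least \<open>n / 2\<close> indices.\<close>
  have "(\<Sum>i\<in>?J. a / real n * (\<beta> - g i)) + (\<Sum>i\<in>?J. a / real n * (g i - \<alpha>)) = (\<Sum>i\<in>?J. a / real n * (\<beta> - \<alpha>))"
    unfolding sum.distrib[symmetric] distrib_left[symmetric] by simp
  also have "\<dots> = real (card ?J) * (a / real n * (\<beta> - \<alpha>))" by simp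
  also have "\<dots> \<ge> real n / 2 * (a / real n * (\<beta> - \<alpha>))"
  proof (rule mult_right_mono[OF J])
    have "\<alpha> \<le> \<beta>" using \<alpha> k by (simp add: \<beta>_def)
    then show "0 \<le> a / real n * (\<beta> - \<alpha>)" using a by simp
  qed
  also have "real n / 2 * (a / real n * (\<beta> - \<alpha>)) = a / 2 * (\<beta> - \<alpha>)" using n by simp
  finally have 5: "a / 2 * (\<beta> - \<alpha>) \<le> (\<Sum>i\<in>?J. a / real n * (\<beta> - g i)) + (\<Sum>i\<in>?J. a / real n * (g i - \<alpha>))" .
  have "4 * d * k * \<alpha> \<le> a * (k - 1) * \<alpha>" using dk \<alpha> by (intro mult_right_mono) auto
  \<comment> \<open>The covariance errors \<open>d \<beta>\<close> of numerator and denominator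
    together stay below the gain; this is half of the hypothesis \<open>dk\<close> multiplied by
    \<alpha>.\<close>
  then have 6: "2 * d * \<beta> \<le> a / 2 * (\<beta> - \<alpha>)" by (simp add: \<beta>_def algebra_simps)
  have "k * (\<alpha> * (1 - d)) = \<beta> - d * \<beta>" by (simp add: \<beta>_def algebra_simps)
  then have "\<beta> - d * \<beta> + (\<Sum>i\<in>?J. a / real n * (g i - \<alpha>)) \<le> k * (\<Sum>i<n. B i * g i)"
    using 3 4 by (simp add: distrib_left)
  moreover have "\<beta> * (1 + d) = \<beta> + d * \<beta>" by (simp add: algebra_simps)
  ultimately show ?thesis unfolding U V using 1 5 6 by linarith
qed

lemma near_conformal_one:
  assumes "1 \<le> k" shows "near_conformal p k (1\<^sub>m p)"
  unfolding near_conformal_def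
proof (intro conjI ballI)
  fix u v :: "real vec" assume uv: "u \<in> carrier_vec p" "v \<in> carrier_vec p"
  have "1 * ((u \<bullet> u) * (v \<bullet> v)) \<le> k * ((u \<bullet> u) * (v \<bullet> v))"
    using assms by (intro mult_right_mono mult_nonneg_nonneg scalar_prod_nonneg)
  then show "bil (1\<^sub>m p) v v * (u \<bullet> u) \<le> k * bil (1\<^sub>m p) u u * (v \<bullet> v)"
    using uv by (simp add: bil_one mult.commute mult.left_commute)
qed (auto simp: sym_mat_def mat_trace_def)

lemma near_conformal_homogeneous:
  assumes S: "pos_def p S" and k: "1 \<le> k" and s: "s = real p / mat_trace S" "mat_trace S > 0"
    and r: "\<And>u v. u \<in> carrier_vec p \<Longrightarrow> v \<in> carrier_vec p \<Longrightarrow> u \<bullet> u = 1 \<Longrightarrow> v \<bullet> v = 1 \<Longrightarrow> bil S v v \<le> k * bil S u u"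
  shows "near_conformal p k (s \<cdot>\<^sub>m S)"
  unfolding near_conformal_def
proof (intro conjI ballI)
  have Sc: "S \<in> carrier_mat p p" using S by (simp add: pos_def_def)
  show "sym_mat p (s \<cdot>\<^sub>m S)"
    by (rule sym_mat_entryI) (use Sc sym_mat_entry[OF pos_def_sym[OF S]] in auto)
  show "mat_trace (s \<cdot>\<^sub>m S) = real p" using s by (simp add: mat_trace_smult[OF Sc])
  fix u v :: "real vec" assume u: "u \<in> carrier_vec p" and v: "v \<in> carrier_vec p"
  have s0: "0 \<le> s" using s by simp
  show "bil (s \<cdot>\<^sub>m S) v v * (u \<bullet> u) \<le> k * bil (s \<cdot>\<^sub>m S) u u * (v \<bullet> v)"
  proof (cases "u = 0\<^sub>v p \<or> v = 0\<^sub>v p")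
    case True
    moreover have "bil (s \<cdot>\<^sub>m S) (0\<^sub>v p) (0\<^sub>v p) = 0"
      using bil_smult_mat[OF Sc, of "0\<^sub>v p" "0\<^sub>v p" s] Sc by (simp add: bil_def mult_mat_zero_vec)
    ultimately show ?thesis by auto
  next
    case False
    then have pu: "0 < u \<bullet> u" and pv: "0 < v \<bullet> v" using scalar_prod_pos u v by auto
    have "bil S ((1 / vnorm v) \<cdot>\<^sub>v v) ((1 / vnorm v) \<cdot>\<^sub>v v) \<le> k * bil S ((1 / vnorm u) \<cdot>\<^sub>v u) ((1 / vnorm u) \<cdot>\<^sub>v u)"
      using False u v by (intro r normalized_bil(2)[OF Sc]) auto
    then have "bil S v v / (v \<bullet> v) \<le> k * (bil S u u / (u \<bullet> u))"
      using False u v by (simp add: normalized_bil(1)[OF Sc])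
    then have "bil S v v * (u \<bullet> u) \<le> k * bil S u u * (v \<bullet> v)" using pu pv by (simp add: field_simps)
    then have "s * (bil S v v * (u \<bullet> u)) \<le> s * (k * bil S u u * (v \<bullet> v))" using s0 by (rule mult_left_mono)
    then show ?thesis by (simp add: bil_smult_mat[OF Sc] u v algebra_simps)
  qed
qed

text \<open>Every nonzero sample contributes \<open>p / n\<close> to the trace, since its own
  quadratic form appears in numerator and denominator. For a solution of \<open>psi = b T\<close>
  this forces \<open>b = 1\<close>.\<close>

lemma mat_trace_mult_psi:
  assumes n: "1 \<le> n" and x: "\<And>i. i < n \<Longrightarrow> x i \<in> carrier_vec p" and nz: "\<And>i. i < n \<Longrightarrow> x i \<noteq> 0\<^sub>v p"
    and P: "pos_def p P"
  shows "mat_trace (P * psi p n x P) = real p"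
proof -
  have Pc: "P \<in> carrier_mat p p" using P by (simp add: pos_def_def)
  have "mat_trace (P * psi p n x P) = (\<Sum>a<p. \<Sum>b<p. P $$ (a, b) * psi p n x P $$ (b, a))"
    by (rule mat_trace_mult[OF Pc psi_carrier])
  also have "\<dots> = (\<Sum>a<p. \<Sum>b<p. \<Sum>i<n. real p / real n * (x i $ a * P $$ (a, b) * x i $ b / bil P (x i) (x i)))"
    by (simp add: psi_def sum_distrib_left bil_def algebra_simps)
  also have "\<dots> = (\<Sum>a<p. \<Sum>i<n. \<Sum>b<p. real p / real n * (x i $ a * P $$ (a, b) * x i $ b / bil P (x i) (x i)))"
    by (intro sum.cong refl sum.swap)
  also have "\<dots> = (\<Sum>i<n. \<Sum>a<p. \<Sum>b<p. real p / real n * (x i $ a * P $$ (a, b) * x i $ b / bil P (x i) (x i)))"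
    by (rule sum.swap)
  also have "\<dots> = (\<Sum>i<n. real p / real n)"
  proof (rule sum.cong[OF refl])
    fix i assume "i \<in> {..<n}"
    then have i: "i < n" by simp
    have "(\<Sum>a<p. \<Sum>b<p. real p / real n * (x i $ a * P $$ (a, b) * x i $ b / bil P (x i) (x i)))
      = real p / real n * ((\<Sum>a<p. \<Sum>b<p. x i $ a * P $$ (a, b) * x i $ b) / bil P (x i) (x i))"
      by (simp only: sum_distrib_left sum_divide_distrib)
    also have "\<dots> = real p / real n"
      unfolding bil_sum[OF Pc x[OF i] x[OF i], symmetric] using pos_defD[OF P x[OF i] nz[OF i]] by simp
    finally show "(\<Sum>a<p. \<Sum>b<p. real p / real n * (x i $ a * P $$ (a, b) * x i $ b / bil P (x i) (x i))) = real p / real n" .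
  qed
  also have "\<dots> = real p" using n by simp
  finally show ?thesis .
qed

lemma pos_def_trace_pos:
  assumes "1 \<le> p" "pos_def p S" shows "0 < mat_trace S"
proof -
  have "S \<in> carrier_mat p p" using assms by (simp add: pos_def_def)
  then show ?thesis using assms by (auto simp: mat_trace_bil lessThan_empty_iff intro!: sum_pos pos_defD)
qed

text \<open>The trace and the ratio bound keep the forms of both \<open>T\<close> and its inverse
  below \<open>k\<close>, so a second extraction lets the inverses converge as well; the limit of
  the products identifies their limit as the inverse of \<open>L\<close>.\<close>

lemma near_conformal_compact:
  assumes p: "1 \<le> p" and k: "1 \<le> k" and T: "\<And>j. near_conformal p k (T j)"
  shows "\<exists>L r. strict_mono (r :: nat \<Rightarrow> nat) \<and> near_conformal p k L \<and> mconv p (T \<circ> r) L \<and>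
    mconv p (\<lambda>j. mat_inv (T (r j))) (mat_inv L)"
proof -
  have s: "sym_mat p (T j)" for j using T by (simp add: near_conformal_def)
  have pd: "pos_def p (T j)" for j by (rule near_conformal_pos_def[OF p k T])
  have k0: "0 \<le> k" using k by simp
  have q: "\<bar>bil (T j) v v\<bar> \<le> k * (v \<bullet> v)" if "v \<in> carrier_vec p" for j v
    using near_conformal_bounds(1)[OF p k T that] psd_bil_nonneg[OF pd that] by simp
  have "\<bar>T j $$ (a, b)\<bar> \<le> k" if "a < p" "b < p" for j a b
    using symmetric_bil_bound[OF s k0 q, of "unit_vec p a" "unit_vec p b" j] that
    by (simp add: bil_unit_vec[OF sym_matD(1)[OF s]] vnorm_def)
  then have "\<exists>L r. strict_mono (r :: nat \<Rightarrow> nat) \<and> mconv p (T \<circ> r) L"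
    by (intro bounded_mat_convergent_subseq[where B = k] sym_matD(1)[OF s])
  then obtain L r where r: "strict_mono r" and L: "mconv p (T \<circ> r) L" by blast
  have s': "sym_mat p (mat_inv (T (r j)))" for j by (rule mat_inv_sym[OF pd])
  have q': "\<bar>bil (mat_inv (T (r j))) v v\<bar> \<le> k * (v \<bullet> v)" if v: "v \<in> carrier_vec p" for j v
  proof -
    have "bil (mat_inv (T (r j))) v v \<le> (v \<bullet> v) / (1 / k)"
      by (rule inverse_bounds(1)[OF pd _ _ _ _ v, of "1 / k" k])
        (use near_conformal_bounds[OF p k T] k in \<open>auto simp: field_simps\<close>)
    then show ?thesis using psd_bil_nonneg[OF pos_def_inverse(2)[OF pd] v] by (simp add: mult.commute)
  qed
  have "\<bar>mat_inv (T (r j)) $$ (a, b)\<bar> \<le> k" if "a < p" "b < p" for j a b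
    using symmetric_bil_bound[OF s' k0 q', of "unit_vec p a" "unit_vec p b" j] that
    by (simp add: bil_unit_vec[OF sym_matD(1)[OF s']] vnorm_def)
  then have "\<exists>M r'. strict_mono (r' :: nat \<Rightarrow> nat) \<and> mconv p ((\<lambda>j. mat_inv (T (r j))) \<circ> r') M"
    by (intro bounded_mat_convergent_subseq[where B = k] sym_matD(1)[OF s'])
  then obtain M r' where r': "strict_mono r'" and M: "mconv p ((\<lambda>j. mat_inv (T (r j))) \<circ> r') M" by blast
  have L': "mconv p ((T \<circ> r) \<circ> r') L" by (rule mconv_subseq[OF L r'])
  have nc: "near_conformal p k L" unfolding near_conformal_def
  proof (intro conjI ballI)
    show "sym_mat p L" by (rule mconv_sym[OF L]) (simp add: s)
    show "mat_trace L = real p"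
      using mconv_trace[OF L] T by (simp add: near_conformal_def LIMSEQ_const_iff)
    fix u v :: "real vec" assume u: "u \<in> carrier_vec p" and v: "v \<in> carrier_vec p"
    have "(\<lambda>j. bil ((T \<circ> r) j) v v * (u \<bullet> u)) \<longlonglongrightarrow> bil L v v * (u \<bullet> u)"
      "(\<lambda>j. k * bil ((T \<circ> r) j) u u * (v \<bullet> v)) \<longlonglongrightarrow> k * bil L u u * (v \<bullet> v)"
      by (intro tendsto_intros bil_tendsto[OF L] vconv_const u v)+
    then show "bil L v v * (u \<bullet> u) \<le> k * bil L u u * (v \<bullet> v)"
      by (rule LIMSEQ_le) (use T u v in \<open>auto simp: near_conformal_def\<close>)
  qed
  have pL: "pos_def p L" by (rule near_conformal_pos_def[OF p k nc])
  have "mconv p (\<lambda>j. ((T \<circ> r) \<circ> r') j * ((\<lambda>j. mat_inv (T (r j))) \<circ> r') j) (L * M)" by (rule mconv_mult[OF L' M])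
  then have "mconv p (\<lambda>j. 1\<^sub>m p) (L * M)" using pos_def_inverse(3)[OF pd] by (simp add: o_def)
  then have LM: "L * M = 1\<^sub>m p" using mconv_unique[OF _ mconv_const[of "1\<^sub>m p" p]] by simp
  have "mat_inv L = M" by (rule mat_inverse_eqI[of _ p, OF _ _ LM pL]) (use L M in \<open>auto simp: mconv_def\<close>)
  then show ?thesis
    using nc L' M strict_mono_o[OF r r'] by (intro exI[of _ L] exI[of _ "r \<circ> r'"]) (simp add: o_def)
qed

text \<open>Collatz--Wielandt: the smallest \<open>b\<close> with \<open>\<Psi>(T\<^sup>-\<^sup>1) \<le> b T\<close> for some nearly conformal \<open>T\<close> is attained,
  and strictness would allow a smaller one.\<close>
lemma psi_fixpoint_exists:
  assumes p: "1 \<le> p" and n: "1 \<le> n" and x: "\<And>i. i < n \<Longrightarrow> x i \<in> carrier_vec p" and ov: "overlap p n x"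
    and nz: "\<And>i. i < n \<Longrightarrow> x i \<noteq> 0\<^sub>v p" and k: "1 \<le> k"
    and inv: "\<And>T u v. near_conformal p k T \<Longrightarrow> u \<in> carrier_vec p \<Longrightarrow> v \<in> carrier_vec p \<Longrightarrow>
      u \<bullet> u = 1 \<Longrightarrow> v \<bullet> v = 1 \<Longrightarrow> bil (psi p n x (mat_inv T)) v v \<le> k * bil (psi p n x (mat_inv T)) u u"
  shows "\<exists>T. near_conformal p k T \<and> psi p n x (mat_inv T) = T"
proof -
  note ncp = near_conformal_pos_def[OF p k]
  define good where "good b T \<longleftrightarrow> near_conformal p k T \<and>
    (\<forall>v \<in> carrier_vec p. bil (psi p n x (mat_inv T)) v v \<le> b * bil T v v)" for b T
  define S where "S = {b. 0 \<le> b \<and> (\<exists>T. good b T)}"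
  have psip: "pos_def p (psi p n x (mat_inv T))" if "near_conformal p k T" for T
    by (rule psi_pos_def[OF p x ov pos_def_inverse(2)[OF ncp[OF that]]])
  \<comment> \<open>The optimal constant of each candidate, with a vector that attains it. It shows
    that \<open>S\<close> is nonempty and later supplies the vector at which strictness is
    applied.\<close>
  have attain: "\<exists>b>0. good b T \<and> (\<exists>v \<in> carrier_vec p. v \<noteq> 0\<^sub>v p \<and> bil (psi p n x (mat_inv T)) v v = b * bil T v v)"
    if T: "near_conformal p k T" for T
  proof -
    obtain b v where v: "v \<in> carrier_vec p" "v \<noteq> 0\<^sub>v p" "bil (psi p n x (mat_inv T)) v v = b * bil T v v"
      and le: "\<forall>u \<in> carrier_vec p. bil (psi p n x (mat_inv T)) u u \<le> b * bil T u u"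
      using generalized_rayleigh_max[OF p ncp[OF T] psi_carrier, of n x "mat_inv T"] by blast
    have "0 < b * bil T v v" using v(3) pos_defD[OF psip[OF T] v(1,2)] by simp
    then have "0 < b" using pos_defD[OF ncp[OF T] v(1,2)] by (simp add: zero_less_mult_iff)
    then show ?thesis using v le T unfolding good_def by blast
  qed
  have S0: "S \<noteq> {}" using attain[OF near_conformal_one[OF k]] unfolding S_def by force
  have Sb: "bdd_below S" unfolding S_def by (rule bdd_belowI[of _ 0]) auto
  define b0 where "b0 = Inf S"
  have "\<exists>b \<in> S. b < b0 + 1 / (real j + 1)" for j :: nat
    using cInf_lessD[OF S0, of "b0 + 1 / (real j + 1)"] by (auto simp: b0_def)
  then have "\<forall>j :: nat. \<exists>b T. b0 \<le> b \<and> b < b0 + 1 / (real j + 1) \<and> good b T"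
    unfolding S_def b0_def using cInf_lower[OF _ Sb] by (fastforce simp: S_def)
  then obtain b T where b: "\<And>j. b0 \<le> b j" "\<And>j. b j < b0 + 1 / (real j + 1)" and T: "\<And>j. good (b j) (T j)"
    by metis
  have blim: "b \<longlonglongrightarrow> b0"
  proof (rule tendsto_sandwich[where f = "\<lambda>_. b0" and h = "\<lambda>j. b0 + 1 / (real j + 1)"])
    show "(\<lambda>j. b0 + 1 / (real j + 1)) \<longlonglongrightarrow> b0"
      using tendsto_add[OF tendsto_const[of b0] LIMSEQ_inverse_real_of_nat] by (simp add: inverse_eq_divide add.commute)
    show "\<forall>\<^sub>F j in sequentially. b0 \<le> b j" "\<forall>\<^sub>F j in sequentially. b j \<le> b0 + 1 / (real j + 1)"
      by (intro always_eventually allI b less_imp_le[OF b(2)])+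
  qed simp
  have Tn: "near_conformal p k (T j)" for j using T by (simp add: good_def)
  from near_conformal_compact[where T = T, OF p k Tn]
  obtain L r where r: "strict_mono r" and L: "near_conformal p k L" "mconv p (T \<circ> r) L"
    "mconv p (\<lambda>j. mat_inv (T (r j))) (mat_inv L)" by (elim exE conjE) (rule that)
  note Lp = ncp[OF L(1)]
  have Lle: "bil (psi p n x (mat_inv L)) v v \<le> b0 * bil L v v" if v: "v \<in> carrier_vec p" for v
  proof (rule LIMSEQ_le)
    show "(\<lambda>j. bil (psi p n x (mat_inv (T (r j)))) v v) \<longlonglongrightarrow> bil (psi p n x (mat_inv L)) v v"
    proof -
      have "(\<lambda>j. real p / real n * (\<Sum>i<n. (v \<bullet> x i) * (v \<bullet> x i) / bil (mat_inv (T (r j))) (x i) (x i)))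
        \<longlonglongrightarrow> real p / real n * (\<Sum>i<n. (v \<bullet> x i) * (v \<bullet> x i) / bil (mat_inv L) (x i) (x i))"
      proof (rule tendsto_mult[OF tendsto_const tendsto_sum])
        fix i assume "i \<in> {..<n}"
        then have i: "i < n" by simp
        show "(\<lambda>j. (v \<bullet> x i) * (v \<bullet> x i) / bil (mat_inv (T (r j))) (x i) (x i)) \<longlonglongrightarrow>
          (v \<bullet> x i) * (v \<bullet> x i) / bil (mat_inv L) (x i) (x i)"
          using pos_defD[OF pos_def_inverse(2)[OF Lp] x[OF i] nz[OF i]]
          by (intro tendsto_divide[OF tendsto_const] bil_tendsto[OF L(3)] vconv_const x[OF i]) simp
      qed
      moreover have "bil (psi p n x Q) v v = real p / real n * (\<Sum>i<n. (v \<bullet> x i) * (v \<bullet> x i) / bil Q (x i) (x i))" for Q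
        by (rule bil_psi[OF x v v])
      ultimately show ?thesis by simp
    qed
    show "(\<lambda>j. b (r j) * bil ((T \<circ> r) j) v v) \<longlonglongrightarrow> b0 * bil L v v"
      by (intro tendsto_mult bil_tendsto[OF L(2)] vconv_const v LIMSEQ_subseq_LIMSEQ[OF blim r, unfolded o_def])
    show "\<exists>N. \<forall>j\<ge>N. bil (psi p n x (mat_inv (T (r j)))) v v \<le> b (r j) * bil ((T \<circ> r) j) v v"
      using T v by (auto simp: good_def)
  qed
  have b0: "0 < b0"
  proof -
    obtain v :: "real vec" where v: "v \<in> carrier_vec p" "v \<bullet> v = 1" using unit_vec_sphere[OF p] by auto
    have v0: "v \<noteq> 0\<^sub>v p" using v by auto
    have "0 < b0 * bil L v v" using Lle[OF v(1)] pos_defD[OF psip[OF L(1)] v(1) v0] by linarith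
    then show ?thesis using pos_defD[OF Lp v(1) v0] by (simp add: zero_less_mult_iff)
  qed
  define s where "s = real p / mat_trace (psi p n x (mat_inv L))"
  have tr: "0 < mat_trace (psi p n x (mat_inv L))" by (rule pos_def_trace_pos[OF p psip[OF L(1)]])
  have s: "0 < s" using tr p by (simp add: s_def)
  \<comment> \<open>One application of the map to the minimiser, rescaled to the right trace;
    \<open>inv\<close> keeps it among the nearly conformal matrices.\<close>
  define T1 where "T1 = s \<cdot>\<^sub>m psi p n x (mat_inv L)"
  have T1: "near_conformal p k T1" unfolding T1_def
    by (rule near_conformal_homogeneous[OF psip[OF L(1)] k s_def tr inv[OF L(1)]])
  have T1b: "bil T1 u v = s * bil (psi p n x (mat_inv L)) u v" if "u \<in> carrier_vec p" "v \<in> carrier_vec p" for u v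
    unfolding T1_def by (rule bil_smult_mat[OF psi_carrier that])
  have "(s * b0) \<cdot>\<^sub>m mat_inv T1 = mat_inv L"
  proof (rule ccontr)
    assume ne: "(s * b0) \<cdot>\<^sub>m mat_inv T1 \<noteq> mat_inv L"
    have le: "bil T1 v v \<le> s * b0 * bil L v v" if "v \<in> carrier_vec p" for v
      using T1b[OF that that] Lle[OF that] s by simp
    have sb: "0 < s * b0" using s b0 by simp
    obtain b1 v where b1: "good b1 T1" "0 < b1" and v: "v \<in> carrier_vec p" "v \<noteq> 0\<^sub>v p"
      "bil (psi p n x (mat_inv T1)) v v = b1 * bil T1 v v" using attain[OF T1] by blast
    \<comment> \<open>Strictness is used at the vector where \<open>T1\<close> attains its own
      constant \<open>b1\<close>. The scale \<open>s\<close> cancels by homogeneity, and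
      \<open>b1 < b0\<close> contradicts minimality.\<close>
    have "bil (psi p n x (mat_inv T1)) v v < s * b0 * bil (psi p n x (mat_inv L)) v v"
      by (rule psi_strict[OF x ov Lp ncp[OF T1] sb le ne v(1,2) p])
    also have "\<dots> = b0 * bil T1 v v" using T1b[OF v(1) v(1)] by simp
    finally have "b1 * bil T1 v v < b0 * bil T1 v v" using v(3) by simp
    then have "b1 < b0" using pos_defD[OF ncp[OF T1] v(1,2)] by simp
    moreover have "b0 \<le> b1" unfolding b0_def using b1 by (intro cInf_lower[OF _ Sb]) (auto simp: S_def)
    ultimately show False by simp
  qed
  then have T1L: "T1 = (s * b0) \<cdot>\<^sub>m L" by (rule proportional_inverses[OF Lp ncp[OF T1]])
  have Lc: "L \<in> carrier_mat p p" using Lp by (simp add: pos_def_def)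
  have psiL: "psi p n x (mat_inv L) = b0 \<cdot>\<^sub>m L"
  proof (rule eq_mat_bilI[OF psi_carrier])
    fix u v :: "real vec" assume u: "u \<in> carrier_vec p" and v: "v \<in> carrier_vec p"
    have "s * bil (psi p n x (mat_inv L)) u v = s * (b0 * bil L u v)"
      using T1b[OF u v] unfolding T1L bil_smult_mat[OF Lc u v] by (simp only: mult.assoc)
    then show "bil (psi p n x (mat_inv L)) u v = bil (b0 \<cdot>\<^sub>m L) u v"
      using s by (simp add: bil_smult_mat[OF Lc u v])
  qed (use Lc in simp)
  have Pc: "mat_inv L \<in> carrier_mat p p" using pos_def_inverse(2)[OF Lp] by (simp add: pos_def_def)
  have "real p = mat_trace (mat_inv L * psi p n x (mat_inv L))"
    by (rule mat_trace_mult_psi[OF n x nz pos_def_inverse(2)[OF Lp], symmetric])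
  also have "\<dots> = mat_trace (b0 \<cdot>\<^sub>m (mat_inv L * L))" unfolding psiL mult_smult_distrib[OF Pc Lc] ..
  also have "\<dots> = b0 * real p" unfolding pos_def_inverse(4)[OF Lp] by (simp add: mat_trace_def)
  finally have "b0 = 1" using p by simp
  then have "psi p n x (mat_inv L) = L" unfolding psiL using Lc by (intro eq_matI) auto
  then show ?thesis using L(1) by blast
qed

section \<open>Tyler's estimator of whitened samples\<close>

lemma spread_overlap:
  assumes p: "1 \<le> p" and n: "1 \<le> n" and a: "0 < a"
    and spread: "\<And>v. v \<in> carrier_vec p \<Longrightarrow> 3 / 4 * real n \<le> real (card {i \<in> {..<n}. a * (v \<bullet> v) \<le> real p * (v \<bullet> y i)\<^sup>2})"
  shows "overlap p n y"
  unfolding overlap_def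
proof (intro ballI impI)
  fix u v :: "real vec" assume u: "u \<in> carrier_vec p" "u \<noteq> 0\<^sub>v p" and v: "v \<in> carrier_vec p" "v \<noteq> 0\<^sub>v p"
  define JA where "JA = {i \<in> {..<n}. a * (v \<bullet> v) \<le> real p * (v \<bullet> y i)\<^sup>2}"
  define JB where "JB = {i \<in> {..<n}. a * (u \<bullet> u) \<le> real p * (u \<bullet> y i)\<^sup>2}"
  have "real n / 2 \<le> real (card (JA \<inter> JB))"
    by (rule card_majority_overlap) (use spread[OF v(1)] spread[OF u(1)] in \<open>auto simp: JA_def JB_def\<close>)
  then have "0 < card (JA \<inter> JB)" using n by linarith
  then obtain i where i: "i \<in> JA" "i \<in> JB" by (auto simp: card_gt_0_iff)
  have "0 < a * (v \<bullet> v)" "0 < a * (u \<bullet> u)" using a scalar_prod_pos[OF u] scalar_prod_pos[OF v] by auto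
  then have "v \<bullet> y i \<noteq> 0" "u \<bullet> y i \<noteq> 0" using i by (auto simp: JA_def JB_def)
  then show "\<exists>i<n. u \<bullet> y i \<noteq> 0 \<and> v \<bullet> y i \<noteq> 0" using i by (auto simp: JA_def)
qed

lemma conj_inverse:
  assumes c: "B \<in> carrier_mat p p" "C \<in> carrier_mat p p" "T \<in> carrier_mat p p" "P \<in> carrier_mat p p"
    and BC: "B * C = (1\<^sub>m p :: real mat)" and TP: "T * P = 1\<^sub>m p"
  shows "B * T * B * (C * P * C) = 1\<^sub>m p"
proof -
  have PC: "P * C \<in> carrier_mat p p" by (rule mult_carrier_mat[OF c(4,2)])
  have BT: "B * T \<in> carrier_mat p p" by (rule mult_carrier_mat[OF c(1,3)])
  have "B * (C * P * C) = B * (C * (P * C))" by (simp only: assoc_mult_mat[OF c(2,4,2)])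
  also have "\<dots> = B * C * (P * C)" by (rule assoc_mult_mat[symmetric, OF c(1,2) PC])
  also have "\<dots> = P * C" unfolding BC by (rule left_mult_one_mat[OF PC])
  finally have 1: "B * (C * P * C) = P * C" .
  have "B * T * B * (C * P * C) = B * T * (B * (C * P * C))"
    by (rule assoc_mult_mat[OF BT c(1) mult_carrier_mat[OF mult_carrier_mat[OF c(2,4)] c(2)]])
  also have "\<dots> = B * (T * (P * C))" unfolding 1 by (rule assoc_mult_mat[OF c(1,3) PC])
  also have "T * (P * C) = T * P * C" by (rule assoc_mult_mat[symmetric, OF c(3,4,2)])
  also have "\<dots> = C" unfolding TP by (rule left_mult_one_mat[OF c(2)])
  finally show ?thesis using BC by simp
qed

lemma smult_mat_inverse:
  assumes c: "T \<in> carrier_mat p p" "P \<in> carrier_mat p p" and TP: "T * P = (1\<^sub>m p :: real mat)" and s: "s \<noteq> 0"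
  shows "(s \<cdot>\<^sub>m T) * ((1 / s) \<cdot>\<^sub>m P) = 1\<^sub>m p"
proof -
  have sP: "(1 / s) \<cdot>\<^sub>m P \<in> carrier_mat p p" using c by simp
  have "(s \<cdot>\<^sub>m T) * ((1 / s) \<cdot>\<^sub>m P) = s \<cdot>\<^sub>m (T * ((1 / s) \<cdot>\<^sub>m P))" by (rule mult_smult_assoc_mat[OF c(1) sP])
  also have "T * ((1 / s) \<cdot>\<^sub>m P) = (1 / s) \<cdot>\<^sub>m (T * P)" by (rule mult_smult_distrib[OF c])
  finally show ?thesis unfolding TP using s by (intro eq_matI) auto
qed

text \<open>With \<open>B\<close> the square root of \<open>S\<close>, a fixed point
  \<open>T0\<close> for the \<open>y i\<close> gives the solution \<open>B T0 B / t\<close> for the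
  \<open>x i\<close>: the factors \<open>c i\<close> cancel, since numerator and denominator are
  quadratic in \<open>x i\<close>. The whitened inverse becomes \<open>t\<close> times the inverse
  of \<open>T0\<close>, with spectrum between \<open>1 / k\<close> and \<open>k\<close>.\<close>

lemma whitened_tyler:
  assumes p: "1 \<le> p" and n: "1 \<le> n" and S: "pos_def p S" "mat_trace S = real p"
    and y: "\<And>i. i < n \<Longrightarrow> y i \<in> carrier_vec p" and unit: "\<And>i. i < n \<Longrightarrow> y i \<bullet> y i = 1"
    and cov: "\<And>v. v \<in> carrier_vec p \<Longrightarrow> \<bar>real p / real n * (\<Sum>i<n. (v \<bullet> y i)\<^sup>2) - v \<bullet> v\<bar> \<le> d * (v \<bullet> v)"
    and spread: "\<And>v. v \<in> carrier_vec p \<Longrightarrow> 3 / 4 * real n \<le> real (card {i \<in> {..<n}. a * (v \<bullet> v) \<le> real p * (v \<bullet> y i)\<^sup>2})"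
    and a: "0 < a" and k: "1 \<le> k" and dk: "4 * d * k \<le> a * (k - 1)"
    and c: "\<And>i. i < n \<Longrightarrow> c i \<noteq> 0" and xy: "\<And>i. i < n \<Longrightarrow> x i = c i \<cdot>\<^sub>v (mat_sqrt S *\<^sub>v y i)"
  shows "tyler_exists p n x \<and> op_norm (1\<^sub>m p - mat_sqrt S * mat_inv (tyler p n x) * mat_sqrt S) \<le> k - 1"
proof -
  define B where "B = mat_sqrt S"
  have Bp: "pos_def p B" and BB: "B * B = S" using mat_sqrt[OF p S(1)] by (auto simp: B_def)
  note Bs = pos_def_sym[OF Bp] and Bc = sym_matD(1)[OF pos_def_sym[OF Bp]]
  define C where "C = mat_inv B"
  have Cp: "pos_def p C" and BC: "B * C = 1\<^sub>m p" and CB: "C * B = 1\<^sub>m p" using pos_def_inverse[OF Bp] by (auto simp: C_def)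
  note Cs = pos_def_sym[OF Cp] and Cc = sym_matD(1)[OF pos_def_sym[OF Cp]]
  have CBv: "C *\<^sub>v (B *\<^sub>v v) = v" if "v \<in> carrier_vec p" for v
    using assoc_mult_mat_vec[OF Cc Bc that] CB that by simp
  have Bv: "B *\<^sub>v v \<in> carrier_vec p" if "v \<in> carrier_vec p" for v by (rule mult_mat_vec_carrier[OF Bc that])
  have Bv0: "B *\<^sub>v v \<noteq> 0\<^sub>v p" if "v \<in> carrier_vec p" "v \<noteq> 0\<^sub>v p" for v
    using CBv[OF that(1)] that mult_mat_zero_vec[OF Cc] by metis
  have ynz: "y i \<noteq> 0\<^sub>v p" if "i < n" for i using unit[OF that] by auto
  have xc: "x i \<in> carrier_vec p" if "i < n" for i
    using xy[OF that] Bv[OF y[OF that]] by (simp add: B_def)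
  have xnz: "x i \<noteq> 0\<^sub>v p" if "i < n" for i
  proof
    assume "x i = 0\<^sub>v p"
    then have "c i \<cdot>\<^sub>v (B *\<^sub>v y i) = 0\<^sub>v p" using xy[OF that] by (simp add: B_def)
    then have "(1 / c i) \<cdot>\<^sub>v (c i \<cdot>\<^sub>v (B *\<^sub>v y i)) = 0\<^sub>v p" by (intro eq_vecI) auto
    then have "B *\<^sub>v y i = 0\<^sub>v p" using c[OF that] by (simp add: smult_smult_assoc)
    then show False using Bv0[OF y[OF that] ynz[OF that]] by simp
  qed
  have ux: "u \<bullet> x i = c i * ((B *\<^sub>v u) \<bullet> y i)" if "i < n" "u \<in> carrier_vec p" for u i
  proof -
    have "u \<bullet> x i = c i * bil B u (y i)"
      using xy[OF that(1)] that(2) Bv[OF y[OF that(1)]] by (simp add: B_def bil_def)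
    also have "bil B u (y i) = bil B (y i) u" by (rule bil_commute[OF Bs that(2) y[OF that(1)]])
    also have "\<dots> = (B *\<^sub>v u) \<bullet> y i"
      unfolding bil_def by (rule comm_scalar_prod[OF y[OF that(1)] Bv[OF that(2)]])
    finally show ?thesis .
  qed
  have ovy: "overlap p n y" by (rule spread_overlap[OF p n a spread])
  have ovx: "overlap p n x" unfolding overlap_def
  proof (intro ballI impI)
    fix u v :: "real vec" assume u: "u \<in> carrier_vec p" "u \<noteq> 0\<^sub>v p" and v: "v \<in> carrier_vec p" "v \<noteq> 0\<^sub>v p"
    obtain i where i: "i < n" "(B *\<^sub>v u) \<bullet> y i \<noteq> 0" "(B *\<^sub>v v) \<bullet> y i \<noteq> 0"
      using ovy Bv Bv0 u v unfolding overlap_def by meson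
    then show "\<exists>i<n. u \<bullet> x i \<noteq> 0 \<and> v \<bullet> x i \<noteq> 0"
      using ux[OF i(1) u(1)] ux[OF i(1) v(1)] c[OF i(1)] by auto
  qed
  have "\<exists>T. near_conformal p k T \<and> psi p n y (mat_inv T) = T"
    by (rule psi_fixpoint_exists[OF p n y ovy ynz k psi_ratio_bound[OF p n y unit cov spread a k dk]])
  then obtain T0 where T0: "near_conformal p k T0" "psi p n y (mat_inv T0) = T0" by blast
  note T0p = near_conformal_pos_def[OF p k T0(1)]
  have T0c: "T0 \<in> carrier_mat p p" using T0p by (simp add: pos_def_def)
  define P0 where "P0 = mat_inv T0"
  have P0p: "pos_def p P0" and TP0: "T0 * P0 = 1\<^sub>m p" using pos_def_inverse[OF T0p] by (auto simp: P0_def)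
  have P0c: "P0 \<in> carrier_mat p p" using P0p by (simp add: pos_def_def)
  obtain \<alpha> where \<alpha>: "0 < \<alpha>" and lo: "\<And>v. v \<in> carrier_vec p \<Longrightarrow> \<alpha> * (v \<bullet> v) \<le> bil T0 v v"
    and hi: "\<And>v. v \<in> carrier_vec p \<Longrightarrow> bil T0 v v \<le> k * \<alpha> * (v \<bullet> v)"
    using near_conformal_alpha[OF p k T0(1)] by blast
  define R where "R = B * T0 * B"
  have Rc: "R \<in> carrier_mat p p" unfolding R_def by (rule mult_carrier_mat[OF mult_carrier_mat[OF Bc T0c] Bc])
  have Rb: "bil R u v = bil T0 (B *\<^sub>v u) (B *\<^sub>v v)" if "u \<in> carrier_vec p" "v \<in> carrier_vec p" for u v
    unfolding R_def by (rule bil_conj[OF Bs T0c that])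
  \<comment> \<open>An average of the form of \<open>T0\<close> over the images under
    \<open>B\<close> of the coordinate vectors, whose squared lengths sum to
    \<open>tr S = p\<close>; hence \<open>t\<close> lies between \<alpha> and \<open>k\<close>
    \<alpha>.\<close>
  define t where "t = mat_trace R / real p"
  have trS: "(\<Sum>i<p. (B *\<^sub>v unit_vec p i) \<bullet> (B *\<^sub>v unit_vec p i)) = real p"
  proof -
    have "mat_trace (B * 1\<^sub>m p * B) = (\<Sum>i<p. bil (1\<^sub>m p) (B *\<^sub>v unit_vec p i) (B *\<^sub>v unit_vec p i))"
      by (rule mat_trace_conj[OF Bs one_carrier_mat])
    moreover have "B * 1\<^sub>m p * B = S" unfolding right_mult_one_mat[OF Bc] by (rule BB)
    ultimately show ?thesis using S(2) Bv by (simp add: bil_one)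
  qed
  have trR: "mat_trace R = (\<Sum>i<p. bil T0 (B *\<^sub>v unit_vec p i) (B *\<^sub>v unit_vec p i))"
    unfolding R_def by (rule mat_trace_conj[OF Bs T0c])
  have "\<alpha> * real p \<le> mat_trace R" unfolding trR trS[symmetric] sum_distrib_left by (intro sum_mono lo Bv) simp
  moreover have "mat_trace R \<le> k * \<alpha> * real p" unfolding trR trS[symmetric] sum_distrib_left by (intro sum_mono hi Bv) simp
  ultimately have t: "\<alpha> \<le> t" "t \<le> k * \<alpha>" using p by (auto simp: t_def field_simps)
  have t0: "0 < t" using t \<alpha> by simp
  define T where "T = (1 / t) \<cdot>\<^sub>m R"
  define P where "P = t \<cdot>\<^sub>m (C * P0 * C)"
  have Tc: "T \<in> carrier_mat p p" using Rc by (simp add: T_def)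
  have CPC: "C * P0 * C \<in> carrier_mat p p" by (rule mult_carrier_mat[OF mult_carrier_mat[OF Cc P0c] Cc])
  have Pc: "P \<in> carrier_mat p p" using CPC by (simp add: P_def)
  have Tb: "bil T u v = 1 / t * bil T0 (B *\<^sub>v u) (B *\<^sub>v v)" if "u \<in> carrier_vec p" "v \<in> carrier_vec p" for u v
    unfolding T_def bil_smult_mat[OF Rc that] Rb[OF that] ..
  have Ts: "sym_mat p T"
    by (rule sym_mat_bilI[OF Tc]) (simp only: Tb bil_commute[OF pos_def_sym[OF T0p] Bv Bv])
  have Tp: "pos_def p T"
    by (rule pos_defI[OF Ts]) (use t0 pos_defD[OF T0p Bv Bv0] Tb in auto)
  have trT: "mat_trace T = real p" unfolding T_def mat_trace_smult[OF Rc] using t0 p by (auto simp: t_def)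
  have "(1 / t) \<cdot>\<^sub>m R * ((1 / (1 / t)) \<cdot>\<^sub>m (C * P0 * C)) = 1\<^sub>m p"
    by (rule smult_mat_inverse[OF Rc CPC]) (use t0 conj_inverse[OF Bc Cc T0c P0c BC TP0] in \<open>simp_all only: R_def, simp_all\<close>)
  then have TP: "T * P = 1\<^sub>m p" by (simp only: T_def P_def divide_divide_eq_right mult_1 div_by_1)
  have invT: "mat_inv T = P" by (rule mat_inverse_eqI[OF Tc Pc TP Tp])
  have Px: "bil P (x i) (x i) = t * (c i)\<^sup>2 * bil P0 (y i) (y i)" if i: "i < n" for i
  proof -
    have BY: "B *\<^sub>v y i \<in> carrier_vec p" by (rule Bv[OF y[OF i]])
    have "bil P (x i) (x i) = t * bil (C * P0 * C) (x i) (x i)" unfolding P_def by (rule bil_smult_mat[OF CPC xc[OF i] xc[OF i]])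
    also have "bil (C * P0 * C) (x i) (x i) = bil P0 (C *\<^sub>v x i) (C *\<^sub>v x i)" by (rule bil_conj[OF Cs P0c xc[OF i] xc[OF i]])
    also have "C *\<^sub>v x i = c i \<cdot>\<^sub>v y i"
      unfolding xy[OF i] B_def[symmetric] mult_mat_vec[OF Cc BY] CBv[OF y[OF i]] ..
    also have "bil P0 (c i \<cdot>\<^sub>v y i) (c i \<cdot>\<^sub>v y i) = (c i)\<^sup>2 * bil P0 (y i) (y i)"
      using y[OF i] P0c by (simp add: bil_linear[where p = p] power2_eq_square)
    finally show ?thesis by simp
  qed
  have fix_T: "psi p n x (mat_inv T) = T" unfolding invT
  proof (rule eq_mat_bilI[OF psi_carrier Tc])
    fix u v :: "real vec" assume u: "u \<in> carrier_vec p" and v: "v \<in> carrier_vec p"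
    have "bil (psi p n x P) u v = real p / real n * (\<Sum>i<n. (u \<bullet> x i) * (v \<bullet> x i) / bil P (x i) (x i))"
      by (rule bil_psi[OF xc u v])
    also have "(\<Sum>i<n. (u \<bullet> x i) * (v \<bullet> x i) / bil P (x i) (x i))
      = (\<Sum>i<n. 1 / t * (((B *\<^sub>v u) \<bullet> y i) * ((B *\<^sub>v v) \<bullet> y i) / bil P0 (y i) (y i)))"
      using c t0 by (intro sum.cong refl) (simp add: ux u v Px power2_eq_square field_simps)
    also have "real p / real n * \<dots> = 1 / t * (real p / real n * (\<Sum>i<n. ((B *\<^sub>v u) \<bullet> y i) * ((B *\<^sub>v v) \<bullet> y i) / bil P0 (y i) (y i)))"
      by (simp only: sum_distrib_left[symmetric] mult.left_commute)
    also have "(real p / real n * (\<Sum>i<n. ((B *\<^sub>v u) \<bullet> y i) * ((B *\<^sub>v v) \<bullet> y i) / bil P0 (y i) (y i)))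
      = bil (psi p n y P0) (B *\<^sub>v u) (B *\<^sub>v v)" by (rule bil_psi[OF y Bv[OF u] Bv[OF v], symmetric])
    also have "psi p n y P0 = T0" unfolding P0_def by (rule T0(2))
    also have "1 / t * bil T0 (B *\<^sub>v u) (B *\<^sub>v v) = bil T u v" by (rule Tb[OF u v, symmetric])
    finally show "bil (psi p n x P) u v = bil T u v" .
  qed
  have sol: "tyler_solution p n x T"
    unfolding tyler_solution_def using Tp trT xnz fix_T unfolding psi_def by blast
  have uniq: "T' = T" if "tyler_solution p n x T'" for T'
  proof -
    have T': "pos_def p T'" "mat_trace T' = real p" "psi p n x (mat_inv T') = T'"
      using that unfolding tyler_solution_def psi_def by auto
    obtain b where b: "T' = b \<cdot>\<^sub>m T" using psi_fixpoint_unique[OF p xc ovx Tp fix_T T'(1,3)] by blast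
    then have "real p = b * real p" using mat_trace_smult[OF Tc, of b] T'(2) trT by simp
    then have "b = 1" using p by simp
    then show ?thesis unfolding b using Tc by (intro eq_matI) auto
  qed
  have ex: "tyler_exists p n x" unfolding tyler_exists_def using sol uniq by blast
  have ty: "tyler p n x = T" unfolding tyler_def using sol uniq by blast
  have BPB: "B * P * B = t \<cdot>\<^sub>m P0"
  proof (rule eq_mat_bilI)
    show "B * P * B \<in> carrier_mat p p" by (rule mult_carrier_mat[OF mult_carrier_mat[OF Bc Pc] Bc])
    show "t \<cdot>\<^sub>m P0 \<in> carrier_mat p p" using P0c by simp
    fix u v :: "real vec" assume u: "u \<in> carrier_vec p" and v: "v \<in> carrier_vec p"
    have "bil (B * P * B) u v = bil P (B *\<^sub>v u) (B *\<^sub>v v)" by (rule bil_conj[OF Bs Pc u v])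
    also have "\<dots> = t * bil (C * P0 * C) (B *\<^sub>v u) (B *\<^sub>v v)" unfolding P_def by (rule bil_smult_mat[OF CPC Bv[OF u] Bv[OF v]])
    also have "bil (C * P0 * C) (B *\<^sub>v u) (B *\<^sub>v v) = bil P0 u v"
      unfolding bil_conj[OF Cs P0c Bv[OF u] Bv[OF v]] CBv[OF u] CBv[OF v] ..
    also have "t * bil P0 u v = bil (t \<cdot>\<^sub>m P0) u v" by (rule bil_smult_mat[OF P0c u v, symmetric])
    finally show "bil (B * P * B) u v = bil (t \<cdot>\<^sub>m P0) u v" .
  qed
  let ?M = "1\<^sub>m p - t \<cdot>\<^sub>m P0"
  have tP: "t \<cdot>\<^sub>m P0 \<in> carrier_mat p p" using P0c by simp
  have Mc: "?M \<in> carrier_mat p p" by (rule minus_carrier_mat[OF tP])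
  have Mb: "bil ?M u v = u \<bullet> v - t * bil P0 u v" if "u \<in> carrier_vec p" "v \<in> carrier_vec p" for u v
    unfolding bil_minus_mat[OF one_carrier_mat tP that] bil_smult_mat[OF P0c that] bil_one[OF that] ..
  have "op_norm ?M \<le> k - 1"
  proof (rule op_norm_le)
    show "sym_mat p ?M"
      by (rule sym_mat_entryI[OF Mc]) (use P0c sym_mat_entry[OF pos_def_sym[OF P0p]] in auto)
    show "0 \<le> k - 1" using k by simp
    fix v :: "real vec" assume v: "v \<in> carrier_vec p"
    have ka: "0 < k * \<alpha>" using k \<alpha> by simp
    have up: "bil P0 v v \<le> (v \<bullet> v) / \<alpha>" and dn: "v \<bullet> v \<le> k * \<alpha> * bil P0 v v"
      unfolding P0_def using inverse_bounds[OF T0p \<alpha> ka lo hi v] by auto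
    have P00: "0 \<le> bil P0 v v" by (rule psd_bil_nonneg[OF P0p v])
    have "t * bil P0 v v \<le> k * \<alpha> * ((v \<bullet> v) / \<alpha>)" by (rule mult_mono[OF t(2) up]) (use ka P00 in auto)
    then have 1: "t * bil P0 v v \<le> k * (v \<bullet> v)" using \<alpha> by simp
    have "v \<bullet> v \<le> k * (\<alpha> * bil P0 v v)" using dn by (simp add: mult.assoc)
    also have "\<dots> \<le> k * (t * bil P0 v v)" using k t(1) P00 by (intro mult_left_mono mult_right_mono) auto
    finally have 2: "v \<bullet> v \<le> k * (t * bil P0 v v)" .
    have vv: "0 \<le> v \<bullet> v" by (rule scalar_prod_nonneg)
    \<comment> \<open>The spectrum may drop to \<open>1 / k\<close>, and
      \<open>1 - 1 / k <= k - 1\<close>, so the same error serves both sides.\<close>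
    have 3: "v \<bullet> v - t * bil P0 v v \<le> (k - 1) * (v \<bullet> v)"
    proof (cases "v \<bullet> v \<le> t * bil P0 v v")
      case True
      moreover have "0 \<le> (k - 1) * (v \<bullet> v)" using k vv by simp
      ultimately show ?thesis by linarith
    next
      case False
      then have "(k - 1) * (t * bil P0 v v) \<le> (k - 1) * (v \<bullet> v)" using k by (intro mult_left_mono) auto
      then show ?thesis using 2 by (simp add: left_diff_distrib)
    qed
    show "\<bar>bil ?M v v\<bar> \<le> (k - 1) * (v \<bullet> v)"
      unfolding Mb[OF v v] using 1 3 by (simp add: left_diff_distrib abs_le_iff)
  qed
  then show ?thesis using ex unfolding ty invT B_def[symmetric] BPB by simp
qed

section \<open>Direction and length of a Gaussian vector\<close>

definition sumsq :: "nat \<Rightarrow> (nat \<Rightarrow> real) \<Rightarrow> real" where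
  "sumsq p x = (\<Sum>i<p. (x i)\<^sup>2)"

abbreviation lebP :: "nat \<Rightarrow> (nat \<Rightarrow> real) measure" where
  "lebP p \<equiv> (\<Pi>\<^sub>M i\<in>{..<p}. lborel)"

definition scaleP :: "nat \<Rightarrow> real \<Rightarrow> (nat \<Rightarrow> real) \<Rightarrow> (nat \<Rightarrow> real)" where
  "scaleP p r x = (\<lambda>i\<in>{..<p}. r * x i)"

lemma sumsq_nonneg: "0 \<le> sumsq p x"
  by (simp add: sumsq_def sum_nonneg)

lemma sumsq_scaleP: "sumsq p (scaleP p r x) = r\<^sup>2 * sumsq p x"
  by (simp add: sumsq_def scaleP_def power_mult_distrib sum_distrib_left)

lemma sumsq_measurable [measurable]: "sumsq p \<in> borel_measurable (lebP p)"
  unfolding sumsq_def by measurable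

lemma scaleP_measurable [measurable]: "scaleP p r \<in> lebP p \<rightarrow>\<^sub>M lebP p"
  unfolding scaleP_def by (rule measurable_restrict) measurable

text \<open>The Jacobian \<open>r ^ p\<close> of a dilation, verified on boxes one coordinate at a
  time.\<close>

lemma lebP_scale:
  assumes r: "0 < r"
  shows "lebP p = scale_measure (ennreal (r ^ p)) (distr (lebP p) (lebP p) (scaleP p r))" (is "_ = ?P")
proof -
  interpret product_sigma_finite "\<lambda>_ :: nat. lborel :: real measure" by standard
  have "?P = lebP p"
  proof (rule PiM_eqI)
    fix A :: "nat \<Rightarrow> real set" assume A: "\<And>i. i \<in> {..<p} \<Longrightarrow> A i \<in> sets lborel"
    have PA: "Pi\<^sub>E {..<p} A \<in> sets (lebP p)" using A by (intro sets_PiM_I_finite) auto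
    have mr: "(*) r \<in> borel \<rightarrow>\<^sub>M borel" by measurable
    have vA: "(*) r -` A i \<in> sets lborel" if "i < p" for i
      using measurable_sets[OF mr, of "A i"] A that by simp
    have vim: "scaleP p r -` Pi\<^sub>E {..<p} A \<inter> space (lebP p) = Pi\<^sub>E {..<p} (\<lambda>i. (*) r -` A i)"
      by (auto simp: scaleP_def space_PiM PiE_iff)
    have one: "emeasure lborel ((*) r -` A i) = ennreal (1 / r) * emeasure lborel (A i)" if i: "i < p" for i
    proof -
      have "emeasure lborel ((*) r -` A i) = emeasure (distr lborel borel ((*) r)) (A i)"
        using A i by (subst emeasure_distr) auto
      also have "\<dots> = ennreal (1 / r) * emeasure lborel (A i)"
        using r A i by (subst lborel_distr_mult) (auto simp: emeasure_density_const inverse_eq_divide)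
      finally show ?thesis .
    qed
    have "emeasure ?P (Pi\<^sub>E {..<p} A) = ennreal (r ^ p) * emeasure (lebP p) (Pi\<^sub>E {..<p} (\<lambda>i. (*) r -` A i))"
      using PA by (simp add: emeasure_distr vim)
    also have "\<dots> = ennreal (r ^ p) * (\<Prod>i<p. emeasure lborel ((*) r -` A i))"
      using vA by (subst emeasure_PiM) auto
    also have "(\<Prod>i<p. emeasure lborel ((*) r -` A i)) = (\<Prod>i<p. ennreal (1 / r) * emeasure lborel (A i))"
      by (intro prod.cong refl one) simp
    also have "\<dots> = ennreal (1 / r) ^ p * (\<Prod>i<p. emeasure lborel (A i))" by (simp add: prod.distrib)
    also have "ennreal (r ^ p) * (ennreal (1 / r) ^ p * (\<Prod>i<p. emeasure lborel (A i))) = (\<Prod>i<p. emeasure lborel (A i))"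
    proof -
      have "ennreal (r ^ p) * ennreal (1 / r) ^ p = 1"
        using r by (simp add: ennreal_power ennreal_mult[symmetric] power_mult_distrib[symmetric])
      then show ?thesis by (simp add: mult.assoc[symmetric])
    qed
    finally show "emeasure ?P (Pi\<^sub>E {..<p} A) = (\<Prod>i<p. emeasure lborel (A i))" .
  qed simp_all
  then show ?thesis by simp
qed

lemma nn_integral_lebP_scale:
  assumes r: "0 < r" and f: "f \<in> borel_measurable (lebP p)"
  shows "(\<integral>\<^sup>+x. f x \<partial>lebP p) = ennreal (r ^ p) * (\<integral>\<^sup>+x. f (scaleP p r x) \<partial>lebP p)"
  by (subst lebP_scale[OF r]) (simp add: nn_integral_scale_measure nn_integral_distr f)

lemma lebP_box:
  assumes "0 \<le> t"
  shows "emeasure (lebP p) (Pi\<^sub>E {..<p} (\<lambda>_. {-t..t})) = ennreal ((2 * t) ^ p)"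
proof -
  interpret product_sigma_finite "\<lambda>_ :: nat. lborel :: real measure" by standard
  show ?thesis using assms by (subst emeasure_PiM) (auto simp: ennreal_power)
qed

definition ballP :: "nat \<Rightarrow> (nat \<Rightarrow> real) set" where
  "ballP p = {x \<in> space (lebP p). sumsq p x \<le> 1}"

lemma ballP_sets [measurable]: "ballP p \<in> sets (lebP p)"
  unfolding ballP_def by measurable

lemma ballP_finite: "emeasure (lebP p) (ballP p) < \<infinity>"
proof -
  have "ballP p \<subseteq> Pi\<^sub>E {..<p} (\<lambda>_. {-1..1})"
  proof
    fix x assume x: "x \<in> ballP p"
    have "x i \<in> {-1..1}" if i: "i < p" for i
    proof -
      have "(x i)\<^sup>2 \<le> (\<Sum>i<p. (x i)\<^sup>2)" using i by (intro member_le_sum) auto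
      also have "\<dots> \<le> 1" using x by (simp add: ballP_def sumsq_def)
      finally have "\<bar>x i\<bar> \<le> 1" by (simp add: abs_square_le_1)
      then show ?thesis by auto
    qed
    then show "x \<in> Pi\<^sub>E {..<p} (\<lambda>_. {-1..1})" using x by (auto simp: ballP_def space_PiM PiE_iff)
  qed
  then have "emeasure (lebP p) (ballP p) \<le> emeasure (lebP p) (Pi\<^sub>E {..<p} (\<lambda>_. {-1..1}))"
    by (intro emeasure_mono sets_PiM_I_finite) auto
  also have "\<dots> < \<infinity>" by (simp add: lebP_box)
  finally show ?thesis .
qed

lemma ballP_pos:
  assumes p: "1 \<le> p" shows "0 < emeasure (lebP p) (ballP p)"
proof -
  \<comment> \<open>The cube of half-width \<open>1 / p\<close> fits into the ball because
    \<open>p\<close> squares of \<open>1 / p\<close> sum to \<open>1 / p <= 1\<close>.\<close>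
  have "Pi\<^sub>E {..<p} (\<lambda>_. {-(1/real p)..1/real p}) \<subseteq> ballP p"
  proof
    fix x :: "nat \<Rightarrow> real" assume x: "x \<in> Pi\<^sub>E {..<p} (\<lambda>_. {-(1/real p)..1/real p})"
    have "(\<Sum>i<p. (x i)\<^sup>2) \<le> (\<Sum>i<p. 1 / real p)"
    proof (rule sum_mono)
      fix i assume "i \<in> {..<p}"
      then have "- (1 / real p) \<le> x i" "x i \<le> 1 / real p" using x by (auto simp: PiE_iff)
      then have "\<bar>x i\<bar> \<le> 1 / real p" by linarith
      then have "(x i)\<^sup>2 \<le> (1 / real p)\<^sup>2" by (metis abs_le_square_iff abs_of_nonneg divide_nonneg_nonneg of_nat_0_le_iff zero_le_one)
      also have "\<dots> \<le> 1 / real p" using p by (simp add: power2_eq_square field_simps)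
      finally show "(x i)\<^sup>2 \<le> 1 / real p" .
    qed
    also have "\<dots> = 1" using p by simp
    finally show "x \<in> ballP p" using x by (auto simp: ballP_def sumsq_def space_PiM PiE_iff)
  qed
  then have "emeasure (lebP p) (Pi\<^sub>E {..<p} (\<lambda>_. {-(1/real p)..1/real p})) \<le> emeasure (lebP p) (ballP p)"
    by (intro emeasure_mono) auto
  moreover have "0 < emeasure (lebP p) (Pi\<^sub>E {..<p} (\<lambda>_. {-(1/real p)..1/real p}))"
    using p by (subst lebP_box) auto
  ultimately show ?thesis by (rule less_le_trans[rotated])
qed

lemma AE_sumsq_pos:
  assumes p: "1 \<le> p" shows "AE x in lebP p. 0 < sumsq p x"
proof (rule AE_I)
  show "{x \<in> space (lebP p). \<not> 0 < sumsq p x} \<subseteq> Pi\<^sub>E {..<p} (\<lambda>_. {0})"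
  proof
    fix x assume x: "x \<in> {x \<in> space (lebP p). \<not> 0 < sumsq p x}"
    then have "(\<Sum>i<p. (x i)\<^sup>2) = 0" using sumsq_nonneg[of p x] by (simp add: sumsq_def)
    then have "\<forall>i<p. x i = 0" by (subst (asm) sum_nonneg_eq_0_iff) auto
    moreover have "x \<in> extensional {..<p}" using x by (auto simp: space_PiM PiE_iff)
    ultimately show "x \<in> Pi\<^sub>E {..<p} (\<lambda>_. {0})" unfolding PiE_iff by simp
  qed
  show "emeasure (lebP p) (Pi\<^sub>E {..<p} (\<lambda>_. {0})) = 0"
    using lebP_box[of 0 p] p by (simp add: power_0_left)
  show "Pi\<^sub>E {..<p} (\<lambda>_. {0}) \<in> sets (lebP p)" by (intro sets_PiM_I_finite) auto
qed

text \<open>Both sides are, as functions of \<open>\<phi>\<close>, integrals with respect to Borel measures on the line;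
  by scaling these agree on the half lines \<open>{..s}\<close>.\<close>
lemma radial_factorization:
  assumes p: "1 \<le> p" and f[measurable]: "f \<in> borel_measurable (lebP p)"
    and hom: "\<And>r x. 0 < r \<Longrightarrow> x \<in> space (lebP p) \<Longrightarrow> f (scaleP p r x) = f x"
    and fin: "(\<integral>\<^sup>+x. f x * indicator (ballP p) x \<partial>lebP p) < \<infinity>"
    and phi[measurable]: "\<phi> \<in> borel_measurable borel"
  shows "emeasure (lebP p) (ballP p) * (\<integral>\<^sup>+x. f x * \<phi> (sumsq p x) \<partial>lebP p) =
    (\<integral>\<^sup>+x. f x * indicator (ballP p) x \<partial>lebP p) * (\<integral>\<^sup>+x. \<phi> (sumsq p x) \<partial>lebP p)"
proof -
  define c where "c h = (\<integral>\<^sup>+x. h x * indicator (ballP p) x \<partial>lebP p)" for h :: "(nat \<Rightarrow> real) \<Rightarrow> ennreal"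
  define M where "M h = distr (density (lebP p) h) borel (sumsq p)" for h :: "(nat \<Rightarrow> real) \<Rightarrow> ennreal"
  \<comment> \<open>Dilating by \<open>sqrt s\<close> carries the unit ball onto the set
    \<open>sumsq <= s\<close> and leaves the homogeneous factor unchanged; for \<open>s <= 0\<close>
    that set is null.\<close>
  have half: "emeasure (M h) {..s} = (if 0 < s then ennreal (sqrt s ^ p) else 0) * c h"
    if h[measurable]: "h \<in> borel_measurable (lebP p)"
      and hh: "\<And>r x. 0 < r \<Longrightarrow> x \<in> space (lebP p) \<Longrightarrow> h (scaleP p r x) = h x" for h s
  proof -
    have "emeasure (M h) {..s} = emeasure (density (lebP p) h) (sumsq p -` {..s} \<inter> space (lebP p))"
      unfolding M_def by (subst emeasure_distr) auto
    also have "\<dots> = (\<integral>\<^sup>+x. h x * indicator (sumsq p -` {..s} \<inter> space (lebP p)) x \<partial>lebP p)"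
      by (rule emeasure_density) measurable
    also have "\<dots> = (\<integral>\<^sup>+x. h x * indicator {..s} (sumsq p x) \<partial>lebP p)"
      by (intro nn_integral_cong) (auto split: split_indicator)
    finally have e: "emeasure (M h) {..s} = (\<integral>\<^sup>+x. h x * indicator {..s} (sumsq p x) \<partial>lebP p)" .
    show ?thesis
    proof (cases "0 < s")
      case True
      have "(\<integral>\<^sup>+x. h x * indicator {..s} (sumsq p x) \<partial>lebP p) =
        ennreal (sqrt s ^ p) * (\<integral>\<^sup>+x. h (scaleP p (sqrt s) x) * indicator {..s} (sumsq p (scaleP p (sqrt s) x)) \<partial>lebP p)"
        using True by (intro nn_integral_lebP_scale) auto
      also have "(\<integral>\<^sup>+x. h (scaleP p (sqrt s) x) * indicator {..s} (sumsq p (scaleP p (sqrt s) x)) \<partial>lebP p) = c h"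
        unfolding c_def using True
        by (intro nn_integral_cong) (auto simp: hh sumsq_scaleP ballP_def split: split_indicator)
      finally show ?thesis using e True by simp
    next
      case False
      have "(\<integral>\<^sup>+x. h x * indicator {..s} (sumsq p x) \<partial>lebP p) = (\<integral>\<^sup>+x. 0 \<partial>lebP p)"
        using AE_sumsq_pos[OF p] False by (intro nn_integral_cong_AE) (auto split: split_indicator elim!: eventually_mono)
      then show ?thesis using e False by simp
    qed
  qed
  have one: "c (\<lambda>_. 1) = emeasure (lebP p) (ballP p)" by (simp add: c_def)
  have eq: "scale_measure (c (\<lambda>_. 1)) (M f) = scale_measure (c f) (M (\<lambda>_. 1))"
  proof (rule measure_eqI_generator_eq[where E = "range (\<lambda>s :: real. {..s})" and \<Omega> = UNIV and A = "\<lambda>i. {..real i}"])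
    show "Int_stable (range (\<lambda>s :: real. {..s}))" by (auto simp: Int_stable_def)
    show "sets (scale_measure (c (\<lambda>_. 1)) (M f)) = sigma_sets UNIV (range (\<lambda>s :: real. {..s}))"
      "sets (scale_measure (c f) (M (\<lambda>_. 1))) = sigma_sets UNIV (range (\<lambda>s :: real. {..s}))"
      unfolding M_def by (simp_all add: borel_eq_atMost)
    fix X :: "real set" assume "X \<in> range (\<lambda>s :: real. {..s})"
    then obtain s where X: "X = {..s}" by auto
    show "emeasure (scale_measure (c (\<lambda>_. 1)) (M f)) X = emeasure (scale_measure (c f) (M (\<lambda>_. 1))) X"
      unfolding X by (simp add: half[OF f hom] half[of "\<lambda>_. 1"] mult_ac)
  next
    \<comment> \<open>Uniqueness on a generator needs an exhaustion of finite mass; this is where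
      \<open>fin\<close> enters.\<close>
    show "emeasure (scale_measure (c (\<lambda>_. 1)) (M f)) {..real i} \<noteq> \<infinity>" for i
      using fin ballP_finite[of p]
      by (auto simp: half[OF f hom] one c_def[symmetric] ennreal_mult_eq_top_iff)
    show "(\<Union>i. {..real i}) = UNIV" by (auto simp: real_arch_simple)
  qed auto
  have "(\<integral>\<^sup>+s. \<phi> s \<partial>scale_measure (c (\<lambda>_. 1)) (M f)) = (\<integral>\<^sup>+s. \<phi> s \<partial>scale_measure (c f) (M (\<lambda>_. 1)))"
    by (simp add: eq)
  moreover have "(\<integral>\<^sup>+s. \<phi> s \<partial>M h) = (\<integral>\<^sup>+x. h x * \<phi> (sumsq p x) \<partial>lebP p)" if [measurable]: "h \<in> borel_measurable (lebP p)" for h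
    unfolding M_def by (simp add: nn_integral_distr nn_integral_density)
  moreover have "\<phi> \<in> borel_measurable (M h)" for h unfolding M_def by simp
  ultimately show ?thesis using f by (simp add: nn_integral_scale_measure one c_def[symmetric])
qed

section \<open>The Gaussian measure in terms of direction and length\<close>

definition gaussP :: "nat \<Rightarrow> (nat \<Rightarrow> real) measure" where
  "gaussP p = (\<Pi>\<^sub>M i\<in>{..<p}. density lborel std_normal_density)"

lemma gaussP_sets [measurable_cong]: "sets (gaussP p) = sets (lebP p)"
  unfolding gaussP_def by (intro sets_PiM_cong) auto

lemma prob_space_gaussP: "prob_space (gaussP p)"
  unfolding gaussP_def by (intro prob_space_PiM prob_space_normal_density) simp

definition gauss_radial :: "nat \<Rightarrow> real \<Rightarrow> real" where
  "gauss_radial p s = (1 / sqrt (2 * pi)) ^ p * exp (- s / 2)"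

lemma gauss_radial_measurable [measurable]: "gauss_radial p \<in> borel_measurable borel"
  unfolding gauss_radial_def by measurable

lemma prod_std_normal_density: "(\<Prod>i<p. std_normal_density (x i)) = gauss_radial p (sumsq p x)"
proof -
  have "(\<Prod>i<p. std_normal_density (x i)) = (1 / sqrt (2 * pi)) ^ p * (\<Prod>i<p. exp (- (x i)\<^sup>2 / 2))"
    by (simp add: std_normal_density_def prod_dividef power_divide)
  also have "(\<Prod>i<p. exp (- (x i)\<^sup>2 / 2)) = exp (- sumsq p x / 2)"
    by (simp add: exp_sum[symmetric] sumsq_def sum_negf sum_divide_distrib)
  finally show ?thesis by (simp add: gauss_radial_def)
qed

lemma gaussP_density: "gaussP p = density (lebP p) (\<lambda>x. ennreal (gauss_radial p (sumsq p x)))"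
proof -
  interpret L: product_sigma_finite "\<lambda>_ :: nat. lborel :: real measure" by standard
  interpret N: product_sigma_finite "\<lambda>_ :: nat. density lborel std_normal_density :: real measure"
    by (intro product_sigma_finite.intro prob_space_imp_sigma_finite prob_space_normal_density) simp
  have "density (lebP p) (\<lambda>x. ennreal (gauss_radial p (sumsq p x))) = gaussP p"
    unfolding gaussP_def
  proof (rule N.PiM_eqI)
    show "sets (density (lebP p) (\<lambda>x. ennreal (gauss_radial p (sumsq p x)))) =
      sets (\<Pi>\<^sub>M i\<in>{..<p}. density lborel (\<lambda>x. ennreal (std_normal_density x)))"
      using gaussP_sets[of p] by (simp add: gaussP_def)
    fix A :: "nat \<Rightarrow> real set" assume "\<And>i. i \<in> {..<p} \<Longrightarrow> A i \<in> sets (density lborel (\<lambda>x. ennreal (std_normal_density x)))"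
    then have A: "A i \<in> sets borel" if "i < p" for i using that by simp
    have PA: "Pi\<^sub>E {..<p} A \<in> sets (lebP p)" using A by (intro sets_PiM_I_finite) auto
    have "emeasure (density (lebP p) (\<lambda>x. ennreal (gauss_radial p (sumsq p x)))) (Pi\<^sub>E {..<p} A) =
      (\<integral>\<^sup>+x. ennreal (gauss_radial p (sumsq p x)) * indicator (Pi\<^sub>E {..<p} A) x \<partial>lebP p)"
      using PA by (intro emeasure_density) auto
    also have "\<dots> = (\<integral>\<^sup>+x. (\<Prod>i<p. ennreal (std_normal_density (x i)) * indicator (A i) (x i)) \<partial>lebP p)"
    proof (rule nn_integral_cong)
      fix x assume x: "x \<in> space (lebP p)"
      have "(\<Prod>i<p. ennreal (std_normal_density (x i)) * indicator (A i) (x i))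
        = ennreal (gauss_radial p (sumsq p x)) * (\<Prod>i<p. indicator (A i) (x i))"
        by (simp add: prod.distrib prod_ennreal prod_std_normal_density)
      also have "(\<Prod>i<p. indicator (A i) (x i) :: ennreal) = indicator (Pi\<^sub>E {..<p} A) x"
        using x by (auto simp: space_PiM PiE_iff indicator_def prod_zero_iff split: if_splits)
      finally show "ennreal (gauss_radial p (sumsq p x)) * indicator (Pi\<^sub>E {..<p} A) x =
        (\<Prod>i<p. ennreal (std_normal_density (x i)) * indicator (A i) (x i))" ..
    qed
    also have "\<dots> = (\<Prod>i<p. \<integral>\<^sup>+x. ennreal (std_normal_density x) * indicator (A i) x \<partial>lborel)"
      using A by (intro L.product_nn_integral_prod) auto
    also have "\<dots> = (\<Prod>i<p. emeasure (density lborel (\<lambda>x. ennreal (std_normal_density x))) (A i))"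
      using A by (intro prod.cong refl emeasure_density[symmetric]) auto
    finally show "emeasure (density (lebP p) (\<lambda>x. ennreal (gauss_radial p (sumsq p x)))) (Pi\<^sub>E {..<p} A) =
      (\<Prod>i<p. emeasure (density lborel (\<lambda>x. ennreal (std_normal_density x))) (A i))" .
  qed simp
  then show ?thesis by simp
qed

lemma nn_integral_gaussP:
  assumes [measurable]: "f \<in> borel_measurable (lebP p)"
  shows "(\<integral>\<^sup>+x. f x \<partial>gaussP p) = (\<integral>\<^sup>+x. f x * ennreal (gauss_radial p (sumsq p x)) \<partial>lebP p)"
  unfolding gaussP_density by (subst nn_integral_density) (auto simp: mult.commute)

text \<open>The Gaussian has total mass one, so taking its radial density for \<phi> identifies the
  average over the ball with the Gaussian expectation, for functions of the direction alone.\<close>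

lemma gauss_direction:
  assumes p: "1 \<le> p" and f[measurable]: "f \<in> borel_measurable (lebP p)"
    and hom: "\<And>r x. 0 < r \<Longrightarrow> x \<in> space (lebP p) \<Longrightarrow> f (scaleP p r x) = f x"
    and fin: "(\<integral>\<^sup>+x. f x * indicator (ballP p) x \<partial>lebP p) < \<infinity>"
  shows "emeasure (lebP p) (ballP p) * (\<integral>\<^sup>+x. f x \<partial>gaussP p) = (\<integral>\<^sup>+x. f x * indicator (ballP p) x \<partial>lebP p)"
proof -
  have "(\<integral>\<^sup>+x. 1 \<partial>gaussP p) = 1" using prob_space.emeasure_space_1[OF prob_space_gaussP] by simp
  then have "(\<integral>\<^sup>+x. ennreal (gauss_radial p (sumsq p x)) \<partial>lebP p) = 1"
    by (subst (asm) nn_integral_gaussP) auto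
  then show ?thesis
    using radial_factorization[OF p f hom fin, of "\<lambda>s. ennreal (gauss_radial p s)"] by (simp add: nn_integral_gaussP)
qed

text \<open>Independence of direction and length: the volume of the ball, finite and positive,
  cancels between two instances of the factorisation.\<close>

lemma gauss_direction_radius:
  assumes p: "1 \<le> p" and f[measurable]: "f \<in> borel_measurable (lebP p)"
    and hom: "\<And>r x. 0 < r \<Longrightarrow> x \<in> space (lebP p) \<Longrightarrow> f (scaleP p r x) = f x"
    and fin: "(\<integral>\<^sup>+x. f x * indicator (ballP p) x \<partial>lebP p) < \<infinity>"
    and phi[measurable]: "\<phi> \<in> borel_measurable borel"
  shows "(\<integral>\<^sup>+x. f x * \<phi> (sumsq p x) \<partial>gaussP p) = (\<integral>\<^sup>+x. f x \<partial>gaussP p) * (\<integral>\<^sup>+x. \<phi> (sumsq p x) \<partial>gaussP p)"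
proof -
  let ?v = "emeasure (lebP p) (ballP p)"
  have "?v * (\<integral>\<^sup>+x. f x * \<phi> (sumsq p x) \<partial>gaussP p) = ?v * ((\<integral>\<^sup>+x. f x \<partial>gaussP p) * (\<integral>\<^sup>+x. \<phi> (sumsq p x) \<partial>gaussP p))"
    using radial_factorization[OF p f hom fin, of "\<lambda>s. \<phi> s * ennreal (gauss_radial p s)"]
    by (simp add: nn_integral_gaussP gauss_direction[OF p f hom fin, symmetric] mult.assoc)
  then show ?thesis using ballP_pos[OF p] ballP_finite[of p]
    by (subst (asm) ennreal_mult_cancel_left) auto
qed

section \<open>Moments of a Gaussian direction\<close>

lemma gaussP_linear_normal:
  assumes e: "(\<Sum>i<p. (e i)\<^sup>2) = 1"
  shows "distr (gaussP p) borel (\<lambda>x. \<Sum>i<p. e i * x i) = density lborel std_normal_density"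
proof -
  interpret prob_space "gaussP p" by (rule prob_space_gaussP)
  \<comment> \<open>Coordinates with zero coefficient are dropped first, since a normal summand must
    have positive deviation.\<close>
  define J where "J = {i \<in> {..<p}. e i \<noteq> 0}"
  have J: "finite J" "J \<subseteq> {..<p}" by (auto simp: J_def)
  have Jne: "J \<noteq> {}"
  proof
    assume "J = {}"
    then have "\<forall>i<p. e i = 0" by (auto simp: J_def)
    then have "(\<Sum>i<p. (e i)\<^sup>2) = 0" by simp
    then show False using e by simp
  qed
  let ?N = "density lborel std_normal_density :: real measure"
  have N: "prob_space ?N" by (rule prob_space_normal_density) simp
  have sN: "sets ?N = sets borel" by simp
  have comp: "distr (gaussP p) ?N (\<lambda>x. x i) = ?N" if "i < p" for i
    unfolding gaussP_def by (rule distr_PiM_component) (use N that in auto)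
  have comp': "distr (gaussP p) borel (\<lambda>x. x i) = ?N" if "i < p" for i
    using comp[OF that] by (subst distr_cong[of _ "gaussP p" _ ?N]) auto
  have m[measurable]: "(\<lambda>x. x i) \<in> borel_measurable (gaussP p)" if "i < p" for i
    using that by (subst measurable_cong_sets[OF gaussP_sets refl]) measurable
  have ind: "indep_vars (\<lambda>_. borel) (\<lambda>i x. x i) J"
  proof (subst indep_vars_iff_distr_eq_PiM'[OF Jne])
    show "random_variable borel (\<lambda>x. x i)" if "i \<in> J" for i using that J m by auto
    interpret P: product_prob_space "\<lambda>_ :: nat. ?N" "{..<p}"
      by (intro product_prob_space.intro product_prob_space_axioms.intro product_sigma_finite.intro
          prob_space_imp_sigma_finite N)
    have "distr (gaussP p) (Pi\<^sub>M J (\<lambda>_. borel)) (\<lambda>x. \<lambda>i\<in>J. x i) = distr (gaussP p) (Pi\<^sub>M J (\<lambda>_. ?N)) (\<lambda>x. restrict x J)"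
      by (intro distr_cong refl sets_PiM_cong) auto
    also have "\<dots> = Pi\<^sub>M J (\<lambda>_. ?N)" unfolding gaussP_def by (rule P.distr_PiM_restrict_finite[OF J])
    also have "\<dots> = Pi\<^sub>M J (\<lambda>i. distr (gaussP p) borel (\<lambda>x. x i))"
      using J by (intro PiM_cong refl comp'[symmetric]) auto
    finally show "distr (gaussP p) (Pi\<^sub>M J (\<lambda>_. borel)) (\<lambda>x. \<lambda>i\<in>J. x i) = Pi\<^sub>M J (\<lambda>i. distr (gaussP p) borel (\<lambda>x. x i))" .
  qed
  have ind': "indep_vars (\<lambda>_. borel) (\<lambda>i x. e i * x i) J"
    using indep_vars_compose2[OF ind, of "\<lambda>i t. e i * t" "\<lambda>_. borel"] by simp
  have nd: "distributed (gaussP p) lborel (\<lambda>x. x i) (normal_density 0 1)" if "i < p" for i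
    unfolding distributed_def using comp'[OF that] m[OF that]
    by (simp add: distr_cong[of _ _ lborel borel])
  have "distributed (gaussP p) lborel (\<lambda>x. \<Sum>i\<in>J. e i * x i) (normal_density (\<Sum>i\<in>J. 0) (sqrt (\<Sum>i\<in>J. \<bar>e i\<bar>\<^sup>2)))"
  proof (rule sum_indep_normal[OF J(1) Jne ind'])
    fix i assume i: "i \<in> J"
    then show "0 < \<bar>e i\<bar>" by (simp add: J_def)
    have "distributed (gaussP p) lborel (\<lambda>x. 0 + e i * x i) (normal_density (0 + e i * 0) (\<bar>e i\<bar> * 1))"
      by (rule normal_density_affine[OF nd]) (use i in \<open>auto simp: J_def\<close>)
    then show "distributed (gaussP p) lborel (\<lambda>x. e i * x i) (normal_density 0 \<bar>e i\<bar>)" by simp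
  qed
  moreover have "(\<Sum>i\<in>J. \<bar>e i\<bar>\<^sup>2) = 1"
    unfolding e[symmetric] J_def by (intro sum.mono_neutral_cong_left) auto
  moreover have "(\<Sum>i\<in>J. e i * x i) = (\<Sum>i<p. e i * x i)" for x :: "nat \<Rightarrow> real"
    unfolding J_def by (intro sum.mono_neutral_cong_left) auto
  ultimately have "distributed (gaussP p) lborel (\<lambda>x. \<Sum>i<p. e i * x i) std_normal_density" by simp
  then have "distr (gaussP p) lborel (\<lambda>x. \<Sum>i<p. e i * x i) = density lborel std_normal_density"
    by (simp add: distributed_def)
  then show ?thesis by (subst distr_cong[of _ "gaussP p" _ lborel]) auto
qed

lemma lin_measurable_gauss [measurable]: "(\<lambda>x. \<Sum>i<p. e i * x i) \<in> borel_measurable (gaussP p)"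
  by (subst measurable_cong_sets[OF gaussP_sets refl]) measurable

text \<open>The value is the double factorial of \<open>2 k - 1\<close>, the even moment of a
  standard normal variable.\<close>

lemma gaussP_linear_moment:
  assumes e: "(\<Sum>i<p. (e i)\<^sup>2) = 1"
  shows "(\<integral>\<^sup>+x. ennreal ((\<Sum>i<p. e i * x i) ^ (2 * k)) \<partial>gaussP p) = ennreal (fact (2 * k) / (2 ^ k * fact k))"
proof -
  have "(\<integral>\<^sup>+x. ennreal ((\<Sum>i<p. e i * x i) ^ (2 * k)) \<partial>gaussP p) =
    (\<integral>\<^sup>+t. ennreal (t ^ (2 * k)) \<partial>distr (gaussP p) borel (\<lambda>x. \<Sum>i<p. e i * x i))"
    by (subst nn_integral_distr) auto
  also have "\<dots> = (\<integral>\<^sup>+t. ennreal (std_normal_density t * t ^ (2 * k)) \<partial>lborel)"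
    unfolding gaussP_linear_normal[OF e]
    by (subst nn_integral_density) (auto simp: ennreal_mult' normal_density_nonneg)
  also have "\<dots> = ennreal (fact (2 * k) / (2 ^ k * fact k))"
    using std_normal_moment_even[of k]
    by (subst nn_integral_eq_integral) (auto simp: has_bochner_integral_iff)
  finally show ?thesis .
qed

lemma gaussP_small_ball:
  assumes e: "(\<Sum>i<p. (e i)\<^sup>2) = 1" and s: "0 \<le> s"
  shows "emeasure (gaussP p) {x \<in> space (gaussP p). \<bar>\<Sum>i<p. e i * x i\<bar> \<le> s} \<le> ennreal (2 * s)"
proof -
  have "emeasure (gaussP p) {x \<in> space (gaussP p). \<bar>\<Sum>i<p. e i * x i\<bar> \<le> s} =
    emeasure (distr (gaussP p) borel (\<lambda>x. \<Sum>i<p. e i * x i)) {-s..s}"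
    by (subst emeasure_distr) (auto intro!: arg_cong2[where f = emeasure])
  also have "\<dots> = (\<integral>\<^sup>+t. ennreal (std_normal_density t) * indicator {-s..s} t \<partial>lborel)"
    unfolding gaussP_linear_normal[OF e] by (rule emeasure_density) auto
  also have "\<dots> \<le> (\<integral>\<^sup>+t. 1 * indicator {-s..s} t \<partial>lborel)"
  proof (intro nn_integral_mono mult_right_mono)
    fix t :: real
    have "1 \<le> sqrt (2 * pi)" using pi_gt3 by simp
    moreover have "exp (- t\<^sup>2 / 2) \<le> 1" by simp
    ultimately have "1 / sqrt (2 * pi) * exp (- t\<^sup>2 / 2) \<le> 1 * 1" by (intro mult_mono) auto
    then show "ennreal (std_normal_density t) \<le> 1" by (simp add: std_normal_density_def)
  qed simp
  also have "\<dots> = ennreal (2 * s)" using s by simp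
  finally show ?thesis .
qed

lemma gaussP_sumsq_mean: "(\<integral>\<^sup>+x. ennreal (sumsq p x) \<partial>gaussP p) = ennreal (real p)"
proof -
  have 1: "(\<integral>\<^sup>+x. ennreal ((x i)\<^sup>2) \<partial>gaussP p) = 1" if i: "i < p" for i
  proof -
    have "(\<Sum>j<p. ((if j = i then 1 else 0) :: real)\<^sup>2) = (\<Sum>j<p. if j = i then 1 else 0)" by (intro sum.cong) auto
    also have "\<dots> = 1" using i by simp
    finally have *: "(\<Sum>j<p. ((if j = i then 1 else 0) :: real)\<^sup>2) = 1" .
    from gaussP_linear_moment[OF *, of 1] have
      "(\<integral>\<^sup>+x. ennreal ((\<Sum>j<p. (if j = i then 1 else 0) * x j)\<^sup>2) \<partial>gaussP p) = 1" by (simp add: fact_numeral)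
    moreover have "(\<Sum>j<p. (if j = i then 1 else 0) * x j) = x i" for x :: "nat \<Rightarrow> real"
    proof -
      have "(\<Sum>j<p. (if j = i then 1 else 0) * x j) = (\<Sum>j<p. if j = i then x j else 0)" by (intro sum.cong) auto
      then show ?thesis using i by simp
    qed
    ultimately show ?thesis by simp
  qed
  have "(\<integral>\<^sup>+x. ennreal (sumsq p x) \<partial>gaussP p) = (\<integral>\<^sup>+x. (\<Sum>i<p. ennreal ((x i)\<^sup>2)) \<partial>gaussP p)"
    by (simp add: sumsq_def)
  also have "\<dots> = (\<Sum>i<p. \<integral>\<^sup>+x. ennreal ((x i)\<^sup>2) \<partial>gaussP p)"
    by (intro nn_integral_sum) (subst measurable_cong_sets[OF gaussP_sets refl], measurable)
  also have "\<dots> = ennreal (real p)" using 1 by (simp add: ennreal_of_nat_eq_real_of_nat)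
  finally show ?thesis .
qed

lemma sumsq_measurable_gauss [measurable]: "sumsq p \<in> borel_measurable (gaussP p)"
  by (subst measurable_cong_sets[OF gaussP_sets refl]) measurable

text \<open>Convexity: the power lies above its tangent at \<open>c\<close>. The terms are arranged
  without subtraction, as integrals in the nonnegative extended reals require.\<close>

lemma bernoulli_tangent:
  fixes s c :: real
  assumes "0 \<le> s" "0 \<le> c"
  shows "real (Suc k) * c ^ k * s \<le> s ^ Suc k + real k * c ^ Suc k"
proof (induction k)
  case (Suc k)
  have "c * (real (Suc k) * c ^ k * s) \<le> c * (s ^ Suc k + real k * c ^ Suc k)"
    by (rule mult_left_mono[OF Suc assms(2)])
  moreover have "0 \<le> (s ^ Suc k - c ^ Suc k) * (s - c)"
  proof (cases "s \<le> c")
    case True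
    then show ?thesis using power_mono[OF True assms(1), of "Suc k"] by (intro mult_nonpos_nonpos) auto
  next
    case False
    then show ?thesis using power_mono[of c s "Suc k"] assms by (intro mult_nonneg_nonneg) auto
  qed
  ultimately show ?case by (simp add: algebra_simps)
qed (use assms in simp)

text \<open>Jensen's inequality for the \<open>k\<close>-th power, obtained by integrating the
  tangent at the mean \<open>p\<close>.\<close>

lemma gaussP_sumsq_moment_ge: "ennreal (real p ^ k) \<le> (\<integral>\<^sup>+x. ennreal (sumsq p x ^ k) \<partial>gaussP p)"
proof (cases k)
  case 0
  then show ?thesis using prob_space.emeasure_space_1[OF prob_space_gaussP] by simp
next
  case (Suc k')
  let ?c = "real p"
  have "ennreal (real (Suc k') * ?c ^ k') * ennreal ?c = (\<integral>\<^sup>+x. ennreal (real (Suc k') * ?c ^ k') * ennreal (sumsq p x) \<partial>gaussP p)"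
    by (subst nn_integral_cmult) (auto simp: gaussP_sumsq_mean)
  also have "\<dots> \<le> (\<integral>\<^sup>+x. ennreal (sumsq p x ^ k) + ennreal (real k' * ?c ^ k) \<partial>gaussP p)"
  proof (rule nn_integral_mono)
    fix x
    have "real (Suc k') * ?c ^ k' * sumsq p x \<le> sumsq p x ^ k + real k' * ?c ^ k"
      unfolding Suc by (rule bernoulli_tangent) (auto simp: sumsq_nonneg)
    then have "ennreal (real (Suc k') * ?c ^ k' * sumsq p x) \<le> ennreal (sumsq p x ^ k + real k' * ?c ^ k)"
      by (rule ennreal_leI)
    then show "ennreal (real (Suc k') * ?c ^ k') * ennreal (sumsq p x) \<le> ennreal (sumsq p x ^ k) + ennreal (real k' * ?c ^ k)"
      by (simp add: ennreal_mult'[symmetric] ennreal_plus[symmetric] sumsq_nonneg del: ennreal_plus of_nat_Suc)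
  qed
  also have "\<dots> = (\<integral>\<^sup>+x. ennreal (sumsq p x ^ k) \<partial>gaussP p) + ennreal (real k' * ?c ^ k)"
    using prob_space.emeasure_space_1[OF prob_space_gaussP] by (subst nn_integral_add) auto
  finally have "ennreal (real (Suc k') * ?c ^ k' * ?c) \<le> (\<integral>\<^sup>+x. ennreal (sumsq p x ^ k) \<partial>gaussP p) + ennreal (real k' * ?c ^ k)"
    by (simp add: ennreal_mult' del: of_nat_Suc)
  moreover have "real (Suc k') * ?c ^ k' * ?c = ?c ^ k + real k' * ?c ^ k" by (simp add: Suc algebra_simps)
  ultimately have "ennreal (?c ^ k) + ennreal (real k' * ?c ^ k) \<le> (\<integral>\<^sup>+x. ennreal (sumsq p x ^ k) \<partial>gaussP p) + ennreal (real k' * ?c ^ k)"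
    by simp
  then show ?thesis by (simp add: ennreal_add_left_cancel_le[of "ennreal (real k' * ?c ^ k)"] add.commute)
qed

text \<open>For a unit \<open>e\<close>, this is \<open>p\<close> times the squared cosine of the
  angle between \<open>e\<close> and \<open>x\<close>; the factor \<open>p\<close> makes its
  Gaussian mean one. Division by zero sets it to \<open>0\<close> at the origin, so the bound by
  \<open>p\<close> holds everywhere.\<close>

definition dirsq :: "nat \<Rightarrow> (nat \<Rightarrow> real) \<Rightarrow> (nat \<Rightarrow> real) \<Rightarrow> real" where
  "dirsq p e x = real p * (\<Sum>i<p. e i * x i)\<^sup>2 / sumsq p x"

lemma dirsq_nonneg: "0 \<le> dirsq p e x"
  by (simp add: dirsq_def sumsq_nonneg)

lemma dirsq_measurable [measurable]: "dirsq p e \<in> borel_measurable (lebP p)"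
  unfolding dirsq_def by measurable

lemma dirsq_scaleP: "0 < r \<Longrightarrow> dirsq p e (scaleP p r x) = dirsq p e x"
proof -
  assume r: "0 < r"
  have "(\<Sum>i<p. e i * scaleP p r x i) = r * (\<Sum>i<p. e i * x i)"
    by (simp add: scaleP_def sum_distrib_left algebra_simps)
  then show ?thesis using r by (simp add: dirsq_def sumsq_scaleP power_mult_distrib)
qed

lemma lin_sq_le_sumsq:
  assumes e: "(\<Sum>i<p. (e i)\<^sup>2) = (1 :: real)"
  shows "(\<Sum>i<p. e i * x i)\<^sup>2 \<le> sumsq p x"
  using Cauchy_Schwarz_ineq_sum[of e x "{..<p}"] e by (simp add: sumsq_def)

lemma dirsq_le:
  assumes e: "(\<Sum>i<p. (e i)\<^sup>2) = 1" shows "dirsq p e x \<le> real p"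
proof (cases "sumsq p x = 0")
  case False
  then have "0 < sumsq p x" using sumsq_nonneg[of p x] by simp
  then show ?thesis using lin_sq_le_sumsq[OF e, of x] by (simp add: dirsq_def divide_le_eq mult_left_mono)
qed (simp add: dirsq_def)

lemma bounded_ball_integral:
  assumes "\<And>x. f x \<le> ennreal K"
  shows "(\<integral>\<^sup>+x. f x * indicator (ballP p) x \<partial>lebP p) < \<infinity>"
proof -
  have "(\<integral>\<^sup>+x. f x * indicator (ballP p) x \<partial>lebP p) \<le> (\<integral>\<^sup>+x. ennreal K * indicator (ballP p) x \<partial>lebP p)"
    by (intro nn_integral_mono mult_right_mono assms) auto
  also have "\<dots> = ennreal K * emeasure (lebP p) (ballP p)" by (simp add: nn_integral_cmult)
  also have "\<dots> < \<infinity>" using ballP_finite[of p] by (simp add: ennreal_mult_less_top)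
  finally show ?thesis .
qed

text \<open>\<open>dirsq * sumsq\<close> is \<open>p\<close> times the square of a standard normal
  variable, and the two factors are independent, so the known normal moment splits into a
  product.\<close>

lemma dirsq_moment_identity:
  assumes p: "1 \<le> p" and e: "(\<Sum>i<p. (e i)\<^sup>2) = 1"
  shows "(\<integral>\<^sup>+x. ennreal (dirsq p e x ^ k) \<partial>gaussP p) * (\<integral>\<^sup>+x. ennreal (sumsq p x ^ k) \<partial>gaussP p) =
    ennreal (real p ^ k * (fact (2 * k) / (2 ^ k * fact k)))"
proof -
  have "(\<integral>\<^sup>+x. ennreal (dirsq p e x ^ k) \<partial>gaussP p) * (\<integral>\<^sup>+x. ennreal (sumsq p x ^ k) \<partial>gaussP p) =
    (\<integral>\<^sup>+x. ennreal (dirsq p e x ^ k) * ennreal (sumsq p x ^ k) \<partial>gaussP p)"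
  proof (rule gauss_direction_radius[OF p, symmetric])
    show "(\<integral>\<^sup>+x. ennreal (dirsq p e x ^ k) * indicator (ballP p) x \<partial>lebP p) < \<infinity>"
      by (rule bounded_ball_integral[where K = "real p ^ k"]) (intro ennreal_leI power_mono dirsq_le[OF e] dirsq_nonneg)
  qed (auto simp: dirsq_scaleP)
  also have "\<dots> = (\<integral>\<^sup>+x. ennreal (real p ^ k) * ennreal ((\<Sum>i<p. e i * x i) ^ (2 * k)) \<partial>gaussP p)"
  proof (rule nn_integral_cong)
    fix x
    have "dirsq p e x * sumsq p x = real p * (\<Sum>i<p. e i * x i)\<^sup>2"
      using lin_sq_le_sumsq[OF e, of x] by (cases "sumsq p x = 0") (auto simp: dirsq_def)
    then have "dirsq p e x ^ k * sumsq p x ^ k = real p ^ k * (\<Sum>i<p. e i * x i) ^ (2 * k)"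
      by (simp add: power_mult power_mult_distrib[symmetric])
    then show "ennreal (dirsq p e x ^ k) * ennreal (sumsq p x ^ k) = ennreal (real p ^ k) * ennreal ((\<Sum>i<p. e i * x i) ^ (2 * k))"
      by (simp add: ennreal_mult'[symmetric] sumsq_nonneg dirsq_nonneg)
  qed
  also have "\<dots> = ennreal (real p ^ k) * ennreal (fact (2 * k) / (2 ^ k * fact k))"
    by (subst nn_integral_cmult) (auto simp: gaussP_linear_moment[OF e])
  also have "\<dots> = ennreal (real p ^ k * (fact (2 * k) / (2 ^ k * fact k)))"
    by (rule ennreal_mult'[symmetric]) simp
  finally show ?thesis .
qed

lemma dirsq_moment_le:
  assumes p: "1 \<le> p" and e: "(\<Sum>i<p. (e i)\<^sup>2) = 1"
  shows "(\<integral>\<^sup>+x. ennreal (dirsq p e x ^ k) \<partial>gaussP p) \<le> ennreal (fact (2 * k) / (2 ^ k * fact k))"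
proof -
  let ?m = "\<integral>\<^sup>+x. ennreal (dirsq p e x ^ k) \<partial>gaussP p"
  have "ennreal (real p ^ k) * ?m \<le> ?m * (\<integral>\<^sup>+x. ennreal (sumsq p x ^ k) \<partial>gaussP p)"
    unfolding mult.commute[of _ ?m] by (intro mult_left_mono gaussP_sumsq_moment_ge) simp
  also have "\<dots> = ennreal (real p ^ k) * ennreal (fact (2 * k) / (2 ^ k * fact k))"
    unfolding dirsq_moment_identity[OF p e] by (rule ennreal_mult') simp
  finally show ?thesis using p by (simp add: ennreal_mult_le_mult_iff)
qed

text \<open>Exact, because the mean of \<open>sumsq\<close> is exactly \<open>p\<close>. The lower
  tail rests on this equality, where the moment bound gives only \<open><= 1\<close>.\<close>

lemma dirsq_mean:
  assumes p: "1 \<le> p" and e: "(\<Sum>i<p. (e i)\<^sup>2) = 1"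
  shows "(\<integral>\<^sup>+x. ennreal (dirsq p e x) \<partial>gaussP p) = 1"
proof -
  have "ennreal (real p) * (\<integral>\<^sup>+x. ennreal (dirsq p e x) \<partial>gaussP p) = ennreal (real p) * 1"
    using dirsq_moment_identity[OF p e, of 1] by (simp add: gaussP_sumsq_mean mult.commute fact_numeral)
  then show ?thesis using p by (subst (asm) ennreal_mult_cancel_left) auto
qed

section \<open>Exponential moments and small balls\<close>

lemma dirsq_measurable_gauss [measurable]: "dirsq p e \<in> borel_measurable (gaussP p)"
  by (subst measurable_cong_sets[OF gaussP_sets refl]) measurable

text \<open>The left side is the central binomial coefficient divided by \<open>2 ^ k\<close>, and
  that coefficient is at most \<open>4 ^ k\<close>.\<close>

lemma central_binomial_moment: "fact (2 * k) / (2 ^ k * fact k) / fact k \<le> (2 :: real) ^ k"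
proof -
  have "real ((2 * k) choose k) \<le> real (2 ^ (2 * k))" by (intro of_nat_mono binomial_le_pow2)
  then have "fact (2 * k) / (fact k * fact k) \<le> (2 :: real) ^ k * 2 ^ k"
    by (subst (asm) binomial_fact) (auto simp: power_mult power2_eq_square power_mult_distrib[symmetric])
  then show ?thesis by (simp add: field_simps)
qed

lemma dirsq_mgf:
  assumes p: "1 \<le> p" and e: "(\<Sum>i<p. (e i)\<^sup>2) = 1" and l: "0 \<le> l" "l \<le> 1 / 4"
  shows "(\<integral>\<^sup>+x. ennreal (exp (l * dirsq p e x)) \<partial>gaussP p) \<le> ennreal (exp (l + 8 * l\<^sup>2))"
proof -
  let ?Y = "dirsq p e"
  \<comment> \<open>The moment bounds give \<open>(2 l) ^ k\<close> for each term; keeping the exact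
    mean \<open>l\<close> at \<open>k = 1\<close> makes the sum \<open>1 / (1 - 2 l) - l\<close>,
    which is \<open>1 + l\<close> up to order \<open>l^2\<close>.\<close>
  define c where "c k = (if k = 1 then l else (2 * l) ^ k)" for k :: nat
  have c0: "0 \<le> c k" for k using l by (simp add: c_def)
  have ex: "ennreal (exp (l * y)) = (\<Sum>k. ennreal ((l * y) ^ k / fact k))" if "0 \<le> y" for y
  proof (rule suminf_ennreal_eq[symmetric])
    show "0 \<le> (l * y) ^ k / fact k" for k using that l by simp
    have "(l * y) ^ k /\<^sub>R fact k = (l * y) ^ k / fact k" for k by (simp only: real_scaleR_def divide_inverse mult.commute)
    then show "(\<lambda>k. (l * y) ^ k / fact k) sums exp (l * y)" using exp_converges[of "l * y"] by simp
  qed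
  have "(\<integral>\<^sup>+x. ennreal (exp (l * ?Y x)) \<partial>gaussP p) = (\<integral>\<^sup>+x. (\<Sum>k. ennreal ((l * ?Y x) ^ k / fact k)) \<partial>gaussP p)"
    by (simp add: ex dirsq_nonneg)
  also have "\<dots> = (\<Sum>k. \<integral>\<^sup>+x. ennreal ((l * ?Y x) ^ k / fact k) \<partial>gaussP p)"
    by (rule nn_integral_suminf) measurable
  also have "\<dots> \<le> (\<Sum>k. ennreal (c k))"
  proof (rule suminf_le)
    fix k :: nat
    have "(\<integral>\<^sup>+x. ennreal ((l * ?Y x) ^ k / fact k) \<partial>gaussP p) = (\<integral>\<^sup>+x. ennreal (l ^ k / fact k) * ennreal (?Y x ^ k) \<partial>gaussP p)"
      using l by (intro nn_integral_cong) (simp add: ennreal_mult'[symmetric] power_mult_distrib)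
    also have "\<dots> = ennreal (l ^ k / fact k) * (\<integral>\<^sup>+x. ennreal (?Y x ^ k) \<partial>gaussP p)"
      by (rule nn_integral_cmult) measurable
    also have "\<dots> \<le> ennreal (c k)"
    proof (cases "k = 1")
      case True
      then show ?thesis by (simp add: dirsq_mean[OF p e] c_def)
    next
      case False
      have "ennreal (l ^ k / fact k) * (\<integral>\<^sup>+x. ennreal (?Y x ^ k) \<partial>gaussP p)
        \<le> ennreal (l ^ k / fact k) * ennreal (fact (2 * k) / (2 ^ k * fact k))"
        by (intro mult_left_mono dirsq_moment_le[OF p e]) simp
      also have "\<dots> = ennreal (l ^ k * (fact (2 * k) / (2 ^ k * fact k) / fact k))"
        using l by (simp add: ennreal_mult'[symmetric])
      also have "\<dots> \<le> ennreal (l ^ k * 2 ^ k)"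
        using l by (intro ennreal_leI mult_left_mono central_binomial_moment) auto
      also have "\<dots> = ennreal (c k)" using False by (simp add: c_def power_mult_distrib mult.commute)
      finally show ?thesis .
    qed
    finally show "(\<integral>\<^sup>+x. ennreal ((l * ?Y x) ^ k / fact k) \<partial>gaussP p) \<le> ennreal (c k)" .
  qed auto
  also have "(\<Sum>k. ennreal (c k)) = ennreal (1 / (1 - 2 * l) - l)"
  proof (rule suminf_ennreal_eq[OF c0])
    have "(\<lambda>k. (2 * l) ^ k) sums (1 / (1 - 2 * l))" using l by (intro geometric_sums) auto
    moreover have "(\<lambda>k. if k = 1 then l else 0) sums l" by (rule sums_single)
    ultimately have "(\<lambda>k. (2 * l) ^ k - (if k = 1 then l else 0)) sums (1 / (1 - 2 * l) - l)" by (rule sums_diff)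
    moreover have "(2 * l) ^ k - (if k = 1 then l else 0) = c k" for k by (simp add: c_def)
    ultimately show "c sums (1 / (1 - 2 * l) - l)" by simp
  qed
  also have "\<dots> \<le> ennreal (exp (l + 8 * l\<^sup>2))"
  proof (rule ennreal_leI)
    have "1 \<le> (1 + 2 * l + 8 * l\<^sup>2) * (1 - 2 * l)"
    proof -
      have "(1 + 2 * l + 8 * l\<^sup>2) * (1 - 2 * l) = 1 + 4 * l\<^sup>2 * (1 - 4 * l)"
        by (simp add: power2_eq_square algebra_simps)
      moreover have "0 \<le> 4 * l\<^sup>2 * (1 - 4 * l)" using l by (intro mult_nonneg_nonneg) auto
      ultimately show ?thesis by linarith
    qed
    then have "1 / (1 - 2 * l) \<le> 1 + 2 * l + 8 * l\<^sup>2" using l by (simp add: divide_le_eq)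
    then have "1 / (1 - 2 * l) - l \<le> 1 + (l + 8 * l\<^sup>2)" by simp
    also have "\<dots> \<le> exp (l + 8 * l\<^sup>2)" by (rule exp_ge_add_one_self)
    finally show "1 / (1 - 2 * l) - l \<le> exp (l + 8 * l\<^sup>2)" .
  qed
  finally show ?thesis .
qed

text \<open>The product of \<open>1 + z + z^2/2\<close> and \<open>1 - z + z^2/2\<close> equals
  \<open>1 + z^4/4\<close>, and its first factor is below \<open>exp z\<close>.\<close>

lemma exp_minus_le_quadratic:
  assumes "0 \<le> (z :: real)" shows "exp (- z) \<le> 1 - z + z\<^sup>2 / 2"
proof -
  have "1 \<le> (1 + z + z\<^sup>2 / 2) * (1 - z + z\<^sup>2 / 2)"
  proof -
    have "(1 + z + z\<^sup>2 / 2) * (1 - z + z\<^sup>2 / 2) = 1 + (z\<^sup>2)\<^sup>2 / 4" by (simp add: power2_eq_square algebra_simps)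
    then show ?thesis by simp
  qed
  also have "\<dots> \<le> exp z * (1 - z + z\<^sup>2 / 2)"
  proof (rule mult_right_mono[OF exp_lower_Taylor_quadratic[OF assms]])
    have "0 \<le> 1 + z\<^sup>2 - 2 * z" using zero_le_power2[of "1 - z"] by (simp add: power2_diff)
    then show "0 \<le> 1 - z + z\<^sup>2 / 2" by linarith
  qed
  finally show ?thesis by (simp add: exp_minus field_simps)
qed

text \<open>Nonnegativity of \<open>dirsq\<close> makes the quadratic bound on
  \<open>exp (- z)\<close> available for every \<open>l >= 0\<close>, so a second moment of at most
  \<open>3\<close> suffices. The term \<open>l\<close> is added to both sides because the integrals
  are nonnegative extended reals; \<open>8 l^2\<close> matches the exponent of the positive
  side.\<close>

lemma dirsq_mgf_neg:
  assumes p: "1 \<le> p" and e: "(\<Sum>i<p. (e i)\<^sup>2) = 1" and l: "0 \<le> l"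
  shows "(\<integral>\<^sup>+x. ennreal (exp (- (l * dirsq p e x))) \<partial>gaussP p) \<le> ennreal (exp (- l + 8 * l\<^sup>2))"
proof -
  let ?Y = "dirsq p e"
  have sp: "emeasure (gaussP p) (space (gaussP p)) = 1" by (rule prob_space.emeasure_space_1[OF prob_space_gaussP])
  have "(\<integral>\<^sup>+x. ennreal (exp (- (l * ?Y x))) \<partial>gaussP p) + ennreal l
    = (\<integral>\<^sup>+x. ennreal (exp (- (l * ?Y x))) + ennreal l * ennreal (?Y x) \<partial>gaussP p)"
    by (subst nn_integral_add) (auto simp: nn_integral_cmult dirsq_mean[OF p e])
  also have "\<dots> \<le> (\<integral>\<^sup>+x. 1 + ennreal (l\<^sup>2 / 2) * ennreal (?Y x ^ 2) \<partial>gaussP p)"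
  proof (rule nn_integral_mono)
    fix x
    have "exp (- (l * ?Y x)) + l * ?Y x \<le> 1 + l\<^sup>2 / 2 * ?Y x ^ 2"
      using exp_minus_le_quadratic[of "l * ?Y x"] l dirsq_nonneg[of p e x] by (simp add: power_mult_distrib)
    then have "ennreal (exp (- (l * ?Y x)) + l * ?Y x) \<le> ennreal (1 + l\<^sup>2 / 2 * ?Y x ^ 2)" by (rule ennreal_leI)
    then show "ennreal (exp (- (l * ?Y x))) + ennreal l * ennreal (?Y x) \<le> 1 + ennreal (l\<^sup>2 / 2) * ennreal (?Y x ^ 2)"
      using l dirsq_nonneg[of p e x] by (simp add: ennreal_mult'[symmetric] ennreal_plus[symmetric] ennreal_1[symmetric] del: ennreal_plus ennreal_1)
  qed
  also have "\<dots> = 1 + ennreal (l\<^sup>2 / 2) * (\<integral>\<^sup>+x. ennreal (?Y x ^ 2) \<partial>gaussP p)"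
    by (subst nn_integral_add) (auto simp: nn_integral_cmult sp)
  also have "\<dots> \<le> 1 + ennreal (l\<^sup>2 / 2) * ennreal 3"
    using dirsq_moment_le[OF p e, of 2] by (intro add_left_mono mult_left_mono) (auto simp: fact_numeral)
  also have "\<dots> = ennreal (1 - l + 3 * l\<^sup>2 / 2) + ennreal l"
  proof -
    have "0 \<le> 1 + l\<^sup>2 - 2 * l" using zero_le_power2[of "1 - l"] by (simp add: power2_diff)
    then have "0 \<le> 1 - l + 3 * l\<^sup>2 / 2" using zero_le_power2[of l] by linarith
    moreover have "ennreal (l\<^sup>2 / 2) * ennreal 3 = ennreal (3 * l\<^sup>2 / 2)"
      by (subst ennreal_mult'[symmetric]) auto
    ultimately show ?thesis using l
      by (simp only: ennreal_plus[symmetric] ennreal_1[symmetric] zero_le_one zero_le_power2) (simp add: ennreal_plus[symmetric] ennreal_1[symmetric] del: ennreal_plus ennreal_1)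
  qed
  finally have "(\<integral>\<^sup>+x. ennreal (exp (- (l * ?Y x))) \<partial>gaussP p) \<le> ennreal (1 - l + 3 * l\<^sup>2 / 2)"
    by (simp add: ennreal_add_left_cancel_le[of "ennreal l"] add.commute[of _ "ennreal l"])
  also have "\<dots> \<le> ennreal (exp (- l + 8 * l\<^sup>2))"
  proof (rule ennreal_leI)
    have "1 - l + 3 * l\<^sup>2 / 2 \<le> 1 + (- l + 8 * l\<^sup>2)" by simp
    also have "\<dots> \<le> exp (- l + 8 * l\<^sup>2)" by (rule exp_ge_add_one_self)
    finally show "1 - l + 3 * l\<^sup>2 / 2 \<le> exp (- l + 8 * l\<^sup>2)" .
  qed
  finally show ?thesis .
qed

text \<open>A small cosine needs a long Gaussian vector or a small linear form. With
  \<open>K = 2 / q\<close>, Markov's inequality bounds the probability of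
  \<open>sumsq >= K p\<close> by \<open>q / 2\<close>; the normal density, below one, bounds that of
  a linear form within \<open>q / 4\<close> by \<open>q / 2\<close>. The witness
  \<open>a = q^3 / 32\<close> is \<open>(q / 4)^2 / K\<close>, and nothing depends on
  \<open>p\<close>.\<close>

lemma dirsq_small_ball:
  assumes q: "0 < q"
  shows "\<exists>a>0. \<forall>p e. 1 \<le> p \<longrightarrow> (\<Sum>i<p. (e i)\<^sup>2) = 1 \<longrightarrow>
    emeasure (gaussP p) {x \<in> space (gaussP p). dirsq p e x < a} \<le> ennreal q"
proof (intro exI[of _ "q ^ 3 / 32"] conjI allI impI)
  show "0 < q ^ 3 / 32" using q by simp
  fix p and e :: "nat \<Rightarrow> real" assume p: "1 \<le> p" and e: "(\<Sum>i<p. (e i)\<^sup>2) = 1"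
  define a where "a = q ^ 3 / 32"
  define K where "K = 2 / q"
  have K: "0 < K" and a: "0 < a" using q by (auto simp: K_def a_def)
  have aK: "a * K = (q / 4)\<^sup>2" using q by (simp add: a_def K_def power2_eq_square power3_eq_cube)
  interpret prob_space "gaussP p" by (rule prob_space_gaussP)
  let ?A = "{x \<in> space (gaussP p). 1 \<le> ennreal (1 / (K * real p)) * ennreal (sumsq p x)}"
  let ?B = "{x \<in> space (gaussP p). \<bar>\<Sum>i<p. e i * x i\<bar> \<le> q / 4}"
  have "{x \<in> space (gaussP p). dirsq p e x < a} \<subseteq> ?A \<union> ?B"
  proof
    fix x assume x: "x \<in> {x \<in> space (gaussP p). dirsq p e x < a}"
    show "x \<in> ?A \<union> ?B"
    proof (cases "K * real p \<le> sumsq p x")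
      case True
      then have "1 \<le> 1 / (K * real p) * sumsq p x" using K p by (simp add: field_simps)
      then have "ennreal 1 \<le> ennreal (1 / (K * real p) * sumsq p x)" by (rule ennreal_leI)
      also have "\<dots> = ennreal (1 / (K * real p)) * ennreal (sumsq p x)" using K by (intro ennreal_mult') simp
      finally show ?thesis using x by simp
    next
      case False
      have "(\<Sum>i<p. e i * x i)\<^sup>2 \<le> a * K"
      proof (cases "sumsq p x = 0")
        case True
        then show ?thesis using lin_sq_le_sumsq[OF e, of x] a K by (smt (verit) mult_pos_pos)
      next
        case nz: False
        then have s: "0 < sumsq p x" using sumsq_nonneg[of p x] by simp
        have "real p * (\<Sum>i<p. e i * x i)\<^sup>2 < a * sumsq p x" using x s by (simp add: dirsq_def divide_less_eq)
        also have "\<dots> \<le> a * (K * real p)" using False a by (intro mult_left_mono) auto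
        finally have "real p * (\<Sum>i<p. e i * x i)\<^sup>2 \<le> real p * (a * K)" by (simp add: algebra_simps)
        then show ?thesis using p by simp
      qed
      then have "\<bar>\<Sum>i<p. e i * x i\<bar> \<le> \<bar>q / 4\<bar>" unfolding aK by (simp only: abs_le_square_iff)
      then show ?thesis using x q by simp
    qed
  qed
  then have "emeasure (gaussP p) {x \<in> space (gaussP p). dirsq p e x < a} \<le> emeasure (gaussP p) (?A \<union> ?B)"
    by (intro emeasure_mono) auto
  also have "\<dots> \<le> emeasure (gaussP p) ?A + emeasure (gaussP p) ?B"
    by (intro emeasure_subadditive) auto
  also have "\<dots> \<le> ennreal (q / 2) + ennreal (q / 2)"
  proof (rule add_mono)
    have "emeasure (gaussP p) ?A \<le> ennreal (1 / (K * real p)) * (\<integral>\<^sup>+x. ennreal (sumsq p x) * indicator (space (gaussP p)) x \<partial>gaussP p)"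
      using nn_integral_Markov_inequality[where A = "space (gaussP p)" and M = "gaussP p" and u = "\<lambda>x. ennreal (sumsq p x)" and c = "ennreal (1 / (K * real p))"]
      by simp
    also have "(\<integral>\<^sup>+x. ennreal (sumsq p x) * indicator (space (gaussP p)) x \<partial>gaussP p) = ennreal (real p)"
      unfolding gaussP_sumsq_mean[symmetric] by (intro nn_integral_cong) simp
    also have "ennreal (1 / (K * real p)) * ennreal (real p) = ennreal (q / 2)"
      using K p by (simp add: ennreal_mult'[symmetric] K_def)
    finally show "emeasure (gaussP p) ?A \<le> ennreal (q / 2)" .
    show "emeasure (gaussP p) ?B \<le> ennreal (q / 2)" using gaussP_small_ball[OF e, of "q / 4"] q by simp
  qed
  also have "\<dots> = ennreal q" using q by (simp add: ennreal_plus[symmetric] del: ennreal_plus)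
  finally show "emeasure (gaussP p) {x \<in> space (gaussP p). dirsq p e x < q ^ 3 / 32} \<le> ennreal q" unfolding a_def .
qed

section \<open>Elliptical distributions\<close>

lemma space_borel_vec [simp]: "space (borel_vec p) = carrier_vec p"
  by (simp add: borel_vec_def)

lemma measurable_borel_vecI:
  assumes "f \<in> space M \<rightarrow> carrier_vec p" "\<And>i. i < p \<Longrightarrow> (\<lambda>x. f x $ i) \<in> borel_measurable M"
  shows "f \<in> M \<rightarrow>\<^sub>M borel_vec p"
  unfolding borel_vec_def
  by (rule measurable_vimage_algebra2) (use assms in \<open>auto intro!: measurable_restrict\<close>)

lemma borel_vec_component:
  assumes "i < p" shows "(\<lambda>v. v $ i) \<in> borel_measurable (borel_vec p)"
proof -
  have 1: "(\<lambda>v. \<lambda>i\<in>{..<p}. v $ i) \<in> borel_vec p \<rightarrow>\<^sub>M (\<Pi>\<^sub>M i\<in>{..<p}. borel)"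
    unfolding borel_vec_def by (rule measurable_vimage_algebra1) (auto simp: space_PiM)
  have 2: "(\<lambda>x. x i) \<in> (\<Pi>\<^sub>M i\<in>{..<p}. borel) \<rightarrow>\<^sub>M borel" using assms by (intro measurable_component_singleton) auto
  show ?thesis using measurable_compose[OF 1 2] assms by simp
qed

lemma vec_measurable [measurable]: "vec p \<in> lebP p \<rightarrow>\<^sub>M borel_vec p"
  by (rule measurable_borel_vecI) (auto simp: measurable_component_singleton)

lemma scalar_prod_borel_vec:
  assumes "f \<in> M \<rightarrow>\<^sub>M borel_vec p" "g \<in> M \<rightarrow>\<^sub>M borel_vec p"
  shows "(\<lambda>x. f x \<bullet> g x) \<in> borel_measurable M"
proof -
  have "(\<lambda>x. \<Sum>i<p. f x $ i * g x $ i) \<in> borel_measurable M"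
    by (intro borel_measurable_sum borel_measurable_times measurable_compose[OF assms(1) borel_vec_component]
        measurable_compose[OF assms(2) borel_vec_component]) auto
  moreover have "f x \<bullet> g x = (\<Sum>i<p. f x $ i * g x $ i)" if "x \<in> space M" for x
    using measurable_space[OF assms(2) that] by (auto simp: scalar_prod_def lessThan_atLeast0)
  ultimately show ?thesis by (subst measurable_cong) auto
qed

lemma vnorm_borel_vec: "f \<in> M \<rightarrow>\<^sub>M borel_vec p \<Longrightarrow> (\<lambda>x. vnorm (f x)) \<in> borel_measurable M"
  unfolding vnorm_def using scalar_prod_borel_vec[of f M p f] by measurable

lemma const_borel_vec: "e \<in> carrier_vec p \<Longrightarrow> (\<lambda>_. e) \<in> M \<rightarrow>\<^sub>M borel_vec p"
  by (rule measurable_const) simp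

lemma mult_mat_vec_borel_vec:
  assumes A: "A \<in> carrier_mat p p" and f: "f \<in> M \<rightarrow>\<^sub>M borel_vec p"
  shows "(\<lambda>x. A *\<^sub>v f x) \<in> M \<rightarrow>\<^sub>M borel_vec p"
proof (rule measurable_borel_vecI)
  have fc: "f x \<in> carrier_vec p" if "x \<in> space M" for x using measurable_space[OF f that] by simp
  then show "(\<lambda>x. A *\<^sub>v f x) \<in> space M \<rightarrow> carrier_vec p" using A by auto
  fix i assume i: "i < p"
  have "(\<lambda>x. row A i \<bullet> f x) \<in> borel_measurable M"
    using A i by (intro scalar_prod_borel_vec[of _ _ p] const_borel_vec f) auto
  then show "(\<lambda>x. (A *\<^sub>v f x) $ i) \<in> borel_measurable M" using A i by simp
qed

lemma smult_borel_vec: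
  assumes c: "c \<in> borel_measurable M" and f: "f \<in> M \<rightarrow>\<^sub>M borel_vec p"
  shows "(\<lambda>x. c x \<cdot>\<^sub>v f x) \<in> M \<rightarrow>\<^sub>M borel_vec p"
proof (rule measurable_borel_vecI)
  have fc: "f x \<in> carrier_vec p" if "x \<in> space M" for x using measurable_space[OF f that] by simp
  then show "(\<lambda>x. c x \<cdot>\<^sub>v f x) \<in> space M \<rightarrow> carrier_vec p" by auto
  fix i assume i: "i < p"
  have "(\<lambda>x. c x * f x $ i) \<in> borel_measurable M"
    by (intro borel_measurable_times c measurable_compose[OF f borel_vec_component[OF i]])
  moreover have "(c x \<cdot>\<^sub>v f x) $ i = c x * f x $ i" if "x \<in> space M" for x using fc[OF that] i by auto
  ultimately show "(\<lambda>x. (c x \<cdot>\<^sub>v f x) $ i) \<in> borel_measurable M" by (subst measurable_cong) auto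
qed

lemma vec_scaleP: "vec p (scaleP p r x) = r \<cdot>\<^sub>v vec p x"
  by (intro eq_vecI) (auto simp: scaleP_def)

lemma vec_scalar_prod: "vec p x \<bullet> vec p x = sumsq p x"
  by (simp add: scalar_prod_def sumsq_def power2_eq_square lessThan_atLeast0)

abbreviation ballV :: "nat \<Rightarrow> real vec set" where
  "ballV p \<equiv> {v \<in> carrier_vec p. vnorm v \<le> 1}"

lemma vec_ball: "x \<in> space (lebP p) \<Longrightarrow> vec p x \<in> ballV p \<longleftrightarrow> x \<in> ballP p"
  using sumsq_nonneg[of p x] by (auto simp: vnorm_def vec_scalar_prod ballP_def)

lemma sets_lborel_vec [simp, measurable_cong]: "sets (lborel_vec p) = sets (borel_vec p)"
  by (simp add: lborel_vec_def)

lemma zero_vec_sets: "{0\<^sub>v p} \<in> sets (borel_vec p)"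
proof -
  have "vnorm -` {0} \<inter> space (borel_vec p) \<in> sets (borel_vec p)"
    by (rule measurable_sets[OF vnorm_borel_vec[OF measurable_ident_sets[OF refl]]]) simp
  moreover have "vnorm -` {0} \<inter> space (borel_vec p) = {0\<^sub>v p :: real vec}"
    using vnorm_eq_0_iff[of _ p] zero_carrier_vec[of p] by (simp only: space_borel_vec) blast
  ultimately show ?thesis by simp
qed

lemma ballV_sets: "ballV p \<in> sets (borel_vec p)"
proof -
  have [measurable]: "vnorm \<in> borel_measurable (borel_vec p)" using vnorm_borel_vec[OF measurable_ident_sets[OF refl]] by simp
  have "{v \<in> space (borel_vec p). vnorm v \<le> 1} \<in> sets (borel_vec p)" by measurable
  then show ?thesis by simp
qed

lemma emeasure_ballV: "emeasure (lborel_vec p) (ballV p) = emeasure (lebP p) (ballP p)"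
proof -
  have "emeasure (lborel_vec p) (ballV p) = emeasure (lebP p) (vec p -` ballV p \<inter> space (lebP p))"
    unfolding lborel_vec_def by (rule emeasure_distr[OF vec_measurable ballV_sets])
  also have "vec p -` ballV p \<inter> space (lebP p) = ballP p"
    using vec_ball by (auto simp: ballP_def)
  finally show ?thesis .
qed

lemma prob_space_sphere_uniform:
  assumes p: "1 \<le> p" shows "prob_space (sphere_uniform p)"
  unfolding sphere_uniform_def
proof (rule prob_space.prob_space_distr)
  show "prob_space (uniform_measure (lborel_vec p) (ballV p))"
    using ballP_pos[OF p] ballP_finite[of p] by (intro prob_space_uniform_measure) (auto simp: emeasure_ballV)
  have i: "(\<lambda>v. v) \<in> uniform_measure (lborel_vec p) (ballV p) \<rightarrow>\<^sub>M borel_vec p" by (rule measurable_ident_sets) simp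
  show "(\<lambda>v. (1 / vnorm v) \<cdot>\<^sub>v v) \<in> uniform_measure (lborel_vec p) (ballV p) \<rightarrow>\<^sub>M borel_vec p"
    by (intro smult_borel_vec i borel_measurable_divide vnorm_borel_vec[OF i]) auto
qed

text \<open>A function invariant under dilations does not notice the projection to the sphere, so
  the cone measure reduces to the ball and the ball to the Gaussian.\<close>

lemma nn_integral_sphere_uniform:
  assumes p: "1 \<le> p" and g: "g \<in> borel_measurable (borel_vec p)" and bd: "\<And>v. v \<in> carrier_vec p \<Longrightarrow> g v \<le> ennreal K"
    and hom: "\<And>c v. c \<noteq> 0 \<Longrightarrow> v \<in> carrier_vec p \<Longrightarrow> g (c \<cdot>\<^sub>v v) = g v"
  shows "(\<integral>\<^sup>+v. g v \<partial>sphere_uniform p) = (\<integral>\<^sup>+x. g (vec p x) \<partial>gaussP p)"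
proof -
  let ?U = "uniform_measure (lborel_vec p) (ballV p)"
  have i: "(\<lambda>v. v) \<in> ?U \<rightarrow>\<^sub>M borel_vec p" by (rule measurable_ident_sets) simp
  have m: "(\<lambda>v. (1 / vnorm v) \<cdot>\<^sub>v v) \<in> ?U \<rightarrow>\<^sub>M borel_vec p"
    by (intro smult_borel_vec i borel_measurable_divide vnorm_borel_vec[OF i]) auto
  have "(\<integral>\<^sup>+v. g v \<partial>sphere_uniform p) = (\<integral>\<^sup>+v. g ((1 / vnorm v) \<cdot>\<^sub>v v) \<partial>?U)"
    unfolding sphere_uniform_def by (rule nn_integral_distr[OF m]) (use g in simp)
  also have "\<dots> = (\<integral>\<^sup>+v. g v \<partial>?U)"
  proof (rule nn_integral_cong)
    fix v assume "v \<in> space ?U"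
    then have v: "v \<in> carrier_vec p" using sets_eq_imp_space_eq[OF sets_lborel_vec[of p]] by simp
    show "g ((1 / vnorm v) \<cdot>\<^sub>v v) = g v"
    proof (cases "v = 0\<^sub>v p")
      \<comment> \<open>At the origin the normalisation divides by zero, but the resulting scalar
        multiplies the zero vector and changes nothing.\<close>
      case True
      then have "(1 / vnorm v) \<cdot>\<^sub>v v = v" by (intro eq_vecI) auto
      then show ?thesis by simp
    next
      case False
      then show ?thesis using vnorm_pos[OF v False] v by (intro hom) auto
    qed
  qed
  also have "\<dots> = (\<integral>\<^sup>+v. g v * indicator (ballV p) v \<partial>lborel_vec p) / emeasure (lborel_vec p) (ballV p)"
    using g ballV_sets[of p] by (intro nn_integral_uniform_measure) (auto simp: measurable_cong_sets[OF sets_lborel_vec refl])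
  also have "(\<integral>\<^sup>+v. g v * indicator (ballV p) v \<partial>lborel_vec p) = (\<integral>\<^sup>+x. g (vec p x) * indicator (ballV p) (vec p x) \<partial>lebP p)"
    unfolding lborel_vec_def using g ballV_sets[of p] by (intro nn_integral_distr) auto
  also have "\<dots> = (\<integral>\<^sup>+x. g (vec p x) * indicator (ballP p) x \<partial>lebP p)"
    by (intro nn_integral_cong) (use vec_ball in \<open>auto split: split_indicator\<close>)
  also have "\<dots> = emeasure (lebP p) (ballP p) * (\<integral>\<^sup>+x. g (vec p x) \<partial>gaussP p)"
  proof (rule gauss_direction[OF p, symmetric])
    show "(\<lambda>x. g (vec p x)) \<in> borel_measurable (lebP p)" by (rule measurable_compose[OF vec_measurable g])
    show "g (vec p (scaleP p r x)) = g (vec p x)" if "0 < r" for r x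
      unfolding vec_scaleP using that by (intro hom) auto
    show "(\<integral>\<^sup>+x. g (vec p x) * indicator (ballP p) x \<partial>lebP p) < \<infinity>" by (rule bounded_ball_integral[OF bd[OF vec_carrier]])
  qed
  also have "\<dots> / emeasure (lborel_vec p) (ballV p) = (\<integral>\<^sup>+x. g (vec p x) \<partial>gaussP p)"
    unfolding emeasure_ballV using ballP_pos[OF p] ballP_finite[of p]
    by (subst mult.commute) (auto simp: ennreal_mult_divide_eq)
  finally show ?thesis .
qed

lemma sets_sphere_uniform [simp, measurable_cong]: "sets (sphere_uniform p) = sets (borel_vec p)"
  by (simp add: sphere_uniform_def)

lemma elliptical_measurable:
  assumes B: "B \<in> carrier_mat p p" and U: "sets U = sets (borel :: real measure)"
  shows "(\<lambda>(u, v). u \<cdot>\<^sub>v (B *\<^sub>v v)) \<in> U \<Otimes>\<^sub>M sphere_uniform p \<rightarrow>\<^sub>M borel_vec p"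
proof -
  have 1: "fst \<in> borel_measurable (U \<Otimes>\<^sub>M sphere_uniform p)"
    using measurable_fst[of U "sphere_uniform p"] by (simp add: measurable_cong_sets[OF refl U])
  have 2: "snd \<in> U \<Otimes>\<^sub>M sphere_uniform p \<rightarrow>\<^sub>M borel_vec p"
    using measurable_snd[of U "sphere_uniform p"] by (simp add: measurable_cong_sets[OF refl sets_sphere_uniform])
  show ?thesis unfolding split_beta by (intro smult_borel_vec mult_mat_vec_borel_vec B 1 2)
qed

lemma elliptical_sets: "centered_elliptical p S D \<Longrightarrow> sets D = sets (borel_vec p)"
  by (auto simp: centered_elliptical_def)

lemma elliptical_prob:
  assumes p: "1 \<le> p" and D: "centered_elliptical p S D" shows "prob_space D"
proof -
  from D obtain U :: "real measure" where S: "pos_def p S" and U: "prob_space U" "sets U = sets borel"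
    and Deq: "D = distr (U \<Otimes>\<^sub>M sphere_uniform p) (borel_vec p) (\<lambda>(u, v). u \<cdot>\<^sub>v (mat_sqrt S *\<^sub>v v))"
    by (auto simp: centered_elliptical_def)
  have B: "mat_sqrt S \<in> carrier_mat p p" using mat_sqrt(1)[OF p S] by (simp add: pos_def_def)
  interpret pair_prob_space U "sphere_uniform p"
    using U prob_space_sphere_uniform[OF p] by (simp add: pair_prob_space_def pair_sigma_finite_def prob_space_imp_sigma_finite)
  show ?thesis unfolding Deq by (rule prob_space_distr[OF elliptical_measurable[OF B U(2)]])
qed

text \<open>Invariance under all nonzero scalars, negative ones included, removes the factor
  \<open>u\<close> for almost every value, so neither the law of \<open>u\<close> nor its sign is
  seen.\<close>

lemma elliptical_nn_integral:
  assumes p: "1 \<le> p" and D: "centered_elliptical p S D"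
    and h: "h \<in> borel_measurable (borel_vec p)" and bd: "\<And>v. v \<in> carrier_vec p \<Longrightarrow> h v \<le> ennreal K"
    and hom: "\<And>c v. c \<noteq> 0 \<Longrightarrow> v \<in> carrier_vec p \<Longrightarrow> h (c \<cdot>\<^sub>v v) = h v"
  shows "(\<integral>\<^sup>+x. h x \<partial>D) = (\<integral>\<^sup>+x. h (mat_sqrt S *\<^sub>v vec p x) \<partial>gaussP p)"
proof -
  from D obtain U :: "real measure" where S: "pos_def p S" and U: "prob_space U" "sets U = sets borel" "AE u in U. u \<noteq> 0"
    and Deq: "D = distr (U \<Otimes>\<^sub>M sphere_uniform p) (borel_vec p) (\<lambda>(u, v). u \<cdot>\<^sub>v (mat_sqrt S *\<^sub>v v))"
    by (auto simp: centered_elliptical_def)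
  have B: "mat_sqrt S \<in> carrier_mat p p" using mat_sqrt(1)[OF p S] by (simp add: pos_def_def)
  note m = elliptical_measurable[OF B U(2)]
  interpret V: prob_space "sphere_uniform p" by (rule prob_space_sphere_uniform[OF p])
  have Bm: "(\<lambda>v. mat_sqrt S *\<^sub>v v) \<in> borel_vec p \<rightarrow>\<^sub>M borel_vec p"
    by (intro mult_mat_vec_borel_vec B measurable_ident_sets refl)
  have "(\<integral>\<^sup>+x. h x \<partial>D) = (\<integral>\<^sup>+z. h (case z of (u, v) \<Rightarrow> u \<cdot>\<^sub>v (mat_sqrt S *\<^sub>v v)) \<partial>(U \<Otimes>\<^sub>M sphere_uniform p))"
    unfolding Deq by (rule nn_integral_distr[OF m]) (use h in simp)
  also have "\<dots> = (\<integral>\<^sup>+u. \<integral>\<^sup>+v. h (u \<cdot>\<^sub>v (mat_sqrt S *\<^sub>v v)) \<partial>sphere_uniform p \<partial>U)"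
    using V.nn_integral_fst[OF measurable_compose[OF m h]] by simp
  also have "\<dots> = (\<integral>\<^sup>+u. (\<integral>\<^sup>+v. h (mat_sqrt S *\<^sub>v v) \<partial>sphere_uniform p) \<partial>U)"
  proof (rule nn_integral_cong_AE)
    have *: "(\<integral>\<^sup>+v. h (u \<cdot>\<^sub>v (mat_sqrt S *\<^sub>v v)) \<partial>sphere_uniform p) = (\<integral>\<^sup>+v. h (mat_sqrt S *\<^sub>v v) \<partial>sphere_uniform p)"
      if "u \<noteq> 0" for u
    proof (rule nn_integral_cong)
      fix v assume "v \<in> space (sphere_uniform p)"
      then have "v \<in> carrier_vec p" using sets_eq_imp_space_eq[OF sets_sphere_uniform[of p]] by simp
      then show "h (u \<cdot>\<^sub>v (mat_sqrt S *\<^sub>v v)) = h (mat_sqrt S *\<^sub>v v)" by (intro hom that mult_mat_vec_carrier[OF B])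
    qed
    show "AE u in U. (\<integral>\<^sup>+v. h (u \<cdot>\<^sub>v (mat_sqrt S *\<^sub>v v)) \<partial>sphere_uniform p) = (\<integral>\<^sup>+v. h (mat_sqrt S *\<^sub>v v) \<partial>sphere_uniform p)"
      using U(3) by eventually_elim (rule *)
  qed
  also have "\<dots> = (\<integral>\<^sup>+v. h (mat_sqrt S *\<^sub>v v) \<partial>sphere_uniform p)"
    using prob_space.emeasure_space_1[OF U(1)] by simp
  also have "\<dots> = (\<integral>\<^sup>+x. h (mat_sqrt S *\<^sub>v vec p x) \<partial>gaussP p)"
  proof (rule nn_integral_sphere_uniform[OF p])
    show "h (mat_sqrt S *\<^sub>v v) \<le> ennreal K" if "v \<in> carrier_vec p" for v
      by (rule bd[OF mult_mat_vec_carrier[OF B that]])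
    show "(\<lambda>v. h (mat_sqrt S *\<^sub>v v)) \<in> borel_measurable (borel_vec p)" by (rule measurable_compose[OF Bm h])
    fix c :: real and v :: "real vec" assume c: "c \<noteq> 0" and v: "v \<in> carrier_vec p"
    show "h (mat_sqrt S *\<^sub>v (c \<cdot>\<^sub>v v)) = h (mat_sqrt S *\<^sub>v v)"
      unfolding mult_mat_vec[OF B v] by (rule hom[OF c mult_mat_vec_carrier[OF B v]])
  qed
  finally show ?thesis .
qed

section \<open>Nets of the sphere\<close>

text \<open>Twice a geometric series plus the central term; the explicit remainder makes the
  induction close.\<close>

lemma sum_two_powers: "(\<Sum>k\<in>{- int L..int L}. (1/2 :: real) ^ nat \<bar>k\<bar>) \<le> 3 - 2 * (1/2) ^ L"
proof (induction L)
  case (Suc L)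
  have "{- int (Suc L)..int (Suc L)} = insert (int (Suc L)) (insert (- int (Suc L)) {- int L..int L})" by auto
  then have "(\<Sum>k\<in>{- int (Suc L)..int (Suc L)}. (1/2 :: real) ^ nat \<bar>k\<bar>) = 2 * (1/2) ^ Suc L + (\<Sum>k\<in>{- int L..int L}. (1/2) ^ nat \<bar>k\<bar>)"
    by (simp add: nat_add_distrib)
  then show ?case using Suc by simp
qed simp

text \<open>Each point receives the weight \<open>2 ^ M\<close> times \<open>1/2\<close> to the
  power of its l1 norm, which is at least one on the l1 ball. Over the whole box the weights factor
  by coordinates, and each factor sums to at most \<open>3\<close>.\<close>

lemma lattice_l1_ball_card:
  fixes p M :: nat
  defines "Z \<equiv> {z \<in> {..<p} \<rightarrow>\<^sub>E {- int M..int M}. (\<Sum>i<p. nat \<bar>z i\<bar>) \<le> M}"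
  shows "finite Z" "real (card Z) \<le> 2 ^ M * 3 ^ p"
proof -
  have fin: "finite ({..<p} \<rightarrow>\<^sub>E {- int M..int M})" by (intro finite_PiE) auto
  then show "finite Z" unfolding Z_def by simp
  have "real (card Z) = (\<Sum>z\<in>Z. 1)" by simp
  also have "\<dots> \<le> (\<Sum>z\<in>Z. 2 ^ M * (\<Prod>i<p. (1/2 :: real) ^ nat \<bar>z i\<bar>))"
  proof (rule sum_mono)
    fix z assume z: "z \<in> Z"
    have "(\<Prod>i<p. (1/2 :: real) ^ nat \<bar>z i\<bar>) = (1/2) ^ (\<Sum>i<p. nat \<bar>z i\<bar>)" by (simp add: power_sum)
    also have "\<dots> \<ge> (1/2) ^ M" using z by (intro power_decreasing) (auto simp: Z_def)
    finally have "2 ^ M * (1/2 :: real) ^ M \<le> 2 ^ M * (\<Prod>i<p. (1/2) ^ nat \<bar>z i\<bar>)" by (intro mult_left_mono) auto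
    moreover have "2 ^ M * (1/2 :: real) ^ M = 1" by (simp add: power_one_over)
    ultimately show "1 \<le> 2 ^ M * (\<Prod>i<p. (1/2 :: real) ^ nat \<bar>z i\<bar>)" by (simp only:)
  qed
  also have "\<dots> \<le> (\<Sum>z\<in>({..<p} \<rightarrow>\<^sub>E {- int M..int M}). 2 ^ M * (\<Prod>i<p. (1/2 :: real) ^ nat \<bar>z i\<bar>))"
  proof (rule sum_mono2[OF fin])
    show "Z \<subseteq> {..<p} \<rightarrow>\<^sub>E {- int M..int M}" unfolding Z_def by blast
    show "0 \<le> 2 ^ M * (\<Prod>i<p. (1/2 :: real) ^ nat \<bar>z i\<bar>)" for z :: "nat \<Rightarrow> int"
      by (intro mult_nonneg_nonneg prod_nonneg) simp_all
  qed
  also have "\<dots> = 2 ^ M * (\<Sum>z\<in>({..<p} \<rightarrow>\<^sub>E {- int M..int M}). \<Prod>i<p. (1/2 :: real) ^ nat \<bar>z i\<bar>)"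
    by (rule sum_distrib_left[symmetric])
  also have "(\<Sum>z\<in>({..<p} \<rightarrow>\<^sub>E {- int M..int M}). \<Prod>i<p. (1/2 :: real) ^ nat \<bar>z i\<bar>)
    = (\<Prod>i<p. \<Sum>k\<in>{- int M..int M}. (1/2 :: real) ^ nat \<bar>k\<bar>)"
    by (rule prod_sum_PiE[symmetric]) auto
  also have "2 ^ M * \<dots> \<le> 2 ^ M * (\<Prod>i<p. 3 :: real)"
  proof (intro mult_left_mono prod_mono conjI)
    show "(\<Sum>k\<in>{- int M..int M}. (1/2 :: real) ^ nat \<bar>k\<bar>) \<le> 3"
      by (rule order_trans[OF sum_two_powers]) simp
  qed (auto intro: sum_nonneg)
  finally show "real (card Z) \<le> 2 ^ M * 3 ^ p" by simp
qed

text \<open>The net consists of lattice points divided by \<open>c = m sqrt p\<close>. A unit vector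
  has l1 norm at most \<open>sqrt p\<close>, so its rounded multiple lies in the lattice l1 ball of
  radius \<open>m p\<close>; counting there makes the size exponential in \<open>p\<close> with a
  base independent of \<open>p\<close>. Rounding errors of \<open>1 / c\<close> per coordinate
  combine to \<open>1 / m\<close>.\<close>

lemma sphere_net:
  assumes p: "1 \<le> p" and m: "1 \<le> m"
  shows "\<exists>N. finite N \<and> N \<subseteq> carrier_vec p \<and> real (card N) \<le> (2 ^ m * 3) ^ p \<and>
    (\<forall>v \<in> carrier_vec p. v \<bullet> v = 1 \<longrightarrow> (\<exists>y \<in> N. y \<bullet> y \<le> 1 \<and> (v - y) \<bullet> (v - y) \<le> (1 / real m)\<^sup>2))"
proof -
  define c where "c = real m * sqrt (real p)"
  have c: "0 < c" using p m by (simp add: c_def)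
  define Z where "Z = {z \<in> {..<p} \<rightarrow>\<^sub>E {- int (m * p)..int (m * p)}. (\<Sum>i<p. nat \<bar>z i\<bar>) \<le> m * p}"
  define F where "F z = vec p (\<lambda>i. real_of_int (z i) / c)" for z :: "nat \<Rightarrow> int"
  note Z = lattice_l1_ball_card[of p "m * p", folded Z_def]
  have "card (F ` Z) \<le> card Z" by (rule card_image_le[OF Z(1)])
  then have card: "real (card (F ` Z)) \<le> (2 ^ m * 3) ^ p" using Z(2) by (simp add: power_mult power_mult_distrib)
  have near: "\<exists>y \<in> F ` Z. y \<bullet> y \<le> 1 \<and> (v - y) \<bullet> (v - y) \<le> (1 / real m)\<^sup>2"
    if v: "v \<in> carrier_vec p" "v \<bullet> v = (1 :: real)" for v
  proof -
    have dv: "dim_vec v = p" using v by simp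
    \<comment> \<open>Rounding towards zero increases no coordinate in modulus, so neither the l1
      norm nor the Euclidean norm grows.\<close>
    define z where "z = (\<lambda>i\<in>{..<p}. if 0 \<le> v $ i then \<lfloor>c * v $ i\<rfloor> else \<lceil>c * v $ i\<rceil>)"
    have zi: "real_of_int \<bar>z i\<bar> \<le> c * \<bar>v $ i\<bar>" "\<bar>c * v $ i - real_of_int (z i)\<bar> \<le> 1" if "i < p" for i
    proof -
      have "real_of_int \<bar>z i\<bar> \<le> c * \<bar>v $ i\<bar> \<and> \<bar>c * v $ i - real_of_int (z i)\<bar> \<le> 1"
      proof (cases "0 \<le> v $ i")
        case True
        then have "0 \<le> c * v $ i" using c by simp
        then have "0 \<le> \<lfloor>c * v $ i\<rfloor>" by simp
        then show ?thesis using True that by (simp add: z_def) linarith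
      next
        case False
        then have "c * v $ i \<le> 0" using c by (simp add: mult_nonneg_nonpos)
        then have "\<lceil>c * v $ i\<rceil> \<le> 0" by simp
        then show ?thesis using False that by (simp add: z_def) linarith
      qed
      then show "real_of_int \<bar>z i\<bar> \<le> c * \<bar>v $ i\<bar>" "\<bar>c * v $ i - real_of_int (z i)\<bar> \<le> 1" by auto
    qed
    have vsum: "(\<Sum>i<p. (v $ i)\<^sup>2) = 1" using v dv by (simp add: scalar_prod_def power2_eq_square lessThan_atLeast0)
    have "(\<Sum>i<p. 1 * \<bar>v $ i\<bar>)\<^sup>2 \<le> (\<Sum>i<p. 1\<^sup>2) * (\<Sum>i<p. \<bar>v $ i\<bar>\<^sup>2)" by (rule Cauchy_Schwarz_ineq_sum)
    then have "(\<Sum>i<p. \<bar>v $ i\<bar>)\<^sup>2 \<le> (sqrt (real p))\<^sup>2" using vsum by simp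
    then have l1: "(\<Sum>i<p. \<bar>v $ i\<bar>) \<le> sqrt (real p)" by (rule power2_le_imp_le) simp
    have "real (\<Sum>i<p. nat \<bar>z i\<bar>) = (\<Sum>i<p. real_of_int \<bar>z i\<bar>)" by simp
    also have "\<dots> \<le> (\<Sum>i<p. c * \<bar>v $ i\<bar>)" using zi by (intro sum_mono) auto
    also have "\<dots> = c * (\<Sum>i<p. \<bar>v $ i\<bar>)" by (simp add: sum_distrib_left)
    also have "\<dots> \<le> c * sqrt (real p)" using l1 c by (intro mult_left_mono) auto
    also have "\<dots> = real (m * p)" by (simp add: c_def)
    finally have zs: "(\<Sum>i<p. nat \<bar>z i\<bar>) \<le> m * p" by (simp only: of_nat_le_iff)
    have "z i \<in> {- int (m * p)..int (m * p)}" if "i < p" for i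
    proof -
      have "nat \<bar>z i\<bar> \<le> (\<Sum>i<p. nat \<bar>z i\<bar>)" using that by (intro member_le_sum) auto
      then have "nat \<bar>z i\<bar> \<le> m * p" using zs by linarith
      then have "\<bar>z i\<bar> \<le> int (m * p)" by (simp only: nat_le_iff)
      then show ?thesis by auto
    qed
    then have zZ: "z \<in> Z" using zs by (auto simp: Z_def z_def)
    have "F z \<bullet> F z = (\<Sum>i<p. (real_of_int (z i) / c)\<^sup>2)"
      by (simp add: F_def scalar_prod_def power2_eq_square lessThan_atLeast0)
    also have "\<dots> \<le> (\<Sum>i<p. (v $ i)\<^sup>2)"
    proof (rule sum_mono)
      fix i assume "i \<in> {..<p}"
      then have "\<bar>real_of_int (z i) / c\<bar> \<le> \<bar>v $ i\<bar>" using zi(1)[of i] c by (simp add: abs_divide divide_le_eq mult.commute)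
      then show "(real_of_int (z i) / c)\<^sup>2 \<le> (v $ i)\<^sup>2" by (simp only: abs_le_square_iff)
    qed
    finally have 1: "F z \<bullet> F z \<le> 1" using vsum by simp
    have "(v - F z) \<bullet> (v - F z) = (\<Sum>i<p. (v $ i - real_of_int (z i) / c)\<^sup>2)"
      using dv by (simp add: F_def scalar_prod_def power2_eq_square lessThan_atLeast0)
    also have "\<dots> \<le> (\<Sum>i<p. (1 / c)\<^sup>2)"
    proof (rule sum_mono)
      fix i assume "i \<in> {..<p}"
      then have "\<bar>c * v $ i - real_of_int (z i)\<bar> / c \<le> 1 / c" using zi(2)[of i] c by (intro divide_right_mono) auto
      moreover have "\<bar>v $ i - real_of_int (z i) / c\<bar> = \<bar>c * v $ i - real_of_int (z i)\<bar> / c"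
        using c by (simp add: abs_divide[symmetric, of _ c, simplified abs_of_pos[OF c]] diff_divide_distrib)
      ultimately have "\<bar>v $ i - real_of_int (z i) / c\<bar> \<le> \<bar>1 / c\<bar>" using c by simp
      then show "(v $ i - real_of_int (z i) / c)\<^sup>2 \<le> (1 / c)\<^sup>2" by (simp only: abs_le_square_iff)
    qed
    also have "\<dots> = (1 / real m)\<^sup>2" using p by (simp add: c_def power_divide power_mult_distrib)
    finally show ?thesis using 1 zZ by blast
  qed
  show ?thesis
    by (rule exI[of _ "F ` Z"]) (use Z(1) card near in \<open>auto simp: F_def\<close>)
qed

lemma bil_diff_bound:
  assumes M: "sym_mat p M" and t: "0 \<le> t" and q: "\<And>v. v \<in> carrier_vec p \<Longrightarrow> \<bar>bil M v v\<bar> \<le> t * (v \<bullet> v)"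
    and v: "v \<in> carrier_vec p" and y: "y \<in> carrier_vec p"
  shows "\<bar>bil M v v - bil M y y\<bar> \<le> t * vnorm (v - y) * (vnorm v + vnorm y)"
proof -
  have w: "v - y \<in> carrier_vec p" using v y by simp
  have vy: "v = y + (v - y)" using v y by (intro eq_vecI) auto
  have c: "M \<in> carrier_mat p p" by (rule sym_matD(1)[OF M])
  have "bil M v v = bil M (y + (v - y)) v" using vy by simp
  also have "\<dots> = bil M y v + bil M (v - y) v" by (rule bil_add_left[OF c y w v])
  also have "bil M y v = bil M y (y + (v - y))" using vy by simp
  also have "\<dots> = bil M y y + bil M y (v - y)" by (rule bil_add_right[OF c y w y])
  finally have "bil M v v - bil M y y = bil M y (v - y) + bil M (v - y) v" by simp
  moreover have "\<bar>bil M y (v - y)\<bar> \<le> t * vnorm y * vnorm (v - y)" "\<bar>bil M (v - y) v\<bar> \<le> t * vnorm (v - y) * vnorm v"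
    by (rule symmetric_bil_bound[OF M t q]; use v y w in simp)+
  ultimately show ?thesis by (simp add: algebra_simps)
qed

text \<open>The largest error \<open>th\<close> over the sphere is attained at some
  \<open>u\<close>; moving \<open>u\<close> to a net point costs at most
  \<open>2 th / m <= th / 2\<close>, so \<open>th <= t + th / 2\<close>.\<close>

lemma net_covariance:
  assumes p: "1 \<le> p" and n: "1 \<le> n" and y: "\<And>i. i < n \<Longrightarrow> y i \<in> carrier_vec p"
    and unit: "\<And>i. i < n \<Longrightarrow> y i \<bullet> y i = 1" and m: "4 \<le> m" and t: "0 \<le> t"
    and N: "N \<subseteq> carrier_vec p"
    and net: "\<And>v. v \<in> carrier_vec p \<Longrightarrow> v \<bullet> v = 1 \<Longrightarrow> \<exists>w \<in> N. w \<bullet> w \<le> 1 \<and> (v - w) \<bullet> (v - w) \<le> (1 / real m)\<^sup>2"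
    and cov: "\<And>w. w \<in> N \<Longrightarrow> \<bar>real p / real n * (\<Sum>i<n. (w \<bullet> y i)\<^sup>2) - w \<bullet> w\<bar> \<le> t * (w \<bullet> w)"
    and v: "v \<in> carrier_vec p"
  shows "\<bar>real p / real n * (\<Sum>i<n. (v \<bullet> y i)\<^sup>2) - v \<bullet> v\<bar> \<le> 2 * t * (v \<bullet> v)"
proof -
  define M where "M = psi p n y (1\<^sub>m p) - 1\<^sub>m p"
  have Mc: "M \<in> carrier_mat p p" unfolding M_def by (rule minus_carrier_mat) simp
  have Ms: "sym_mat p M" unfolding sym_mat_def
  proof
    have "M\<^sup>T = (psi p n y (1\<^sub>m p))\<^sup>T - (1\<^sub>m p)\<^sup>T" unfolding M_def by (rule transpose_minus[OF psi_carrier one_carrier_mat])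
    then show "M\<^sup>T = M" using sym_matD(2)[OF psi_sym] by (simp add: M_def)
  qed (rule Mc)
  have Mb: "bil M u u = real p / real n * (\<Sum>i<n. (u \<bullet> y i)\<^sup>2) - u \<bullet> u" if u: "u \<in> carrier_vec p" for u
  proof -
    have "bil M u u = bil (psi p n y (1\<^sub>m p)) u u - bil (1\<^sub>m p) u u"
      unfolding M_def by (rule bil_minus_mat[OF psi_carrier one_carrier_mat u u])
    also have "bil (psi p n y (1\<^sub>m p)) u u = real p / real n * (\<Sum>i<n. (u \<bullet> y i) * (u \<bullet> y i) / bil (1\<^sub>m p) (y i) (y i))"
      by (rule bil_psi[OF y u u])
    also have "(\<Sum>i<n. (u \<bullet> y i) * (u \<bullet> y i) / bil (1\<^sub>m p) (y i) (y i)) = (\<Sum>i<n. (u \<bullet> y i)\<^sup>2)"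
      using y unit by (intro sum.cong) (auto simp: bil_one power2_eq_square)
    finally show ?thesis using u by (simp add: bil_one)
  qed
  let ?S = "{\<bar>bil M v v\<bar> | v. v \<in> carrier_vec p \<and> v \<bullet> v = (1 :: real)}"
  have "compact ?S"
    by (rule sphere_image_compact) (auto intro!: tendsto_intros bil_tendsto mconv_const Mc)
  moreover have "?S \<noteq> {}" using unit_vec_sphere[OF p] by blast
  ultimately obtain th where "th \<in> ?S" and max: "\<forall>s\<in>?S. s \<le> th" using compact_attains_sup by blast
  then obtain u where u: "th = \<bar>bil M u u\<bar>" "u \<in> carrier_vec p" "u \<bullet> u = 1" by auto
  have th0: "0 \<le> th" using u by simp
  have q: "\<bar>bil M x x\<bar> \<le> th * (x \<bullet> x)" if x: "x \<in> carrier_vec p" for x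
  proof (cases "x = 0\<^sub>v p")
    case True then show ?thesis using Mc by (simp add: bil_def mult_mat_zero_vec)
  next
    case False
    have "\<bar>bil M ((1 / vnorm x) \<cdot>\<^sub>v x) ((1 / vnorm x) \<cdot>\<^sub>v x)\<bar> \<in> ?S"
      by (intro CollectI exI[of _ "(1 / vnorm x) \<cdot>\<^sub>v x"] conjI refl normalized_bil(2)[OF Mc x False]) (use x in simp)
    then have "\<bar>bil M x x / (x \<bullet> x)\<bar> \<le> th" using max unfolding normalized_bil(1)[OF Mc x False] by blast
    then show ?thesis using scalar_prod_pos[OF x False] by (simp add: abs_divide divide_le_eq)
  qed
  obtain w where w: "w \<in> N" "w \<bullet> w \<le> 1" "(u - w) \<bullet> (u - w) \<le> (1 / real m)\<^sup>2" using net[OF u(2,3)] by blast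
  have wc: "w \<in> carrier_vec p" using w N by auto
  have m0: "0 < real m" using m by simp
  have nw: "vnorm (u - w) \<le> 1 / real m"
    using w(3) m0 unfolding vnorm_def by (intro real_le_lsqrt) (auto simp: scalar_prod_nonneg)
  have "vnorm w \<le> 1" "vnorm u = 1" using w(2) u(3) by (auto simp: vnorm_def)
  then have "vnorm u + vnorm w \<le> 2" by simp
  then have "th * vnorm (u - w) * (vnorm u + vnorm w) \<le> th * (1 / real m) * 2"
    using nw th0 m0 by (intro mult_mono) (auto intro: add_nonneg_nonneg)
  also have "\<dots> \<le> th / 2" using m th0 by (simp add: field_simps mult_left_mono)
  finally have "\<bar>bil M u u - bil M w w\<bar> \<le> th / 2" using bil_diff_bound[OF Ms th0 q u(2) wc] by linarith
  moreover have "\<bar>bil M w w\<bar> \<le> t * (w \<bullet> w)" unfolding Mb[OF wc] by (rule cov[OF w(1)])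
  moreover have "t * (w \<bullet> w) \<le> t" using w(2) t by (simp add: mult_left_le)
  ultimately have "th \<le> 2 * t" using u(1) by linarith
  then have "th * (v \<bullet> v) \<le> 2 * t * (v \<bullet> v)" by (intro mult_right_mono scalar_prod_nonneg)
  then show ?thesis using q[OF v] unfolding Mb[OF v] by linarith
qed

text \<open>Counts are not continuous in \<open>v\<close>, so the step from a net point
  \<open>w\<close> to \<open>v\<close> goes through the covariance: \<open>d = v - w\<close> is
  short, and few samples can see it strongly. Outside two exceptional sets of at most
  \<open>n / 8\<close> indices each, \<open>sqrt p * |v \<bullet> y i|\<close> is at least
  \<open>3/4 sqrt a - 1/2 sqrt a\<close>, which explains the loss from \<open>a\<close> to
  \<open>a / 16\<close>.\<close>

lemma net_spread:
  assumes p: "1 \<le> p" and n: "1 \<le> n" and y: "\<And>i. i < n \<Longrightarrow> y i \<in> carrier_vec p"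
    and m: "4 \<le> m" and a: "0 < a" and ma: "8 \<le> real m * sqrt a"
    and N: "N \<subseteq> carrier_vec p"
    and net: "\<And>v. v \<in> carrier_vec p \<Longrightarrow> v \<bullet> v = 1 \<Longrightarrow> \<exists>w \<in> N. w \<bullet> w \<le> 1 \<and> (v - w) \<bullet> (v - w) \<le> (1 / real m)\<^sup>2"
    and spread: "\<And>w. w \<in> N \<Longrightarrow> real (card {i \<in> {..<n}. real p * (w \<bullet> y i)\<^sup>2 < a * (w \<bullet> w)}) \<le> real n / 8"
    and cov: "\<And>v. v \<in> carrier_vec p \<Longrightarrow> real p / real n * (\<Sum>i<n. (v \<bullet> y i)\<^sup>2) \<le> 2 * (v \<bullet> v)"
    and v: "v \<in> carrier_vec p"
  shows "3 / 4 * real n \<le> real (card {i \<in> {..<n}. a / 16 * (v \<bullet> v) \<le> real p * (v \<bullet> y i)\<^sup>2})"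
proof -
  have m0: "0 < real m" using m by simp
  have unit_case: "3 / 4 * real n \<le> real (card {i \<in> {..<n}. a / 16 \<le> real p * (v \<bullet> y i)\<^sup>2})"
    if v: "v \<in> carrier_vec p" "v \<bullet> v = 1" for v
  proof -
    obtain w where w: "w \<in> N" "w \<bullet> w \<le> 1" "(v - w) \<bullet> (v - w) \<le> (1 / real m)\<^sup>2" using net[OF v] by blast
    have wc: "w \<in> carrier_vec p" using w N by auto
    define d where "d = v - w"
    have dc: "d \<in> carrier_vec p" using v wc by (simp add: d_def)
    have nd: "vnorm d \<le> 1 / real m" unfolding d_def
      using w(3) m0 unfolding vnorm_def by (intro real_le_lsqrt) (auto simp: scalar_prod_nonneg)
    have nw: "3 / 4 \<le> vnorm w"
    proof -
      have "v \<bullet> v = w \<bullet> v + d \<bullet> v"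
        using minus_scalar_prod_distrib[OF v(1) wc v(1)] by (simp add: d_def)
      also have "\<dots> \<le> vnorm w * vnorm v + vnorm d * vnorm v"
        using scalar_prod_cauchy_schwarz[OF wc v(1)] scalar_prod_cauchy_schwarz[OF dc v(1)] by linarith
      finally have "1 \<le> vnorm w + vnorm d" using v(2) by (simp add: vnorm_def)
      moreover have "1 / real m \<le> 1 / 4" using m by (simp add: field_simps)
      ultimately show ?thesis using nd by linarith
    qed
    define J1 where "J1 = {i \<in> {..<n}. real p * (w \<bullet> y i)\<^sup>2 < a * (w \<bullet> w)}"
    \<comment> \<open>Markov's inequality over the indices: the average of
      \<open>p (d \<bullet> y i)^2\<close> is at most \<open>2 / m^2\<close>, one eighth of this
      threshold.\<close>
    define J2 where "J2 = {i \<in> {..<n}. 16 / (real m)\<^sup>2 < real p * (d \<bullet> y i)\<^sup>2}"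
    define J where "J = {i \<in> {..<n}. a / 16 \<le> real p * (v \<bullet> y i)\<^sup>2}"
    have fin: "finite J1" "finite J2" "finite J" by (auto simp: J1_def J2_def J_def)
    have J2c: "real (card J2) \<le> real n / 8"
    proof -
      have "real (card J2) * (16 / (real m)\<^sup>2) = (\<Sum>i\<in>J2. 16 / (real m)\<^sup>2)" by simp
      also have "\<dots> \<le> (\<Sum>i\<in>J2. real p * (d \<bullet> y i)\<^sup>2)" by (rule sum_mono) (auto simp: J2_def)
      also have "\<dots> \<le> (\<Sum>i<n. real p * (d \<bullet> y i)\<^sup>2)" by (rule sum_mono2) (auto simp: J2_def)
      also have "\<dots> = real n * (real p / real n * (\<Sum>i<n. (d \<bullet> y i)\<^sup>2))" using n by (simp add: sum_distrib_left)
      also have "\<dots> \<le> real n * (2 * (d \<bullet> d))" using cov[OF dc] by (intro mult_left_mono) auto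
      also have "\<dots> \<le> real n * (2 * (1 / real m)\<^sup>2)" using w(3) by (intro mult_left_mono) (auto simp: d_def)
      finally show ?thesis using m0 by (simp add: power_divide divide_simps)
    qed
    have "{..<n} \<subseteq> J1 \<union> J2 \<union> J"
    proof
      fix i assume i: "i \<in> {..<n}"
      show "i \<in> J1 \<union> J2 \<union> J"
      proof (rule ccontr)
        assume "i \<notin> J1 \<union> J2 \<union> J"
        then have 1: "a * (w \<bullet> w) \<le> real p * (w \<bullet> y i)\<^sup>2" and 2: "real p * (d \<bullet> y i)\<^sup>2 \<le> 16 / (real m)\<^sup>2"
          and 3: "real p * (v \<bullet> y i)\<^sup>2 < a / 16" using i by (auto simp: J1_def J2_def J_def)
        define s where "s = sqrt (real p)"
        have s: "s\<^sup>2 = real p" "0 \<le> s" by (auto simp: s_def)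
        have yc: "y i \<in> carrier_vec p" using y i by simp
        have vd: "v \<bullet> y i = w \<bullet> y i + d \<bullet> y i"
          using minus_scalar_prod_distrib[OF v(1) wc yc] by (simp add: d_def)
        have sq: "(3 / 4 * sqrt a)\<^sup>2 \<le> (s * (w \<bullet> y i))\<^sup>2"
        proof -
          have "(3 / 4)\<^sup>2 \<le> (vnorm w)\<^sup>2" using nw by (intro power_mono) auto
          then have "a * (3 / 4)\<^sup>2 \<le> a * (w \<bullet> w)" unfolding vnorm_sq using a by (intro mult_left_mono) auto
          moreover have "(3 / 4 * sqrt a)\<^sup>2 = a * (3 / 4)\<^sup>2"
            by (simp only: power_mult_distrib real_sqrt_pow2[OF less_imp_le[OF a]] mult.commute)
          moreover have "(s * (w \<bullet> y i))\<^sup>2 = real p * (w \<bullet> y i)\<^sup>2" by (simp only: power_mult_distrib s)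
          ultimately show ?thesis using 1 by linarith
        qed
        have "3 / 4 * sqrt a \<le> \<bar>s * (w \<bullet> y i)\<bar>" 
        proof -
          have "\<bar>3 / 4 * sqrt a\<bar> \<le> \<bar>s * (w \<bullet> y i)\<bar>" using sq by (simp only: abs_le_square_iff)
          then show ?thesis using a by simp
        qed
        moreover have "\<bar>s * (d \<bullet> y i)\<bar> \<le> sqrt a / 2"
        proof -
          have "(s * (d \<bullet> y i))\<^sup>2 \<le> (4 / real m)\<^sup>2" using 2 by (simp add: power_mult_distrib s power_divide)
          then have "\<bar>s * (d \<bullet> y i)\<bar> \<le> \<bar>4 / real m\<bar>" by (simp only: abs_le_square_iff)
          also have "\<dots> \<le> sqrt a / 2" using ma m0 by (simp add: field_simps)
          finally show ?thesis .
        qed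
        moreover have "s * (v \<bullet> y i) = s * (w \<bullet> y i) + s * (d \<bullet> y i)" unfolding vd by (simp add: algebra_simps)
        ultimately have "sqrt a / 4 \<le> \<bar>s * (v \<bullet> y i)\<bar>" by linarith
        then have "(sqrt a / 4)\<^sup>2 \<le> \<bar>s * (v \<bullet> y i)\<bar>\<^sup>2" using a by (intro power_mono) auto
        then have "a / 16 \<le> real p * (v \<bullet> y i)\<^sup>2" using a by (simp add: power_mult_distrib power_divide s)
        then show False using 3 by simp
      qed
    qed
    then have "card {..<n} \<le> card (J1 \<union> J2 \<union> J)" using fin by (intro card_mono) auto
    also have "\<dots> \<le> card J1 + card J2 + card J"
      using card_Un_le[of "J1 \<union> J2" J] card_Un_le[of J1 J2] by linarith
    finally have "real n \<le> real (card J1) + real (card J2) + real (card J)" by simp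
    moreover have "real (card J1) \<le> real n / 8" unfolding J1_def by (rule spread[OF w(1)])
    ultimately show ?thesis using J2c unfolding J_def by linarith
  qed
  show ?thesis
  proof (cases "v = 0\<^sub>v p")
    case True
    have "{i \<in> {..<n}. a / 16 * (v \<bullet> v) \<le> real p * (v \<bullet> y i)\<^sup>2} = {..<n}" using True by auto
    then show ?thesis by simp
  next
    case False
    let ?u = "(1 / vnorm v) \<cdot>\<^sub>v v"
    have nv: "0 < vnorm v" by (rule vnorm_pos[OF v False])
    have "3 / 4 * real n \<le> real (card {i \<in> {..<n}. a / 16 \<le> real p * (?u \<bullet> y i)\<^sup>2})"
      by (rule unit_case) (use v normalized_bil(2)[OF one_carrier_mat v False] in auto)
    also have "{i \<in> {..<n}. a / 16 \<le> real p * (?u \<bullet> y i)\<^sup>2} = {i \<in> {..<n}. a / 16 * (v \<bullet> v) \<le> real p * (v \<bullet> y i)\<^sup>2}"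
    proof (rule Collect_cong, rule conj_cong[OF refl])
      fix i assume "i \<in> {..<n}"
      then have "?u \<bullet> y i = (v \<bullet> y i) / vnorm v" using y v by simp
      then show "a / 16 \<le> real p * (?u \<bullet> y i)\<^sup>2 \<longleftrightarrow> a / 16 * (v \<bullet> v) \<le> real p * (v \<bullet> y i)\<^sup>2"
        unfolding vnorm_sq[symmetric] using nv by (simp add: power_divide le_divide_eq)
    qed
    finally show ?thesis .
  qed
qed

section \<open>Tail bounds for a fixed direction\<close>

text \<open>For \<open>x = u B v\<close> with \<open>B\<close> the square root of \<open>S\<close>,
  \<open>v\<close> a unit vector and \<open>u\<close> nonzero, this is \<open>v\<close> up to the
  sign of \<open>u\<close>. Squared inner products do not see the sign.\<close>

definition whiten :: "real mat \<Rightarrow> real vec \<Rightarrow> real vec" where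
  "whiten S x = (1 / vnorm (mat_inv (mat_sqrt S) *\<^sub>v x)) \<cdot>\<^sub>v (mat_inv (mat_sqrt S) *\<^sub>v x)"

definition dirstat :: "nat \<Rightarrow> real mat \<Rightarrow> real vec \<Rightarrow> real vec \<Rightarrow> real" where
  "dirstat p S e x = real p * (e \<bullet> whiten S x)\<^sup>2"

context
  fixes p :: nat and S :: "real mat"
  assumes p: "1 \<le> p" and S: "pos_def p S"
begin

lemma sqrt_inv_facts:
  "mat_sqrt S \<in> carrier_mat p p" "mat_inv (mat_sqrt S) \<in> carrier_mat p p"
  "mat_sqrt S * mat_inv (mat_sqrt S) = 1\<^sub>m p" "mat_inv (mat_sqrt S) * mat_sqrt S = 1\<^sub>m p"
  using mat_sqrt(1)[OF p S] pos_def_inverse[OF mat_sqrt(1)[OF p S]] by (auto simp: pos_def_def)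

lemma inv_sqrt_carrier: "x \<in> carrier_vec p \<Longrightarrow> mat_inv (mat_sqrt S) *\<^sub>v x \<in> carrier_vec p"
  by (rule mult_mat_vec_carrier[OF sqrt_inv_facts(2)])

lemma inv_sqrt_sqrt: "v \<in> carrier_vec p \<Longrightarrow> mat_inv (mat_sqrt S) *\<^sub>v (mat_sqrt S *\<^sub>v v) = v"
  using assoc_mult_mat_vec[OF sqrt_inv_facts(2,1)] sqrt_inv_facts(4) by simp

lemma sqrt_inv_sqrt: "v \<in> carrier_vec p \<Longrightarrow> mat_sqrt S *\<^sub>v (mat_inv (mat_sqrt S) *\<^sub>v v) = v"
  using assoc_mult_mat_vec[OF sqrt_inv_facts(1,2)] sqrt_inv_facts(3) by simp

lemma inv_sqrt_nonzero:
  assumes "x \<in> carrier_vec p" "x \<noteq> 0\<^sub>v p" shows "mat_inv (mat_sqrt S) *\<^sub>v x \<noteq> 0\<^sub>v p"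
  using sqrt_inv_sqrt[OF assms(1)] assms(2) mult_mat_zero_vec[OF sqrt_inv_facts(1)] by metis

lemma whiten_carrier: "x \<in> carrier_vec p \<Longrightarrow> whiten S x \<in> carrier_vec p"
  using inv_sqrt_carrier by (simp add: whiten_def)

lemma whiten_unit:
  assumes "x \<in> carrier_vec p" "x \<noteq> 0\<^sub>v p" shows "whiten S x \<bullet> whiten S x = 1"
  unfolding whiten_def
  by (rule normalized_bil(2)[OF one_carrier_mat inv_sqrt_carrier[OF assms(1)] inv_sqrt_nonzero[OF assms]])

lemma whiten_inverse:
  assumes "x \<in> carrier_vec p" "x \<noteq> 0\<^sub>v p"
  shows "x = vnorm (mat_inv (mat_sqrt S) *\<^sub>v x) \<cdot>\<^sub>v (mat_sqrt S *\<^sub>v whiten S x)" "vnorm (mat_inv (mat_sqrt S) *\<^sub>v x) \<noteq> 0"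
proof -
  let ?c = "vnorm (mat_inv (mat_sqrt S) *\<^sub>v x)"
  show c: "?c \<noteq> 0" using vnorm_pos[OF inv_sqrt_carrier[OF assms(1)] inv_sqrt_nonzero[OF assms]] by simp
  have "mat_sqrt S *\<^sub>v whiten S x = (1 / ?c) \<cdot>\<^sub>v x"
    unfolding whiten_def mult_mat_vec[OF sqrt_inv_facts(1) inv_sqrt_carrier[OF assms(1)]] sqrt_inv_sqrt[OF assms(1)] ..
  then show "x = ?c \<cdot>\<^sub>v (mat_sqrt S *\<^sub>v whiten S x)" using c by (simp add: smult_smult_assoc)
qed

lemma dirstat_formula:
  assumes e: "e \<in> carrier_vec p" and x: "x \<in> carrier_vec p"
  shows "dirstat p S e x = real p * (e \<bullet> (mat_inv (mat_sqrt S) *\<^sub>v x))\<^sup>2 /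
    ((mat_inv (mat_sqrt S) *\<^sub>v x) \<bullet> (mat_inv (mat_sqrt S) *\<^sub>v x))"
  using inv_sqrt_carrier[OF x] e
  by (simp add: dirstat_def whiten_def power_divide vnorm_sq)

lemma dirstat_hom:
  assumes e: "e \<in> carrier_vec p" and x: "x \<in> carrier_vec p" and c: "c \<noteq> 0"
  shows "dirstat p S e (c \<cdot>\<^sub>v x) = dirstat p S e x"
proof -
  have cx: "c \<cdot>\<^sub>v x \<in> carrier_vec p" using x by simp
  show ?thesis
    unfolding dirstat_formula[OF e x] dirstat_formula[OF e cx] mult_mat_vec[OF sqrt_inv_facts(2) x]
    using inv_sqrt_carrier[OF x] e c by (simp add: power2_eq_square)
qed

lemma dirstat_nonneg: "0 \<le> dirstat p S e x"
  by (simp add: dirstat_def)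

lemma dirstat_le:
  assumes e: "e \<in> carrier_vec p" "e \<bullet> e = 1" and x: "x \<in> carrier_vec p"
  shows "dirstat p S e x \<le> real p"
proof -
  let ?z = "mat_inv (mat_sqrt S) *\<^sub>v x"
  have "\<bar>e \<bullet> ?z\<bar> \<le> vnorm ?z" using scalar_prod_cauchy_schwarz[OF e(1) inv_sqrt_carrier[OF x]] e(2) by (simp add: vnorm_def)
  then have "(e \<bullet> ?z)\<^sup>2 \<le> ?z \<bullet> ?z" unfolding vnorm_sq[symmetric] by (metis abs_le_square_iff abs_of_nonneg vnorm_nonneg)
  then show ?thesis unfolding dirstat_formula[OF e(1) x] using scalar_prod_nonneg[of ?z]
    by (cases "?z \<bullet> ?z = 0") (auto simp: divide_le_eq mult_left_mono)
qed

lemma dirstat_measurable: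
  assumes e: "e \<in> carrier_vec p"
  shows "dirstat p S e \<in> borel_measurable (borel_vec p)"
proof -
  have z: "(\<lambda>x. mat_inv (mat_sqrt S) *\<^sub>v x) \<in> borel_vec p \<rightarrow>\<^sub>M borel_vec p"
    by (intro mult_mat_vec_borel_vec sqrt_inv_facts(2) measurable_ident_sets refl)
  have "(\<lambda>x. real p * (e \<bullet> (mat_inv (mat_sqrt S) *\<^sub>v x))\<^sup>2 /
    ((mat_inv (mat_sqrt S) *\<^sub>v x) \<bullet> (mat_inv (mat_sqrt S) *\<^sub>v x))) \<in> borel_measurable (borel_vec p)"
    by (intro borel_measurable_divide borel_measurable_times borel_measurable_power borel_measurable_const
        scalar_prod_borel_vec[OF z z] scalar_prod_borel_vec[OF const_borel_vec[OF e] z])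
  then show ?thesis by (subst measurable_cong[OF dirstat_formula[OF e]]) auto
qed

lemma dirstat_gauss:
  assumes e: "e \<in> carrier_vec p"
  shows "dirstat p S e (mat_sqrt S *\<^sub>v vec p x) = dirsq p (\<lambda>i. e $ i) x"
proof -
  have "mat_sqrt S *\<^sub>v vec p x \<in> carrier_vec p" by (rule mult_mat_vec_carrier[OF sqrt_inv_facts(1)]) simp
  moreover have "e \<bullet> vec p x = (\<Sum>i<p. e $ i * x i)" by (simp add: scalar_prod_def lessThan_atLeast0)
  ultimately show ?thesis by (simp add: dirstat_formula[OF e] inv_sqrt_sqrt vec_scalar_prod dirsq_def)
qed

text \<open>The statistic is invariant under nonzero scaling, so its law is the same for all shape
  matrices and all laws of \<open>u\<close>: that of \<open>dirsq\<close> under the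
  Gaussian.\<close>

lemma dirstat_law:
  assumes D: "centered_elliptical p S D" and e: "e \<in> carrier_vec p" "e \<bullet> e = 1"
    and F: "F \<in> borel_measurable borel" and bd: "\<And>t. 0 \<le> t \<Longrightarrow> t \<le> real p \<Longrightarrow> F t \<le> ennreal K"
  shows "(\<integral>\<^sup>+x. F (dirstat p S e x) \<partial>D) = (\<integral>\<^sup>+x. F (dirsq p (\<lambda>i. e $ i) x) \<partial>gaussP p)"
proof -
  have "(\<integral>\<^sup>+x. F (dirstat p S e x) \<partial>D) = (\<integral>\<^sup>+x. F (dirstat p S e (mat_sqrt S *\<^sub>v vec p x)) \<partial>gaussP p)"
  proof (rule elliptical_nn_integral[OF p D, where K = K])
    show "(\<lambda>x. F (dirstat p S e x)) \<in> borel_measurable (borel_vec p)"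
      by (rule measurable_compose[OF dirstat_measurable[OF e(1)] F])
  qed (use e dirstat_nonneg dirstat_le dirstat_hom bd in auto)
  then show ?thesis by (simp add: dirstat_gauss[OF e(1)])
qed

text \<open>The indicator of the zero vector is itself invariant under nonzero scalars, so the
  transfer to the Gaussian applies to it.\<close>

lemma elliptical_nonzero:
  assumes D: "centered_elliptical p S D"
  shows "AE x in D. x \<noteq> 0\<^sub>v p"
proof -
  have "emeasure D {0\<^sub>v p} = (\<integral>\<^sup>+x. indicator {0\<^sub>v p} x \<partial>D)"
    using zero_vec_sets elliptical_sets[OF D] by simp
  also have "\<dots> = (\<integral>\<^sup>+x. indicator {0\<^sub>v p} (mat_sqrt S *\<^sub>v vec p x) \<partial>gaussP p)"
  proof (rule elliptical_nn_integral[OF p D, where K = 1])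
    show "indicator {0\<^sub>v p} \<in> borel_measurable (borel_vec p)" using zero_vec_sets by simp
    fix c :: real and v :: "real vec" assume c: "c \<noteq> 0" and v: "v \<in> carrier_vec p"
    have "c \<cdot>\<^sub>v v = 0\<^sub>v p \<longleftrightarrow> v = 0\<^sub>v p" using vnorm_eq_0_iff[of v p] vnorm_eq_0_iff[of "c \<cdot>\<^sub>v v" p] v c by (simp add: vnorm_smult)
    then show "(indicator {0\<^sub>v p} (c \<cdot>\<^sub>v v) :: ennreal) = indicator {0\<^sub>v p} v" by (simp add: indicator_def)
  qed (auto simp: indicator_def)
  also have "\<dots> = (\<integral>\<^sup>+x. indicator {0} (sumsq p x) \<partial>gaussP p)"
  proof (rule nn_integral_cong)
    fix x
    have "mat_sqrt S *\<^sub>v vec p x = 0\<^sub>v p \<longleftrightarrow> vec p x = 0\<^sub>v p"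
      using inv_sqrt_sqrt[of "vec p x"] mult_mat_zero_vec[OF sqrt_inv_facts(2)] mult_mat_zero_vec[OF sqrt_inv_facts(1)] by force
    also have "\<dots> \<longleftrightarrow> sumsq p x = 0" using vec_scalar_prod[of p x] scalar_prod_eq_0[of "vec p x" p] by auto
    finally show "indicator {0\<^sub>v p} (mat_sqrt S *\<^sub>v vec p x) = (indicator {0} (sumsq p x) :: ennreal)" by (simp add: indicator_def)
  qed
  also have "\<dots> = (\<integral>\<^sup>+x. indicator {0} (sumsq p x) * ennreal (gauss_radial p (sumsq p x)) \<partial>lebP p)"
    by (rule nn_integral_gaussP) measurable
  also have "\<dots> = (\<integral>\<^sup>+x. 0 \<partial>lebP p)"
    using AE_sumsq_pos[OF p] by (intro nn_integral_cong_AE) (auto elim!: eventually_mono)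
  finally have "emeasure D {0\<^sub>v p} = 0" by simp
  then have "{0\<^sub>v p} \<in> null_sets D" using zero_vec_sets elliptical_sets[OF D] by auto
  then show ?thesis by (rule AE_I') auto
qed

end

text \<open>Markov's inequality for a product whose mean factors over the independent samples; the
  three tail bounds are instances with exponential \<open>h\<close>.\<close>

lemma product_chernoff:
  assumes D: "prob_space D" and h[measurable]: "h \<in> borel_measurable D" and A: "(\<integral>\<^sup>+x. h x \<partial>D) \<le> ennreal A" "0 \<le> A" and t: "0 < t"
  shows "emeasure (\<Pi>\<^sub>M i\<in>{..<n}. D) {x \<in> space (\<Pi>\<^sub>M i\<in>{..<n}. D). ennreal t \<le> (\<Prod>i<n. h (x i))} \<le> ennreal (A ^ n / t)"
proof -
  interpret product_sigma_finite "\<lambda>_ :: nat. D"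
    by (intro product_sigma_finite.intro prob_space_imp_sigma_finite D)
  let ?Q = "\<Pi>\<^sub>M i\<in>{..<n}. D" and ?g = "\<lambda>x. \<Prod>i<n. h (x i)"
  have g[measurable]: "?g \<in> borel_measurable ?Q" by measurable
  have "{x \<in> space ?Q. ennreal t \<le> ?g x} \<subseteq> {x \<in> space ?Q. 1 \<le> ennreal (1 / t) * ?g x}"
  proof
    fix x assume x: "x \<in> {x \<in> space ?Q. ennreal t \<le> ?g x}"
    have "1 = ennreal (1 / t) * ennreal t" using t by (simp add: ennreal_mult'[symmetric])
    also have "\<dots> \<le> ennreal (1 / t) * ?g x" using x by (intro mult_left_mono) auto
    finally show "x \<in> {x \<in> space ?Q. 1 \<le> ennreal (1 / t) * ?g x}" using x by simp
  qed
  then have "emeasure ?Q {x \<in> space ?Q. ennreal t \<le> ?g x} \<le> emeasure ?Q {x \<in> space ?Q. 1 \<le> ennreal (1 / t) * ?g x}"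
    by (intro emeasure_mono) auto
  also have "\<dots> \<le> ennreal (1 / t) * (\<integral>\<^sup>+x. ?g x * indicator (space ?Q) x \<partial>?Q)"
    using nn_integral_Markov_inequality[where A = "space ?Q" and M = ?Q and u = ?g and c = "ennreal (1 / t)"] by simp
  also have "(\<integral>\<^sup>+x. ?g x * indicator (space ?Q) x \<partial>?Q) = (\<integral>\<^sup>+x. ?g x \<partial>?Q)" by (intro nn_integral_cong) simp
  also have "\<dots> = (\<Prod>i<n. \<integral>\<^sup>+x. h x \<partial>D)" by (rule product_nn_integral_prod) auto
  also have "\<dots> \<le> ennreal A ^ n"
  proof (induction n)
    case (Suc n)
    then show ?case using A(1) by (simp add: mult_mono)
  qed simp
  also have "\<dots> = ennreal (A ^ n)" using A by (simp add: ennreal_power)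
  also have "ennreal (1 / t) * ennreal (A ^ n) = ennreal (A ^ n / t)" using t A by (simp add: ennreal_mult'[symmetric])
  finally show ?thesis by (simp add: mult_left_mono)
qed

lemma prod_ennreal_exp: fixes n :: nat shows "(\<Prod>i<n. ennreal (exp (f i))) = ennreal (exp (\<Sum>i<n. f i))"
  unfolding exp_sum[OF finite_lessThan] by (rule prod_ennreal) simp

context
  fixes p :: nat and S :: "real mat" and D :: "real vec measure" and e :: "real vec"
  assumes p: "1 \<le> p" and D: "centered_elliptical p S D" and e: "e \<in> carrier_vec p" "e \<bullet> e = 1"
begin

lemma shape_pos_def: "pos_def p S"
  using D by (simp add: centered_elliptical_def)

lemma unit_sumsq: "(\<Sum>i<p. (e $ i)\<^sup>2) = 1"
  using e by (simp add: scalar_prod_def power2_eq_square lessThan_atLeast0)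

lemma dirstat_measurable_D [measurable]: "dirstat p S e \<in> borel_measurable D"
  using dirstat_measurable[OF p shape_pos_def e(1)] by (simp add: measurable_cong_sets[OF elliptical_sets[OF D] refl])

lemma upper_tail:
  assumes t: "0 < t" "t \<le> 4"
  shows "emeasure (\<Pi>\<^sub>M i\<in>{..<n}. D) {x \<in> space (\<Pi>\<^sub>M i\<in>{..<n}. D). real n * (1 + t) \<le> (\<Sum>i<n. dirstat p S e (x i))}
    \<le> ennreal (exp (- (real n * t\<^sup>2 / 32)))"
proof -
  \<comment> \<open>Minimises \<open>8 l^2 - l t\<close>, with value \<open>- t^2 / 32\<close>; the
    condition \<open>t <= 4\<close> becomes the range \<open>l <= 1/4\<close> of the exponential
    moment bound.\<close>
  define l where "l = t / 16"
  have l: "0 < l" "l \<le> 1 / 4" using t by (auto simp: l_def)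
  have law: "(\<integral>\<^sup>+x. ennreal (exp (l * dirstat p S e x)) \<partial>D) \<le> ennreal (exp (l + 8 * l\<^sup>2))"
  proof -
    have "(\<integral>\<^sup>+x. ennreal (exp (l * dirstat p S e x)) \<partial>D) = (\<integral>\<^sup>+x. ennreal (exp (l * dirsq p (\<lambda>i. e $ i) x)) \<partial>gaussP p)"
      using l by (intro dirstat_law[OF p shape_pos_def D e, where F = "\<lambda>t. ennreal (exp (l * t))" and K = "exp (l * real p)"]) (auto intro!: ennreal_leI)
    then show ?thesis using dirsq_mgf[OF p unit_sumsq, of l] l by simp
  qed
  have "{x \<in> space (\<Pi>\<^sub>M i\<in>{..<n}. D). real n * (1 + t) \<le> (\<Sum>i<n. dirstat p S e (x i))} =
    {x \<in> space (\<Pi>\<^sub>M i\<in>{..<n}. D). ennreal (exp (l * (real n * (1 + t)))) \<le> (\<Prod>i<n. ennreal (exp (l * dirstat p S e (x i))))}"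
    unfolding prod_ennreal_exp using l by (auto simp: sum_distrib_left[symmetric])
  also have "emeasure (\<Pi>\<^sub>M i\<in>{..<n}. D) \<dots> \<le> ennreal (exp (l + 8 * l\<^sup>2) ^ n / exp (l * (real n * (1 + t))))"
    by (rule product_chernoff[OF elliptical_prob[OF p D] _ law]) auto
  also have "exp (l + 8 * l\<^sup>2) ^ n / exp (l * (real n * (1 + t))) = exp (- (real n * t\<^sup>2 / 32))"
    by (simp add: exp_of_nat_mult[symmetric] exp_diff[symmetric] l_def power2_eq_square field_simps)
  finally show ?thesis .
qed

lemma lower_tail:
  assumes t: "0 < t"
  shows "emeasure (\<Pi>\<^sub>M i\<in>{..<n}. D) {x \<in> space (\<Pi>\<^sub>M i\<in>{..<n}. D). (\<Sum>i<n. dirstat p S e (x i)) \<le> real n * (1 - t)}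
    \<le> ennreal (exp (- (real n * t\<^sup>2 / 32)))"
proof -
  define l where "l = t / 16"
  have l: "0 < l" using t by (auto simp: l_def)
  have law: "(\<integral>\<^sup>+x. ennreal (exp (- (l * dirstat p S e x))) \<partial>D) \<le> ennreal (exp (- l + 8 * l\<^sup>2))"
  proof -
    have "(\<integral>\<^sup>+x. ennreal (exp (- (l * dirstat p S e x))) \<partial>D) = (\<integral>\<^sup>+x. ennreal (exp (- (l * dirsq p (\<lambda>i. e $ i) x))) \<partial>gaussP p)"
      using l by (intro dirstat_law[OF p shape_pos_def D e, where F = "\<lambda>t. ennreal (exp (- (l * t)))" and K = 1]) auto
    then show ?thesis using dirsq_mgf_neg[OF p unit_sumsq, of l] l by simp
  qed
  have "{x \<in> space (\<Pi>\<^sub>M i\<in>{..<n}. D). (\<Sum>i<n. dirstat p S e (x i)) \<le> real n * (1 - t)} =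
    {x \<in> space (\<Pi>\<^sub>M i\<in>{..<n}. D). ennreal (exp (- (l * (real n * (1 - t))))) \<le> (\<Prod>i<n. ennreal (exp (- (l * dirstat p S e (x i)))))}"
    unfolding prod_ennreal_exp using l by (auto simp: sum_distrib_left[symmetric] sum_negf)
  also have "emeasure (\<Pi>\<^sub>M i\<in>{..<n}. D) \<dots> \<le> ennreal (exp (- l + 8 * l\<^sup>2) ^ n / exp (- (l * (real n * (1 - t)))))"
    by (rule product_chernoff[OF elliptical_prob[OF p D] _ law]) auto
  also have "exp (- l + 8 * l\<^sup>2) ^ n / exp (- (l * (real n * (1 - t)))) = exp (- (real n * t\<^sup>2 / 32))"
    by (simp add: exp_of_nat_mult[symmetric] exp_diff[symmetric] l_def power2_eq_square field_simps)
  finally show ?thesis .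
qed

text \<open>Weight \<open>exp 16\<close> on an event of probability at most
  \<open>exp (- 16)\<close>, and weight one elsewhere, has mean at most \<open>2 <= exp 1\<close>,
  while \<open>n / 8\<close> occurrences produce a product of at least
  \<open>exp (2 n)\<close>.\<close>

lemma count_tail:
  assumes a: "emeasure (gaussP p) {x \<in> space (gaussP p). dirsq p (\<lambda>i. e $ i) x < a} \<le> ennreal (exp (- 16))"
  shows "emeasure (\<Pi>\<^sub>M i\<in>{..<n}. D) {x \<in> space (\<Pi>\<^sub>M i\<in>{..<n}. D). real n / 8 \<le> real (card {i \<in> {..<n}. dirstat p S e (x i) < a})}
    \<le> ennreal (exp (- real n))"
proof -
  define F where "F t = ennreal (exp (if t < a then 16 else 0))" for t :: real
  have Fm: "F \<in> borel_measurable borel" unfolding F_def by measurable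
  have law: "(\<integral>\<^sup>+x. F (dirstat p S e x) \<partial>D) \<le> ennreal (exp 1)"
  proof -
    have "(\<integral>\<^sup>+x. F (dirstat p S e x) \<partial>D) = (\<integral>\<^sup>+x. F (dirsq p (\<lambda>i. e $ i) x) \<partial>gaussP p)"
      by (rule dirstat_law[OF p shape_pos_def D e Fm, where K = "exp 16"]) (auto simp: F_def)
    also have "\<dots> \<le> (\<integral>\<^sup>+x. 1 + ennreal (exp 16) * indicator {x \<in> space (gaussP p). dirsq p (\<lambda>i. e $ i) x < a} x \<partial>gaussP p)"
      by (intro nn_integral_mono) (auto simp: F_def indicator_def)
    also have "\<dots> = 1 + ennreal (exp 16) * emeasure (gaussP p) {x \<in> space (gaussP p). dirsq p (\<lambda>i. e $ i) x < a}"
      using prob_space.emeasure_space_1[OF prob_space_gaussP[of p]]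
      by (subst nn_integral_add) (auto simp: nn_integral_cmult)
    also have "\<dots> \<le> 1 + ennreal (exp 16) * ennreal (exp (- 16))" by (intro add_left_mono mult_left_mono a) simp
    also have "\<dots> = ennreal (1 + 1)" by (simp add: ennreal_mult'[symmetric] exp_add[symmetric])
    also have "\<dots> \<le> ennreal (exp 1)" using exp_ge_add_one_self[of 1] by (intro ennreal_leI) simp
    finally show ?thesis .
  qed
  have cs: "(\<Sum>i<n. if P i then 16 else 0 :: real) = 16 * real (card {i \<in> {..<n}. P i})" for P
    by (simp add: sum.If_cases Int_def)
  have "{x \<in> space (\<Pi>\<^sub>M i\<in>{..<n}. D). real n / 8 \<le> real (card {i \<in> {..<n}. dirstat p S e (x i) < a})} =
    {x \<in> space (\<Pi>\<^sub>M i\<in>{..<n}. D). ennreal (exp (2 * real n)) \<le> (\<Prod>i<n. F (dirstat p S e (x i)))}"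
    unfolding F_def prod_ennreal_exp cs by auto
  also have "emeasure (\<Pi>\<^sub>M i\<in>{..<n}. D) \<dots> \<le> ennreal (exp 1 ^ n / exp (2 * real n))"
    by (rule product_chernoff[OF elliptical_prob[OF p D] measurable_compose[OF dirstat_measurable_D Fm] law]) auto
  also have "exp 1 ^ n / exp (2 * real n) = exp (- real n)"
    by (simp add: exp_of_nat_mult[symmetric] exp_diff[symmetric])
  finally show ?thesis .
qed

end

section \<open>Measurability of the event\<close>

text \<open>Compactness makes the quantifier countable: since \<open>|F x|\<close> attains its
  minimum, a zero in \<open>K\<close> exists exactly when the values on a countable dense subset
  come arbitrarily close to zero.\<close>

lemma measurable_exists_compact:
  fixes F :: "'x \<Rightarrow> 'b :: {metric_space, second_countable_topology} \<Rightarrow> real"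
  assumes K: "compact K" and cont: "\<And>x. x \<in> space M \<Longrightarrow> continuous_on K (F x)"
    and meas: "\<And>\<theta>. \<theta> \<in> K \<Longrightarrow> (\<lambda>x. F x \<theta>) \<in> borel_measurable M"
  shows "{x \<in> space M. \<exists>\<theta>\<in>K. F x \<theta> = 0} \<in> sets M"
proof -
  obtain C where C: "countable C" "C \<subseteq> K" "K \<subseteq> closure C" using separable by metis
  have "{x \<in> space M. \<exists>\<theta>\<in>K. F x \<theta> = 0} = {x \<in> space M. \<forall>k :: nat. \<exists>c\<in>C. \<bar>F x c\<bar> < 1 / real (Suc k)}"
  proof (intro Collect_cong conj_cong refl iffI allI)
    fix x k assume x: "x \<in> space M" and ex: "\<exists>\<theta>\<in>K. F x \<theta> = 0"
    then obtain \<theta> where \<theta>: "\<theta> \<in> K" "F x \<theta> = 0" by auto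
    have "\<exists>d>0. \<forall>y\<in>K. dist y \<theta> < d \<longrightarrow> dist (F x y) (F x \<theta>) < 1 / real (Suc k)"
      by (rule cont[OF x, unfolded continuous_on_iff, rule_format, OF \<theta>(1)]) simp
    then obtain d where d: "0 < d" "\<And>y. y \<in> K \<Longrightarrow> dist y \<theta> < d \<Longrightarrow> dist (F x y) (F x \<theta>) < 1 / real (Suc k)" by auto
    obtain c where c: "c \<in> C" "dist c \<theta> < d" using \<theta>(1) C(3) d(1) by (metis closure_approachable subsetD)
    then show "\<exists>c\<in>C. \<bar>F x c\<bar> < 1 / real (Suc k)" using d(2)[of c] C(2) \<theta>(2) by (auto simp: dist_real_def)
  next
    fix x assume x: "x \<in> space M" and all: "\<forall>k :: nat. \<exists>c\<in>C. \<bar>F x c\<bar> < 1 / real (Suc k)"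
    then have ne: "K \<noteq> {}" using C(2) by blast
    obtain \<theta> where \<theta>: "\<theta> \<in> K" "\<And>y. y \<in> K \<Longrightarrow> \<bar>F x \<theta>\<bar> \<le> \<bar>F x y\<bar>"
      using continuous_attains_inf[OF K ne continuous_on_rabs[OF cont[OF x]]] by auto
    have "\<bar>F x \<theta>\<bar> < 1 / real (Suc k)" for k using all \<theta>(2) C(2) by (meson le_less_trans subsetD)
    moreover have "\<exists>k. 1 / real (Suc k) < \<bar>F x \<theta>\<bar>" if "0 < \<bar>F x \<theta>\<bar>" using that by (rule nat_approx_posE) blast
    ultimately have "\<bar>F x \<theta>\<bar> \<le> 0" by (meson linorder_not_less order_less_asym)
    then show "\<exists>\<theta>\<in>K. F x \<theta> = 0" using \<theta>(1) by auto
  qed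
  also have "\<dots> \<in> sets M"
  proof -
    have "{x \<in> space M. \<bar>F x c\<bar> < 1 / real (Suc k)} \<in> sets M" if "c \<in> C" for c k
    proof -
      have [measurable]: "(\<lambda>x. F x c) \<in> borel_measurable M" using meas C(2) that by auto
      show ?thesis by measurable
    qed
    then have "(\<Inter>k :: nat. \<Union>c\<in>C. {x \<in> space M. \<bar>F x c\<bar> < 1 / real (Suc k)}) \<in> sets M"
      using C(1) by (intro sets.countable_INT sets.countable_UN') auto
    moreover have "{x \<in> space M. \<forall>k :: nat. \<exists>c\<in>C. \<bar>F x c\<bar> < 1 / real (Suc k)} = (\<Inter>k :: nat. \<Union>c\<in>C. {x \<in> space M. \<bar>F x c\<bar> < 1 / real (Suc k)})"
      by auto
    ultimately show ?thesis by simp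
  qed
  finally show ?thesis .
qed

lemma compact_box_fun:
  fixes B :: "'i \<Rightarrow> real set"
  assumes "\<And>i. compact (B i)"
  shows "compact (Pi\<^sub>E UNIV B)"
proof -
  have "compactin (product_topology (\<lambda>_. euclidean) UNIV) (Pi\<^sub>E UNIV B)"
    using assms by (subst compactin_PiE) auto
  then show ?thesis by (simp add: euclidean_product_topology)
qed

text \<open>Slots \<open>k\<close> and \<open>k + 1\<close> of a parameter hold a candidate \<open>T\<close> and its inverse; keeping both makes
  every condition continuous.\<close>
type_synonym param = "nat \<times> nat \<times> nat \<Rightarrow> real"

definition pmat :: "nat \<Rightarrow> nat \<Rightarrow> param \<Rightarrow> real mat" where
  "pmat p k \<theta> = mat p p (\<lambda>(a, b). \<theta> (k, a, b))"

text \<open>The four blocks hold two candidate solutions with their inverses, as failure of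
  uniqueness involves a pair. All other coordinates are pinned to zero, which makes the box compact
  in the full function space.\<close>

definition pbox :: "nat \<Rightarrow> nat \<Rightarrow> param set" where
  "pbox p j = Pi\<^sub>E UNIV (\<lambda>(k, a, b). if k < 4 \<and> a < p \<and> b < p then {- real j..real j} else {0})"

text \<open>Nonnegativity of the form in place of positivity keeps the set closed; definiteness
  returns through the stored inverse in slot \<open>k + 1\<close>.\<close>

definition pvalid :: "nat \<Rightarrow> nat \<Rightarrow> param set" where
  "pvalid p k = {\<theta>. sym_mat p (pmat p k \<theta>) \<and> pmat p k \<theta> * pmat p (Suc k) \<theta> = 1\<^sub>m p \<and>
     mat_trace (pmat p k \<theta>) = real p \<and> (\<forall>v \<in> carrier_vec p. 0 \<le> bil (pmat p k \<theta>) v v)}"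

lemma pmat_carrier [simp]: "pmat p k \<theta> \<in> carrier_mat p p"
  by (simp add: pmat_def)

lemma compact_pbox: "compact (pbox p j)"
  unfolding pbox_def by (rule compact_box_fun) (auto split: prod.split)

lemma pbox_mono: "i \<le> j \<Longrightarrow> pbox p i \<subseteq> pbox p j"
  unfolding pbox_def by (rule PiE_mono) (auto split: prod.split)

lemma continuous_coord [continuous_intros]: "continuous_on A (\<lambda>\<theta> :: param. \<theta> c)"
  by (rule continuous_on_subset[OF continuous_on_product_coordinates]) simp

lemma continuous_bil_pmat:
  assumes "u \<in> carrier_vec p" "v \<in> carrier_vec p"
  shows "continuous_on A (\<lambda>\<theta>. bil (pmat p k \<theta>) u v)"
proof -
  have "continuous_on A (\<lambda>\<theta> :: param. \<Sum>a<p. \<Sum>b<p. u $ a * \<theta> (k, a, b) * v $ b)" by (intro continuous_intros)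
  then show ?thesis unfolding bil_sum[OF pmat_carrier assms] by (simp add: pmat_def)
qed

lemma closed_pvalid: "closed (pvalid p k)"
proof -
  have 1: "sym_mat p (pmat p k \<theta>) \<longleftrightarrow> (\<forall>a<p. \<forall>b<p. \<theta> (k, a, b) = \<theta> (k, b, a))" for \<theta>
    by (auto simp: sym_mat_def pmat_def mat_eq_iff)
  have 2: "pmat p k \<theta> * pmat p (Suc k) \<theta> = 1\<^sub>m p \<longleftrightarrow>
    (\<forall>a<p. \<forall>b<p. (\<Sum>c<p. \<theta> (k, a, c) * \<theta> (Suc k, c, b)) = (if a = b then 1 else 0))" for \<theta>
    by (auto simp: mat_eq_iff pmat_def scalar_prod_def lessThan_atLeast0)
  have 3: "mat_trace (pmat p k \<theta>) = (\<Sum>a<p. \<theta> (k, a, a))" for \<theta> by (simp add: mat_trace_def pmat_def)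
  have eq: "pvalid p k = (\<Inter>a\<in>{..<p}. \<Inter>b\<in>{..<p}. {\<theta>. \<theta> (k, a, b) = \<theta> (k, b, a)}) \<inter>
    (\<Inter>a\<in>{..<p}. \<Inter>b\<in>{..<p}. {\<theta>. (\<Sum>c<p. \<theta> (k, a, c) * \<theta> (Suc k, c, b)) = (if a = b then 1 else 0)}) \<inter>
    {\<theta>. (\<Sum>a<p. \<theta> (k, a, a)) = real p} \<inter> (\<Inter>v\<in>carrier_vec p. {\<theta>. 0 \<le> bil (pmat p k \<theta>) v v})"
    unfolding pvalid_def 1 2 3 by auto
  show ?thesis unfolding eq
    by (intro closed_Int closed_INT ballI closed_Collect_eq closed_Collect_le continuous_intros continuous_bil_pmat) auto
qed

lemma pvalid_pos_def:
  assumes "\<theta> \<in> pvalid p k"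
  shows "pos_def p (pmat p k \<theta>)" "mat_inv (pmat p k \<theta>) = pmat p (Suc k) \<theta>"
proof -
  let ?T = "pmat p k \<theta>" and ?P = "pmat p (Suc k) \<theta>"
  have s: "sym_mat p ?T" and TP: "?T * ?P = 1\<^sub>m p" and psd: "\<And>v. v \<in> carrier_vec p \<Longrightarrow> 0 \<le> bil ?T v v"
    using assms by (auto simp: pvalid_def)
  have PT: "?P\<^sup>T * ?T = 1\<^sub>m p"
    using arg_cong[OF TP, of transpose_mat] transpose_mult[OF pmat_carrier pmat_carrier, of p k \<theta> "Suc k" \<theta>] sym_matD(2)[OF s] by simp
  have Pc: "?P\<^sup>T \<in> carrier_mat p p" by simp
  show pd: "pos_def p ?T"
  proof (rule pos_defI[OF s])
    fix v :: "real vec" assume v: "v \<in> carrier_vec p" "v \<noteq> 0\<^sub>v p"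
    have "bil ?T v v \<noteq> 0"
    proof
      assume "bil ?T v v = 0"
      then have "?T *\<^sub>v v = 0\<^sub>v p" using psd_null_vector[OF s psd v(1)] by blast
      then have "?P\<^sup>T *\<^sub>v (?T *\<^sub>v v) = 0\<^sub>v p" using mult_mat_zero_vec[OF Pc] by simp
      then have "v = 0\<^sub>v p" using assoc_mult_mat_vec[OF Pc pmat_carrier v(1), of k \<theta>] PT v(1) by simp
      then show False using v by simp
    qed
    then show "0 < bil ?T v v" using psd[OF v(1)] by simp
  qed
  show "mat_inv ?T = ?P" by (rule mat_inverse_eqI[OF pmat_carrier pmat_carrier TP pd])
qed

definition pembed :: "nat \<Rightarrow> (nat \<Rightarrow> real mat) \<Rightarrow> param" where
  "pembed p A = (\<lambda>(k, a, b). if k < 4 \<and> a < p \<and> b < p then A k $$ (a, b) else 0)"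

lemma pmat_pembed: "A k \<in> carrier_mat p p \<Longrightarrow> k < 4 \<Longrightarrow> pmat p k (pembed p A) = A k"
  by (intro eq_matI) (auto simp: pmat_def pembed_def)

lemma pembed_in_pbox: "\<exists>j. pembed p A \<in> pbox p j"
proof -
  let ?X = "(\<lambda>(k, a, b). \<bar>A k $$ (a, b)\<bar>) ` ({..<4} \<times> {..<p} \<times> {..<p})"
  have "finite ?X" by simp
  then have "bdd_above ?X" by (rule bdd_above_finite)
  then obtain M where M: "\<And>x. x \<in> ?X \<Longrightarrow> x \<le> M" unfolding bdd_above_def by blast
  obtain j :: nat where j: "M \<le> real j" using real_arch_simple by blast
  have "\<bar>A k $$ (a, b)\<bar> \<le> real j" if "k < 4" "a < p" "b < p" for k a b
    using M[of "\<bar>A k $$ (a, b)\<bar>"] that j by force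
  then have "pembed p A \<in> pbox p j" by (auto simp: pbox_def pembed_def PiE_iff abs_le_iff minus_le_iff)
  then show ?thesis ..
qed

lemma pembed_pvalid:
  assumes T: "pos_def p (A k)" "mat_trace (A k) = real p" and P: "A (Suc k) = mat_inv (A k)" and k: "Suc k < 4"
  shows "pembed p A \<in> pvalid p k"
proof -
  have "A k \<in> carrier_mat p p" "A (Suc k) \<in> carrier_mat p p"
    using T pos_def_inverse(2)[OF T(1)] P by (auto simp: pos_def_def)
  then have e: "pmat p k (pembed p A) = A k" "pmat p (Suc k) (pembed p A) = A (Suc k)"
    using k by (auto intro!: pmat_pembed)
  show ?thesis unfolding pvalid_def mem_Collect_eq e P
    using pos_def_sym[OF T(1)] pos_def_inverse(3)[OF T(1)] T(2) psd_bil_nonneg[OF T(1)] by blast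
qed

text \<open>On \<open>pvalid\<close> it vanishes exactly at solutions. The value \<open>1\<close>
  encodes that samples containing a zero vector admit none; as this case depends only on
  \<open>x\<close>, continuity in \<theta> is preserved.\<close>

definition presid :: "nat \<Rightarrow> nat \<Rightarrow> nat \<Rightarrow> (nat \<Rightarrow> real vec) \<Rightarrow> param \<Rightarrow> real" where
  "presid p n k x \<theta> = (if \<exists>i<n. x i = 0\<^sub>v p then 1 else
     (\<Sum>a<p. \<Sum>b<p. \<bar>\<theta> (k, a, b) - psi p n x (pmat p (Suc k) \<theta>) $$ (a, b)\<bar>))"

lemma presid_nonneg: "0 \<le> presid p n k x \<theta>"
  by (auto simp: presid_def intro!: sum_nonneg)

lemma presid_zero_iff:
  assumes "\<theta> \<in> pvalid p k"
  shows "presid p n k x \<theta> = 0 \<longleftrightarrow> tyler_solution p n x (pmat p k \<theta>)"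
proof -
  note pv = pvalid_pos_def[OF assms]
  have tr: "mat_trace (pmat p k \<theta>) = real p" using assms by (simp add: pvalid_def)
  have "(\<Sum>a<p. \<Sum>b<p. \<bar>\<theta> (k, a, b) - psi p n x (pmat p (Suc k) \<theta>) $$ (a, b)\<bar>) = 0 \<longleftrightarrow>
    (\<forall>a<p. \<forall>b<p. \<theta> (k, a, b) = psi p n x (pmat p (Suc k) \<theta>) $$ (a, b))"
    by (subst sum_nonneg_eq_0_iff) (auto intro!: sum_nonneg simp: sum_nonneg_eq_0_iff)
  also have "\<dots> \<longleftrightarrow> psi p n x (mat_inv (pmat p k \<theta>)) = pmat p k \<theta>"
    unfolding pv(2) by (auto simp: mat_eq_iff pmat_def psi_def)
  finally show ?thesis
    using pv(1) tr unfolding tyler_solution_def presid_def psi_def[symmetric] by auto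
qed

lemma presid_continuous:
  assumes x: "\<And>i. i < n \<Longrightarrow> x i \<in> carrier_vec p" and A: "A \<subseteq> pvalid p k"
  shows "continuous_on A (presid p n k x)"
proof (cases "\<exists>i<n. x i = 0\<^sub>v p")
  case True then show ?thesis by (simp add: presid_def)
next
  case False
  have nz: "bil (pmat p (Suc k) \<theta>) (x i) (x i) \<noteq> 0" if "\<theta> \<in> A" "i < n" for \<theta> i
  proof -
    have "\<theta> \<in> pvalid p k" using that A by auto
    from pvalid_pos_def[OF this] have "pos_def p (pmat p (Suc k) \<theta>)" using pos_def_inverse(2) by metis
    then show ?thesis using pos_defD x[OF that(2)] False that(2) by fastforce
  qed
  have "continuous_on A (\<lambda>\<theta>. \<Sum>a<p. \<Sum>b<p. \<bar>\<theta> (k, a, b) -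
     real p / real n * (\<Sum>i<n. x i $ a * x i $ b / bil (pmat p (Suc k) \<theta>) (x i) (x i))\<bar>)"
    by (intro continuous_intros continuous_bil_pmat) (use x nz in auto)
  moreover have "presid p n k x = (\<lambda>\<theta>. \<Sum>a<p. \<Sum>b<p. \<bar>\<theta> (k, a, b) -
     real p / real n * (\<Sum>i<n. x i $ a * x i $ b / bil (pmat p (Suc k) \<theta>) (x i) (x i))\<bar>)"
    using False by (auto simp: presid_def psi_def bil_def fun_eq_iff)
  ultimately show ?thesis by simp
qed

lemma presid_measurable:
  assumes X: "\<And>i. i < n \<Longrightarrow> (\<lambda>x. x i) \<in> M \<rightarrow>\<^sub>M borel_vec p"
  shows "(\<lambda>x. presid p n k x \<theta>) \<in> borel_measurable M"
proof -
  let ?P = "pmat p (Suc k) \<theta>"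
  have "(\<lambda>x. \<Sum>a<p. \<Sum>b<p. \<bar>\<theta> (k, a, b) - real p / real n * (\<Sum>i<n. x i $ a * x i $ b / (x i \<bullet> (?P *\<^sub>v x i)))\<bar>) \<in> borel_measurable M"
    by (intro borel_measurable_sum borel_measurable_abs borel_measurable_diff borel_measurable_times
        borel_measurable_divide borel_measurable_const scalar_prod_borel_vec[of _ _ p] mult_mat_vec_borel_vec pmat_carrier
        measurable_compose[OF X borel_vec_component] X) auto
  then have 1: "(\<lambda>x. \<Sum>a<p. \<Sum>b<p. \<bar>\<theta> (k, a, b) - psi p n x ?P $$ (a, b)\<bar>) \<in> borel_measurable M"
    by (simp add: psi_def)
  have 2: "{x \<in> space M. \<exists>i<n. x i = 0\<^sub>v p} \<in> sets M"
  proof -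
    have "{x \<in> space M. \<exists>i<n. x i = 0\<^sub>v p} = (\<Union>i\<in>{..<n}. (\<lambda>x. x i) -` {0\<^sub>v p} \<inter> space M)"
      by auto
    also have "\<dots> \<in> sets M" by (intro sets.finite_UN measurable_sets[OF X zero_vec_sets]) auto
    finally show ?thesis .
  qed
  show ?thesis unfolding presid_def by (rule measurable_If[OF borel_measurable_const 1 2])
qed

lemma tyler_solution_param:
  assumes T: "tyler_solution p n x (A k)" and P: "A (Suc k) = mat_inv (A k)" and k: "Suc k < 4"
  shows "pembed p A \<in> pvalid p k" "presid p n k x (pembed p A) = 0"
proof -
  have T': "pos_def p (A k)" "mat_trace (A k) = real p" using T by (auto simp: tyler_solution_def)
  show v: "pembed p A \<in> pvalid p k" by (rule pembed_pvalid[OF T' P k])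
  have "pmat p k (pembed p A) = A k" using T'(1) k by (intro pmat_pembed) (auto simp: pos_def_def)
  then show "presid p n k x (pembed p A) = 0" using presid_zero_iff[OF v] T by simp
qed

text \<open>As a family of inequalities between bilinear values, each continuous in the entries, the
  norm bound cuts out a closed set of parameters. The norms must be shown bounded, since otherwise
  their supremum carries no information.\<close>

lemma op_norm_le_iff:
  assumes M: "M \<in> carrier_mat p p" and t: "0 \<le> t"
  shows "op_norm M \<le> t \<longleftrightarrow> (\<forall>u \<in> carrier_vec p. \<forall>v \<in> carrier_vec p. vnorm u \<le> 1 \<longrightarrow> vnorm v \<le> 1 \<longrightarrow> bil M u v \<le> t)"
proof -
  let ?S = "{vnorm (M *\<^sub>v v) | v. v \<in> carrier_vec (dim_col M) \<and> vnorm v \<le> 1}"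
  have Mv: "M *\<^sub>v v \<in> carrier_vec p" if "v \<in> carrier_vec p" for v by (rule mult_mat_vec_carrier[OF M that])
  have bdd: "bdd_above ?S"
  proof (rule bdd_aboveI)
    fix s assume "s \<in> ?S"
    then obtain v where v: "s = vnorm (M *\<^sub>v v)" "v \<in> carrier_vec p" "vnorm v \<le> 1" using M by auto
    have "s\<^sup>2 = (\<Sum>i<p. (row M i \<bullet> v)\<^sup>2)" unfolding v(1) vnorm_sq
      using M by (simp add: scalar_prod_def[of "M *\<^sub>v v"] power2_eq_square lessThan_atLeast0)
    also have "\<dots> \<le> (\<Sum>i<p. (vnorm (row M i))\<^sup>2)"
    proof (rule sum_mono)
      fix i assume "i \<in> {..<p}"
      then have r: "row M i \<in> carrier_vec p" using M by auto
      have "\<bar>row M i \<bullet> v\<bar> \<le> vnorm (row M i) * 1"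
        using scalar_prod_cauchy_schwarz[OF r v(2)] mult_left_mono[OF v(3) vnorm_nonneg[of "row M i"]] by linarith
      then show "(row M i \<bullet> v)\<^sup>2 \<le> (vnorm (row M i))\<^sup>2" by (intro abs_le_square_iff[THEN iffD1]) simp
    qed
    finally have "s \<le> sqrt (\<Sum>i<p. (vnorm (row M i))\<^sup>2)" by (rule real_le_rsqrt)
    then show "s \<le> sqrt (\<Sum>i<p. (vnorm (row M i))\<^sup>2)" .
  qed
  show ?thesis
  proof (intro iffI ballI impI)
    fix u v :: "real vec" assume le: "op_norm M \<le> t" and u: "u \<in> carrier_vec p" "vnorm u \<le> 1" and v: "v \<in> carrier_vec p" "vnorm v \<le> 1"
    have "vnorm (M *\<^sub>v v) \<in> ?S" using v M by auto
    then have "vnorm (M *\<^sub>v v) \<le> t" using cSup_upper[OF _ bdd] le unfolding op_norm_def by fastforce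
    moreover have "bil M u v \<le> vnorm u * vnorm (M *\<^sub>v v)" unfolding bil_def using scalar_prod_cauchy_schwarz[OF u(1) Mv[OF v(1)]] by linarith
    moreover have "vnorm u * vnorm (M *\<^sub>v v) \<le> 1 * vnorm (M *\<^sub>v v)" by (rule mult_right_mono[OF u(2)]) simp
    ultimately show "bil M u v \<le> t" by linarith
  next
    assume all: "\<forall>u \<in> carrier_vec p. \<forall>v \<in> carrier_vec p. vnorm u \<le> 1 \<longrightarrow> vnorm v \<le> 1 \<longrightarrow> bil M u v \<le> t"
    show "op_norm M \<le> t" unfolding op_norm_def
    proof (rule cSup_least)
      have "vnorm (M *\<^sub>v 0\<^sub>v p) \<in> ?S" using M by (intro CollectI exI[of _ "0\<^sub>v p"]) (auto simp: vnorm_def)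
      then show "?S \<noteq> {}" by blast
      fix s assume "s \<in> ?S"
      then obtain v where v: "s = vnorm (M *\<^sub>v v)" "v \<in> carrier_vec p" "vnorm v \<le> 1" using M by auto
      show "s \<le> t"
      proof (cases "M *\<^sub>v v = 0\<^sub>v p")
        case True then show ?thesis using v t by (simp add: vnorm_def)
      next
        case False
        let ?u = "(1 / vnorm (M *\<^sub>v v)) \<cdot>\<^sub>v (M *\<^sub>v v)"
        have pos: "0 < vnorm (M *\<^sub>v v)" by (rule vnorm_pos[OF Mv[OF v(2)] False])
        have u: "?u \<in> carrier_vec p" "vnorm ?u \<le> 1" using Mv[OF v(2)] pos by (auto simp: vnorm_smult)
        have "bil M ?u v = (vnorm (M *\<^sub>v v))\<^sup>2 / vnorm (M *\<^sub>v v)"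
          unfolding vnorm_sq using Mv[OF v(2)] by (simp add: bil_def)
        then have "bil M ?u v = s" using pos v(1) by (simp add: power2_eq_square)
        moreover have "bil M ?u v \<le> t" using all u v(2,3) by blast
        ultimately show ?thesis by simp
      qed
    qed
  qed
qed

text \<open>The event is a difference: some solution satisfies the norm bound, and no two distinct
  solutions exist. Each of the two existence statements is a countable union over compact parameter
  sets.\<close>

lemma tyler_event_measurable:
  assumes X: "\<And>i. i < n \<Longrightarrow> (\<lambda>x. x i) \<in> M \<rightarrow>\<^sub>M borel_vec p" and B: "sym_mat p B" and t: "0 \<le> t"
  shows "{x \<in> space M. tyler_exists p n x \<and> op_norm (1\<^sub>m p - B * mat_inv (tyler p n x) * B) \<le> t} \<in> sets M"
proof -
  have xc: "x i \<in> carrier_vec p" if "x \<in> space M" "i < n" for x i using measurable_space[OF X[OF that(2)] that(1)] by simp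
  have Bc: "B \<in> carrier_mat p p" by (rule sym_matD(1)[OF B])
  define R where "R P \<longleftrightarrow> op_norm (1\<^sub>m p - B * P * B) \<le> t" for P
  define CR where "CR = {\<theta> :: param. R (pmat p 1 \<theta>)}"
  have closedR: "closed CR"
  proof -
    have "R P \<longleftrightarrow> (\<forall>u \<in> carrier_vec p. \<forall>v \<in> carrier_vec p. vnorm u \<le> 1 \<longrightarrow> vnorm v \<le> 1 \<longrightarrow>
      u \<bullet> v - bil P (B *\<^sub>v u) (B *\<^sub>v v) \<le> t)" if P: "P \<in> carrier_mat p p" for P
    proof -
      have BPB: "B * P * B \<in> carrier_mat p p" by (rule mult_carrier_mat[OF mult_carrier_mat[OF Bc P] Bc])
      have "bil (1\<^sub>m p - B * P * B) u v = u \<bullet> v - bil P (B *\<^sub>v u) (B *\<^sub>v v)" if "u \<in> carrier_vec p" "v \<in> carrier_vec p" for u v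
        unfolding bil_minus_mat[OF one_carrier_mat BPB that] bil_one[OF that] bil_conj[OF B P that] ..
      then show ?thesis unfolding R_def op_norm_le_iff[OF minus_carrier_mat[OF BPB] t] by auto
    qed
    then have eq: "CR = (\<Inter>u\<in>{u \<in> carrier_vec p. vnorm u \<le> 1}. \<Inter>v\<in>{v \<in> carrier_vec p. vnorm v \<le> 1}.
      {\<theta>. u \<bullet> v - bil (pmat p 1 \<theta>) (B *\<^sub>v u) (B *\<^sub>v v) \<le> t})"
      unfolding CR_def by auto
    show ?thesis unfolding eq
      by (intro closed_INT ballI closed_Collect_le continuous_intros continuous_bil_pmat mult_mat_vec_carrier[OF Bc]) auto
  qed
  define K1 where "K1 j = pbox p j \<inter> (pvalid p 0 \<inter> CR)" for j
  define E1 where "E1 = (\<Union>j. {x \<in> space M. \<exists>\<theta>\<in>K1 j. presid p n 0 x \<theta> = 0})"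
  have "{x \<in> space M. \<exists>\<theta>\<in>K1 j. presid p n 0 x \<theta> = 0} \<in> sets M" for j
  proof (rule measurable_exists_compact)
    show "compact (K1 j)" unfolding K1_def
      by (intro compact_Int_closed compact_pbox closed_Int closed_pvalid closedR)
    show "continuous_on (K1 j) (presid p n 0 x)" if "x \<in> space M" for x
      by (rule presid_continuous[OF xc[OF that]]) (auto simp: K1_def)
  qed (rule presid_measurable[OF X])
  then have E1m: "E1 \<in> sets M" unfolding E1_def by (intro sets.countable_UN') auto
  have E1: "x \<in> E1 \<longleftrightarrow> x \<in> space M \<and> (\<exists>T. tyler_solution p n x T \<and> R (mat_inv T))" for x
  proof
    assume "x \<in> E1"
    then obtain j \<theta> where "x \<in> space M" and \<theta>: "\<theta> \<in> K1 j" "presid p n 0 x \<theta> = 0" by (auto simp: E1_def)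
    have v: "\<theta> \<in> pvalid p 0" "R (pmat p 1 \<theta>)" using \<theta>(1) by (auto simp: K1_def CR_def)
    then have "tyler_solution p n x (pmat p 0 \<theta>)" "R (mat_inv (pmat p 0 \<theta>))"
      using presid_zero_iff[OF v(1)] \<theta>(2) pvalid_pos_def(2)[OF v(1)] by auto
    then show "x \<in> space M \<and> (\<exists>T. tyler_solution p n x T \<and> R (mat_inv T))" using \<open>x \<in> space M\<close> by blast
  next
    assume "x \<in> space M \<and> (\<exists>T. tyler_solution p n x T \<and> R (mat_inv T))"
    then obtain T where x: "x \<in> space M" and T: "tyler_solution p n x T" "R (mat_inv T)" by auto
    define A where "A k = (if k = 0 then T else mat_inv T)" for k :: nat
    have v: "pembed p A \<in> pvalid p 0" "presid p n 0 x (pembed p A) = 0"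
      using tyler_solution_param[of p n x A 0] T by (auto simp: A_def)
    have "mat_inv T \<in> carrier_mat p p" using T pos_def_inverse(2)[of p T] by (auto simp: tyler_solution_def pos_def_def)
    then have "pmat p 1 (pembed p A) = mat_inv T" by (subst pmat_pembed) (auto simp: A_def)
    then have "pembed p A \<in> CR" using T by (simp add: CR_def)
    moreover obtain j where "pembed p A \<in> pbox p j" using pembed_in_pbox by blast
    ultimately have "pembed p A \<in> K1 j" using v by (simp add: K1_def)
    then show "x \<in> E1" using x v(2) by (auto simp: E1_def)
  qed
  \<comment> \<open>Distinctness is not a closed condition; it is exhausted by closed ones, where
    one entry of the first matrix exceeds that of the second by \<open>1 / (j + 1)\<close>.
    Interchanging the two solutions fixes the sign.\<close>
  define K2 where "K2 j a b = pbox p j \<inter> (pvalid p 0 \<inter> (pvalid p 2 \<inter> {\<theta>. \<theta> (2, a, b) + 1 / real (Suc j) \<le> \<theta> (0, a, b)}))" for j a b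
  define E2 where "E2 = (\<Union>j. \<Union>a\<in>{..<p}. \<Union>b\<in>{..<p}. {x \<in> space M. \<exists>\<theta>\<in>K2 j a b. presid p n 0 x \<theta> + presid p n 2 x \<theta> = 0})"
  have "{x \<in> space M. \<exists>\<theta>\<in>K2 j a b. presid p n 0 x \<theta> + presid p n 2 x \<theta> = 0} \<in> sets M" for j a b
  proof (rule measurable_exists_compact)
    show "compact (K2 j a b)" unfolding K2_def
      by (intro compact_Int_closed compact_pbox closed_Int closed_pvalid closed_Collect_le continuous_intros)
    show "continuous_on (K2 j a b) (\<lambda>\<theta>. presid p n 0 x \<theta> + presid p n 2 x \<theta>)" if "x \<in> space M" for x
      by (intro continuous_on_add presid_continuous[OF xc[OF that]]) (auto simp: K2_def)
  qed (intro borel_measurable_add presid_measurable[OF X])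
  then have E2m: "E2 \<in> sets M" unfolding E2_def by (intro sets.countable_UN' sets.finite_UN) auto
  have E2: "x \<in> E2 \<longleftrightarrow> x \<in> space M \<and> (\<exists>T T'. tyler_solution p n x T \<and> tyler_solution p n x T' \<and> T \<noteq> T')" for x
  proof
    assume "x \<in> E2"
    then obtain j a b \<theta> where x: "x \<in> space M" and ab: "a < p" "b < p" and \<theta>: "\<theta> \<in> K2 j a b" "presid p n 0 x \<theta> + presid p n 2 x \<theta> = 0"
      by (auto simp: E2_def)
    have v: "\<theta> \<in> pvalid p 0" "\<theta> \<in> pvalid p 2" and gap: "\<theta> (2, a, b) + 1 / real (Suc j) \<le> \<theta> (0, a, b)" using \<theta>(1) by (auto simp: K2_def)
    have "presid p n 0 x \<theta> = 0" "presid p n 2 x \<theta> = 0" using \<theta>(2) presid_nonneg[of p n 0 x \<theta>] presid_nonneg[of p n 2 x \<theta>] by linarith+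
    then have "tyler_solution p n x (pmat p 0 \<theta>)" "tyler_solution p n x (pmat p 2 \<theta>)"
      using presid_zero_iff v by auto
    moreover have "\<theta> (2, a, b) < \<theta> (0, a, b)" using gap by (smt (verit) divide_pos_pos of_nat_0_less_iff zero_less_Suc)
    then have "pmat p 0 \<theta> $$ (a, b) \<noteq> pmat p 2 \<theta> $$ (a, b)" using ab by (simp add: pmat_def)
    then have "pmat p 0 \<theta> \<noteq> pmat p 2 \<theta>" by metis
    ultimately show "x \<in> space M \<and> (\<exists>T T'. tyler_solution p n x T \<and> tyler_solution p n x T' \<and> T \<noteq> T')" using x by blast
  next
    assume "x \<in> space M \<and> (\<exists>T T'. tyler_solution p n x T \<and> tyler_solution p n x T' \<and> T \<noteq> T')"
    then obtain T0 T1 where x: "x \<in> space M" and s: "tyler_solution p n x T0" "tyler_solution p n x T1" "T0 \<noteq> T1" by auto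
    have c: "T0 \<in> carrier_mat p p" "T1 \<in> carrier_mat p p" using s by (auto simp: tyler_solution_def pos_def_def)
    have "\<exists>a<p. \<exists>b<p. T0 $$ (a, b) \<noteq> T1 $$ (a, b)" using s(3) c by (metis carrier_matD eq_matI)
    then obtain a b where ab: "a < p" "b < p" "T0 $$ (a, b) \<noteq> T1 $$ (a, b)" by auto
    obtain T T' where T: "tyler_solution p n x T" "tyler_solution p n x T'" "T' $$ (a, b) < T $$ (a, b)"
      using ab(3) s(1,2) by (metis linorder_neqE_linordered_idom)
    have Tc: "T \<in> carrier_mat p p" "T' \<in> carrier_mat p p" using T by (auto simp: tyler_solution_def pos_def_def)
    define A where "A k = (if k = 0 then T else if k = 1 then mat_inv T else if k = 2 then T' else mat_inv T')" for k :: nat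
    have v0: "pembed p A \<in> pvalid p 0" "presid p n 0 x (pembed p A) = 0"
      using tyler_solution_param[of p n x A 0] T by (auto simp: A_def)
    have v2: "pembed p A \<in> pvalid p 2" "presid p n 2 x (pembed p A) = 0"
      using tyler_solution_param[of p n x A 2] T by (auto simp: A_def)
    obtain j1 where j1: "pembed p A \<in> pbox p j1" using pembed_in_pbox by blast
    obtain j2 :: nat where j2: "1 / real (Suc j2) < T $$ (a, b) - T' $$ (a, b)" using T(3) nat_approx_posE[of "T $$ (a, b) - T' $$ (a, b)"] by auto
    define j where "j = max j1 j2"
    have "pembed p A \<in> pbox p j" using j1 pbox_mono[of j1 j p] by (auto simp: j_def)
    moreover have "1 / real (Suc j) \<le> 1 / real (Suc j2)" by (intro divide_left_mono) (auto simp: j_def)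
    then have "pembed p A (2, a, b) + 1 / real (Suc j) \<le> pembed p A (0, a, b)" using ab j2 by (simp add: pembed_def A_def)
    ultimately have "pembed p A \<in> K2 j a b" using v0 v2 by (simp add: K2_def)
    moreover have "presid p n 0 x (pembed p A) + presid p n 2 x (pembed p A) = 0" using v0 v2 by simp
    ultimately show "x \<in> E2" using x ab unfolding E2_def by blast
  qed
  have "{x \<in> space M. tyler_exists p n x \<and> op_norm (1\<^sub>m p - B * mat_inv (tyler p n x) * B) \<le> t} = E1 - E2"
  proof (rule Set.set_eqI)
    fix x
    have "tyler_exists p n x \<and> R (mat_inv (tyler p n x)) \<longleftrightarrow>
      (\<exists>T. tyler_solution p n x T \<and> R (mat_inv T)) \<and> \<not> (\<exists>T T'. tyler_solution p n x T \<and> tyler_solution p n x T' \<and> T \<noteq> T')"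
    proof
      assume l: "tyler_exists p n x \<and> R (mat_inv (tyler p n x))"
      then have "tyler_solution p n x (tyler p n x)" unfolding tyler_exists_def tyler_def by (blast intro: theI')
      then show "(\<exists>T. tyler_solution p n x T \<and> R (mat_inv T)) \<and> \<not> (\<exists>T T'. tyler_solution p n x T \<and> tyler_solution p n x T' \<and> T \<noteq> T')"
        using l unfolding tyler_exists_def by blast
    next
      assume r: "(\<exists>T. tyler_solution p n x T \<and> R (mat_inv T)) \<and> \<not> (\<exists>T T'. tyler_solution p n x T \<and> tyler_solution p n x T' \<and> T \<noteq> T')"
      then obtain T where T: "tyler_solution p n x T" "R (mat_inv T)" and u: "\<And>T'. tyler_solution p n x T' \<Longrightarrow> T' = T" by blast
      then have "tyler p n x = T" unfolding tyler_def by blast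
      then show "tyler_exists p n x \<and> R (mat_inv (tyler p n x))" using T u unfolding tyler_exists_def by blast
    qed
    then show "x \<in> {x \<in> space M. tyler_exists p n x \<and> op_norm (1\<^sub>m p - B * mat_inv (tyler p n x) * B) \<le> t} \<longleftrightarrow> x \<in> E1 - E2"
      using E1[of x] E2[of x] unfolding R_def by blast
  qed
  then show ?thesis using E1m E2m by simp
qed

section \<open>Good samples\<close>

lemma elliptical_component:
  assumes D: "centered_elliptical p S D" and i: "i < n"
  shows "(\<lambda>x. x i) \<in> (\<Pi>\<^sub>M i\<in>{..<n}. D) \<rightarrow>\<^sub>M borel_vec p"
proof -
  have "(\<lambda>x. x i) \<in> (\<Pi>\<^sub>M i\<in>{..<n}. D) \<rightarrow>\<^sub>M D" using i by (intro measurable_component_singleton) auto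
  then show ?thesis by (simp add: measurable_cong_sets[OF refl elliptical_sets[OF D]])
qed

lemma elliptical_samples_nonzero:
  fixes n :: nat
  assumes p: "1 \<le> p" and D: "centered_elliptical p S D"
  shows "AE x in (\<Pi>\<^sub>M i\<in>{..<n}. D). \<forall>i<n. x i \<noteq> 0\<^sub>v p"
proof -
  have S: "pos_def p S" using D by (simp add: centered_elliptical_def)
  have "AE x in (\<Pi>\<^sub>M i\<in>{..<n}. D). x i \<noteq> 0\<^sub>v p" if "i \<in> {..<n}" for i
    by (rule AE_PiM_component[OF _ that elliptical_nonzero[OF p S D]]) (rule elliptical_prob[OF p D])
  then have "AE x in (\<Pi>\<^sub>M i\<in>{..<n}. D). \<forall>i\<in>{..<n}. x i \<noteq> 0\<^sub>v p" by (intro AE_finite_allI) auto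
  then show ?thesis by (rule eventually_mono) auto
qed

text \<open>The claim is homogeneous in \<open>w\<close>, so it concerns the unit vector
  \<open>e\<close>. The exceptional set joins the two covariance tails and the counting tail, whose
  bound \<open>exp (- n)\<close> is absorbed because \<open>t <= 1\<close>.\<close>

lemma direction_bad_event:
  assumes p: "1 \<le> p" and D: "centered_elliptical p S D" and w: "w \<in> carrier_vec p" "w \<noteq> 0\<^sub>v p"
    and t: "0 < t" "t \<le> 1"
    and a: "\<And>e. (\<Sum>i<p. (e i)\<^sup>2) = 1 \<Longrightarrow> emeasure (gaussP p) {x \<in> space (gaussP p). dirsq p e x < a} \<le> ennreal (exp (- 16))"
    and n: "1 \<le> n"
  shows "\<exists>Z \<in> sets (\<Pi>\<^sub>M i\<in>{..<n}. D). emeasure (\<Pi>\<^sub>M i\<in>{..<n}. D) Z \<le> ennreal (3 * exp (- (real n * t\<^sup>2 / 32))) \<and>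
    (\<forall>x \<in> space (\<Pi>\<^sub>M i\<in>{..<n}. D) - Z.
      \<bar>real p / real n * (\<Sum>i<n. (w \<bullet> whiten S (x i))\<^sup>2) - w \<bullet> w\<bar> \<le> t * (w \<bullet> w) \<and>
      real (card {i \<in> {..<n}. real p * (w \<bullet> whiten S (x i))\<^sup>2 < a * (w \<bullet> w)}) \<le> real n / 8)"
proof -
  let ?Q = "\<Pi>\<^sub>M i\<in>{..<n}. D"
  have S: "pos_def p S" using D by (simp add: centered_elliptical_def)
  define e where "e = (1 / vnorm w) \<cdot>\<^sub>v w"
  have e: "e \<in> carrier_vec p" "e \<bullet> e = 1"
    using w normalized_bil(2)[OF one_carrier_mat w] by (auto simp: e_def)
  have es: "(\<Sum>i<p. (e $ i)\<^sup>2) = 1"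
    using e by (simp add: scalar_prod_def power2_eq_square lessThan_atLeast0)
  have ww: "0 < w \<bullet> w" by (rule scalar_prod_pos[OF w])
  define Z1 where "Z1 = {x \<in> space ?Q. real n * (1 + t) \<le> (\<Sum>i<n. dirstat p S e (x i))}"
  define Z2 where "Z2 = {x \<in> space ?Q. (\<Sum>i<n. dirstat p S e (x i)) \<le> real n * (1 - t)}"
  define Z3 where "Z3 = {x \<in> space ?Q. real n / 8 \<le> real (card {i \<in> {..<n}. dirstat p S e (x i) < a})}"
  have dm[measurable]: "(\<lambda>x. dirstat p S e (x i)) \<in> borel_measurable ?Q" if "i < n" for i
    by (rule measurable_compose[OF elliptical_component[OF D that] dirstat_measurable[OF p S e(1)]])
  have sm[measurable]: "(\<lambda>x. \<Sum>i<n. dirstat p S e (x i)) \<in> borel_measurable ?Q" by (intro borel_measurable_sum dm) simp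
  have cm: "(\<lambda>x. real (card {i \<in> {..<n}. dirstat p S e (x i) < a})) \<in> borel_measurable ?Q"
  proof -
    have "(\<lambda>x. \<Sum>i<n. indicator {..<a} (dirstat p S e (x i)) :: real) \<in> borel_measurable ?Q"
      by (intro borel_measurable_sum measurable_compose[OF dm]) auto
    moreover have "(\<Sum>i<n. indicator {..<a} (dirstat p S e (x i)) :: real) = real (card {i \<in> {..<n}. dirstat p S e (x i) < a})" for x
      by (simp add: indicator_def sum.If_cases Int_def)
    ultimately show ?thesis by simp
  qed
  have sets: "Z1 \<in> sets ?Q" "Z2 \<in> sets ?Q" "Z3 \<in> sets ?Q"
    unfolding Z1_def Z2_def Z3_def using cm by measurable
  let ?b = "exp (- (real n * t\<^sup>2 / 32))"
  have "emeasure ?Q Z1 \<le> ennreal ?b" unfolding Z1_def using t by (intro upper_tail[OF p D e]) auto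
  moreover have "emeasure ?Q Z2 \<le> ennreal ?b" unfolding Z2_def by (rule lower_tail[OF p D e t(1)])
  moreover have "emeasure ?Q Z3 \<le> ennreal ?b"
  proof -
    have "emeasure ?Q Z3 \<le> ennreal (exp (- real n))" unfolding Z3_def by (rule count_tail[OF p D e a[OF es]])
    also have "\<dots> \<le> ennreal ?b"
    proof (intro ennreal_leI iffD2[OF exp_le_cancel_iff])
      have "t\<^sup>2 \<le> 1" using t by (simp add: power_le_one)
      then have "real n * t\<^sup>2 \<le> real n * 32" by (intro mult_left_mono) auto
      then show "- real n \<le> - (real n * t\<^sup>2 / 32)" by simp
    qed
    finally show ?thesis .
  qed
  moreover have "emeasure ?Q (Z1 \<union> Z2 \<union> Z3) \<le> emeasure ?Q Z1 + emeasure ?Q Z2 + emeasure ?Q Z3"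
    using emeasure_subadditive[of "Z1 \<union> Z2" ?Q Z3] emeasure_subadditive[of Z1 ?Q Z2] sets
    by (meson add_right_mono order_trans sets.Un)
  ultimately have "emeasure ?Q (Z1 \<union> Z2 \<union> Z3) \<le> ennreal ?b + ennreal ?b + ennreal ?b"
    by (meson add_mono order_trans)
  also have "\<dots> = ennreal (3 * ?b)" by (simp add: ennreal_plus[symmetric] del: ennreal_plus)
  finally have em: "emeasure ?Q (Z1 \<union> Z2 \<union> Z3) \<le> ennreal (3 * ?b)" .
  have good: "\<bar>real p / real n * (\<Sum>i<n. (w \<bullet> whiten S (x i))\<^sup>2) - w \<bullet> w\<bar> \<le> t * (w \<bullet> w) \<and>
      real (card {i \<in> {..<n}. real p * (w \<bullet> whiten S (x i))\<^sup>2 < a * (w \<bullet> w)}) \<le> real n / 8"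
    if x: "x \<in> space ?Q - (Z1 \<union> Z2 \<union> Z3)" for x
  proof
    have xc: "x i \<in> carrier_vec p" if "i < n" for i using measurable_space[OF elliptical_component[OF D that]] x by auto
    have rel: "real p * (w \<bullet> whiten S (x i))\<^sup>2 = (w \<bullet> w) * dirstat p S e (x i)" if "i < n" for i
    proof -
      have "e \<bullet> whiten S (x i) = (w \<bullet> whiten S (x i)) / vnorm w"
        using w(1) whiten_carrier[OF p S xc[OF that]] by (simp add: e_def)
      then show ?thesis using ww vnorm_pos[OF w] by (simp add: dirstat_def power_divide vnorm_sq)
    qed
    let ?s = "\<Sum>i<n. dirstat p S e (x i)"
    have s: "?s \<le> real n * (1 + t)" "real n * (1 - t) \<le> ?s" using x by (auto simp: Z1_def Z2_def)
    have "real p / real n * (\<Sum>i<n. (w \<bullet> whiten S (x i))\<^sup>2) = (\<Sum>i<n. real p * (w \<bullet> whiten S (x i))\<^sup>2) / real n"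
      by (simp add: sum_distrib_left sum_divide_distrib)
    also have "(\<Sum>i<n. real p * (w \<bullet> whiten S (x i))\<^sup>2) = (w \<bullet> w) * ?s" using rel by (simp add: sum_distrib_left)
    finally have eq: "real p / real n * (\<Sum>i<n. (w \<bullet> whiten S (x i))\<^sup>2) - w \<bullet> w = (w \<bullet> w) * (?s / real n - 1)"
      by (simp add: algebra_simps)
    have "?s / real n \<le> 1 + t" "1 - t \<le> ?s / real n" using s n by (auto simp: field_simps)
    then have "\<bar>?s / real n - 1\<bar> \<le> t" by linarith
    then show "\<bar>real p / real n * (\<Sum>i<n. (w \<bullet> whiten S (x i))\<^sup>2) - w \<bullet> w\<bar> \<le> t * (w \<bullet> w)"
      unfolding eq abs_mult using ww by (simp add: mult.commute mult_left_mono)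
    have "{i \<in> {..<n}. real p * (w \<bullet> whiten S (x i))\<^sup>2 < a * (w \<bullet> w)} = {i \<in> {..<n}. dirstat p S e (x i) < a}"
      using rel ww by (intro Collect_cong conj_cong refl) (simp add: mult.commute[of a])
    moreover have "\<not> real n / 8 \<le> real (card {i \<in> {..<n}. dirstat p S e (x i) < a})" using x unfolding Z3_def by blast
    ultimately show "real (card {i \<in> {..<n}. real p * (w \<bullet> whiten S (x i))\<^sup>2 < a * (w \<bullet> w)}) \<le> real n / 8" by simp
  qed
  have Zm: "Z1 \<union> Z2 \<union> Z3 \<in> sets ?Q" by (intro sets.Un sets)
  show ?thesis
  proof (rule bexI[OF _ Zm], rule conjI[OF em], rule ballI)
    fix x assume "x \<in> space ?Q - (Z1 \<union> Z2 \<union> Z3)"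
    then show "\<bar>real p / real n * (\<Sum>i<n. (w \<bullet> whiten S (x i))\<^sup>2) - w \<bullet> w\<bar> \<le> t * (w \<bullet> w) \<and>
      real (card {i \<in> {..<n}. real p * (w \<bullet> whiten S (x i))\<^sup>2 < a * (w \<bullet> w)}) \<le> real n / 8" by (rule good)
  qed
qed

text \<open>A union bound over the net costs a factor \<open>K ^ p\<close>. Here
  \<open>K = 2 ^ m * 3\<close>, with \<open>m\<close> determined by the small-ball constant, so all
  constants are absolute. Passing from the net to all directions costs a factor 2 in the error and
  16 in the small-ball constant.\<close>

lemma good_samples:
  "\<exists>a K. 0 < a \<and> a \<le> 1 \<and> 1 \<le> K \<and> (\<forall>p n t S D. 1 \<le> p \<longrightarrow> 1 \<le> n \<longrightarrow> 0 < t \<longrightarrow> t \<le> 1 / 2 \<longrightarrow> centered_elliptical p S D \<longrightarrow>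
    (\<exists>Z \<in> sets (\<Pi>\<^sub>M i\<in>{..<n}. D). emeasure (\<Pi>\<^sub>M i\<in>{..<n}. D) Z \<le> ennreal (K ^ p * (3 * exp (- (real n * t\<^sup>2 / 32)))) \<and>
      (\<forall>x \<in> space (\<Pi>\<^sub>M i\<in>{..<n}. D) - Z. (\<forall>i<n. x i \<noteq> 0\<^sub>v p) \<longrightarrow>
        (\<forall>v \<in> carrier_vec p. \<bar>real p / real n * (\<Sum>i<n. (v \<bullet> whiten S (x i))\<^sup>2) - v \<bullet> v\<bar> \<le> 2 * t * (v \<bullet> v) \<and>
          3 / 4 * real n \<le> real (card {i \<in> {..<n}. a * (v \<bullet> v) \<le> real p * (v \<bullet> whiten S (x i))\<^sup>2})))))"
proof -
  \<comment> \<open>\<open>exp (- 16)\<close> is the probability that the counting tail asks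
    for.\<close>
  obtain a0 where a0: "0 < a0" "\<And>p e. 1 \<le> p \<Longrightarrow> (\<Sum>i<p. (e i)\<^sup>2) = 1 \<Longrightarrow>
    emeasure (gaussP p) {x \<in> space (gaussP p). dirsq p e x < a0} \<le> ennreal (exp (- 16))"
    using dirsq_small_ball[of "exp (- 16)"] by auto
  define a where "a = min a0 1"
  have a: "0 < a" "a \<le> 1" using a0 by (auto simp: a_def)
  have sb: "emeasure (gaussP p) {x \<in> space (gaussP p). dirsq p e x < a} \<le> ennreal (exp (- 16))"
    if "1 \<le> p" "(\<Sum>i<p. (e i)\<^sup>2) = 1" for p e
    by (rule order_trans[OF emeasure_mono a0(2)[OF that]]) (auto simp: a_def)
  obtain m0 :: nat where m0: "8 / sqrt a \<le> real m0" using real_arch_simple by blast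
  define m where "m = max m0 4"
  have m: "4 \<le> m" "8 \<le> real m * sqrt a"
  proof -
    have "8 / sqrt a \<le> real m" using m0 by (simp add: m_def)
    then show "8 \<le> real m * sqrt a" using a by (simp add: divide_le_eq)
  qed (simp add: m_def)
  define K :: real where "K = 2 ^ m * 3"
  have K1: "1 \<le> K"
  proof -
    have "1 * 1 \<le> (2 :: real) ^ m * 3" by (intro mult_mono) auto
    then show ?thesis by (simp add: K_def)
  qed
  have main: "\<exists>Z \<in> sets (\<Pi>\<^sub>M i\<in>{..<n}. D). emeasure (\<Pi>\<^sub>M i\<in>{..<n}. D) Z \<le> ennreal (K ^ p * (3 * exp (- (real n * t\<^sup>2 / 32)))) \<and>
      (\<forall>x \<in> space (\<Pi>\<^sub>M i\<in>{..<n}. D) - Z. (\<forall>i<n. x i \<noteq> 0\<^sub>v p) \<longrightarrow>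
        (\<forall>v \<in> carrier_vec p. \<bar>real p / real n * (\<Sum>i<n. (v \<bullet> whiten S (x i))\<^sup>2) - v \<bullet> v\<bar> \<le> 2 * t * (v \<bullet> v) \<and>
          3 / 4 * real n \<le> real (card {i \<in> {..<n}. a / 16 * (v \<bullet> v) \<le> real p * (v \<bullet> whiten S (x i))\<^sup>2})))"
    if p: "1 \<le> p" and n: "1 \<le> n" and t: "0 < t" "t \<le> 1 / 2" and D: "centered_elliptical p S D" for p n t S D
  proof -
    let ?Q = "\<Pi>\<^sub>M i\<in>{..<n}. D"
    have S: "pos_def p S" using D by (simp add: centered_elliptical_def)
    have m1: "1 \<le> m" using m by simp
    obtain N0 where N0: "finite N0" "N0 \<subseteq> carrier_vec p" "real (card N0) \<le> K ^ p"
      "\<And>v. v \<in> carrier_vec p \<Longrightarrow> v \<bullet> v = 1 \<Longrightarrow> \<exists>y \<in> N0. y \<bullet> y \<le> 1 \<and> (v - y) \<bullet> (v - y) \<le> (1 / real m)\<^sup>2"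
      using sphere_net[OF p m1] unfolding K_def by blast
    \<comment> \<open>The zero vector has no direction to which the tail bounds could apply. Its
      distance to the sphere exceeds \<open>1 / m\<close>, so the remaining points still form a
      net.\<close>
    define N where "N = N0 - {0\<^sub>v p}"
    have N: "finite N" "N \<subseteq> carrier_vec p" using N0 by (auto simp: N_def)
    have cN: "real (card N) \<le> K ^ p"
      using card_mono[OF N0(1), of N] N0(3) by (auto simp: N_def)
    have net: "\<exists>y \<in> N. y \<bullet> y \<le> 1 \<and> (v - y) \<bullet> (v - y) \<le> (1 / real m)\<^sup>2" if v: "v \<in> carrier_vec p" "v \<bullet> v = 1" for v
    proof -
      obtain y where y: "y \<in> N0" "y \<bullet> y \<le> 1" "(v - y) \<bullet> (v - y) \<le> (1 / real m)\<^sup>2" using N0(4)[OF v] by blast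
      have "y \<noteq> 0\<^sub>v p"
      proof
        assume "y = 0\<^sub>v p"
        then have "v - y = v" using v by (intro eq_vecI) auto
        then have "1 \<le> (1 / real m)\<^sup>2" using y(3) v(2) by simp
        moreover have "(1 / real m)\<^sup>2 < 1" using m(1) by (simp add: power_divide)
        ultimately show False by simp
      qed
      then show ?thesis using y by (auto simp: N_def)
    qed
    let ?b = "3 * exp (- (real n * t\<^sup>2 / 32))"
    define ok where "ok w Z \<longleftrightarrow> Z \<in> sets ?Q \<and> emeasure ?Q Z \<le> ennreal ?b \<and> (\<forall>x \<in> space ?Q - Z.
      \<bar>real p / real n * (\<Sum>i<n. (w \<bullet> whiten S (x i))\<^sup>2) - w \<bullet> w\<bar> \<le> t * (w \<bullet> w) \<and>
      real (card {i \<in> {..<n}. real p * (w \<bullet> whiten S (x i))\<^sup>2 < a * (w \<bullet> w)}) \<le> real n / 8)" for w Z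
    have "\<exists>Z. ok w Z" if w: "w \<in> N" for w
    proof -
      have "w \<in> carrier_vec p" "w \<noteq> 0\<^sub>v p" "t \<le> 1" using w N(2) t(2) by (auto simp: N_def)
      from direction_bad_event[OF p D this(1,2) t(1) this(3) sb[OF p] n] show ?thesis unfolding ok_def Bex_def .
    qed
    then obtain Z where ok: "\<And>w. w \<in> N \<Longrightarrow> ok w (Z w)" by metis
    have Z: "\<And>w. w \<in> N \<Longrightarrow> Z w \<in> sets ?Q" "\<And>w. w \<in> N \<Longrightarrow> emeasure ?Q (Z w) \<le> ennreal ?b"
      and Zg: "\<And>w x. w \<in> N \<Longrightarrow> x \<in> space ?Q - Z w \<Longrightarrow>
      \<bar>real p / real n * (\<Sum>i<n. (w \<bullet> whiten S (x i))\<^sup>2) - w \<bullet> w\<bar> \<le> t * (w \<bullet> w) \<and>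
      real (card {i \<in> {..<n}. real p * (w \<bullet> whiten S (x i))\<^sup>2 < a * (w \<bullet> w)}) \<le> real n / 8"
      using ok unfolding ok_def by blast+
    define Z' where "Z' = (\<Union>w\<in>N. Z w)"
    have Zs: "Z' \<in> sets ?Q" unfolding Z'_def using N Z by (intro sets.finite_UN) auto
    have "emeasure ?Q Z' \<le> (\<Sum>w\<in>N. emeasure ?Q (Z w))"
      unfolding Z'_def using N Z by (intro emeasure_subadditive_finite) auto
    also have "\<dots> \<le> (\<Sum>w\<in>N. ennreal ?b)" using Z by (intro sum_mono) auto
    also have "\<dots> = ennreal (real (card N)) * ennreal ?b" by (simp add: ennreal_of_nat_eq_real_of_nat)
    also have "\<dots> = ennreal (real (card N) * ?b)" by (rule ennreal_mult'[symmetric]) simp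
    also have "\<dots> \<le> ennreal (K ^ p * ?b)" using cN by (intro ennreal_leI mult_right_mono) auto
    finally have em: "emeasure ?Q Z' \<le> ennreal (K ^ p * ?b)" .
    have gd: "\<bar>real p / real n * (\<Sum>i<n. (v \<bullet> whiten S (x i))\<^sup>2) - v \<bullet> v\<bar> \<le> 2 * t * (v \<bullet> v) \<and>
          3 / 4 * real n \<le> real (card {i \<in> {..<n}. a / 16 * (v \<bullet> v) \<le> real p * (v \<bullet> whiten S (x i))\<^sup>2})"
      if x: "x \<in> space ?Q - Z'" and nz: "\<forall>i<n. x i \<noteq> 0\<^sub>v p" and v: "v \<in> carrier_vec p" for x v
    proof -
      have xc: "x i \<in> carrier_vec p" if "i < n" for i using measurable_space[OF elliptical_component[OF D that]] x by auto
      have yc: "whiten S (x i) \<in> carrier_vec p" if "i < n" for i by (rule whiten_carrier[OF p S xc[OF that]])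
      have yu: "whiten S (x i) \<bullet> whiten S (x i) = 1" if "i < n" for i using whiten_unit[OF p S xc[OF that]] nz that by auto
      have xZ: "x \<in> space ?Q - Z w" if "w \<in> N" for w using x that by (auto simp: Z'_def)
      have cov: "\<bar>real p / real n * (\<Sum>i<n. (u \<bullet> whiten S (x i))\<^sup>2) - u \<bullet> u\<bar> \<le> 2 * t * (u \<bullet> u)" if "u \<in> carrier_vec p" for u
        by (rule net_covariance[where y = "\<lambda>i. whiten S (x i)", OF p n yc yu m(1) less_imp_le[OF t(1)] N(2) net _ that])
          (assumption | rule conjunct1[OF Zg[OF _ xZ]])+
      have cov2: "real p / real n * (\<Sum>i<n. (u \<bullet> whiten S (x i))\<^sup>2) \<le> 2 * (u \<bullet> u)" if "u \<in> carrier_vec p" for u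
      proof -
        have "2 * t * (u \<bullet> u) \<le> 1 * (u \<bullet> u)" using t by (intro mult_right_mono scalar_prod_nonneg) simp
        then have "real p / real n * (\<Sum>i<n. (u \<bullet> whiten S (x i))\<^sup>2) - u \<bullet> u \<le> u \<bullet> u"
          using abs_le_D1[OF cov[OF that]] by (simp only: mult_1)
        then show ?thesis by (simp only: diff_le_eq mult_2)
      qed
      have "3 / 4 * real n \<le> real (card {i \<in> {..<n}. a / 16 * (v \<bullet> v) \<le> real p * (v \<bullet> whiten S (x i))\<^sup>2})"
        by (rule net_spread[where y = "\<lambda>i. whiten S (x i)", OF p n yc m(1) a(1) m(2) N(2) net _ cov2 v])
          (assumption | rule conjunct2[OF Zg[OF _ xZ]])+
      then show ?thesis using cov[OF v] by blast
    qed
    show ?thesis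
    proof (rule bexI[OF _ Zs], rule conjI[OF em], rule ballI, rule impI, rule ballI)
      fix x and v :: "real vec" assume "x \<in> space ?Q - Z'" "\<forall>i<n. x i \<noteq> 0\<^sub>v p" "v \<in> carrier_vec p"
      then show "\<bar>real p / real n * (\<Sum>i<n. (v \<bullet> whiten S (x i))\<^sup>2) - v \<bullet> v\<bar> \<le> 2 * t * (v \<bullet> v) \<and>
          3 / 4 * real n \<le> real (card {i \<in> {..<n}. a / 16 * (v \<bullet> v) \<le> real p * (v \<bullet> whiten S (x i))\<^sup>2})" by (rule gd)
    qed
  qed
  show ?thesis
    using a K1 by (intro exI[of _ "a / 16"] exI[of _ K] conjI allI impI main) simp_all
qed

section \<open>From good samples to the probability bound\<close>

lemma whitened_samples_tyler:
  assumes p: "1 \<le> p" and n: "1 \<le> n" and S: "pos_def p S" "mat_trace S = real p"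
    and x: "\<And>i. i < n \<Longrightarrow> x i \<in> carrier_vec p" and nz: "\<And>i. i < n \<Longrightarrow> x i \<noteq> 0\<^sub>v p"
    and cov: "\<And>v. v \<in> carrier_vec p \<Longrightarrow> \<bar>real p / real n * (\<Sum>i<n. (v \<bullet> whiten S (x i))\<^sup>2) - v \<bullet> v\<bar> \<le> d * (v \<bullet> v)"
    and spread: "\<And>v. v \<in> carrier_vec p \<Longrightarrow> 3 / 4 * real n \<le> real (card {i \<in> {..<n}. a * (v \<bullet> v) \<le> real p * (v \<bullet> whiten S (x i))\<^sup>2})"
    and a: "0 < a" and k: "1 \<le> k" and dk: "4 * d * k \<le> a * (k - 1)"
  shows "tyler_exists p n x \<and> op_norm (1\<^sub>m p - mat_sqrt S * mat_inv (tyler p n x) * mat_sqrt S) \<le> k - 1"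
  by (rule whitened_tyler[where y = "\<lambda>i. whiten S (x i)" and c = "\<lambda>i. vnorm (mat_inv (mat_sqrt S) *\<^sub>v x i)",
        OF p n S whiten_carrier[OF p S(1) x] whiten_unit[OF p S(1) x nz] cov spread a k dk
        whiten_inverse(2)[OF p S(1) x nz] whiten_inverse(1)[OF p S(1) x nz]])

text \<open>In dimension one the unit vectors are \<open>1\<close> and \<open>-1\<close>, so the
  covariance is exact and the general argument runs with \<open>d = 0\<close> and
  \<open>k = 1\<close>. The conclusion is deterministic on nonzero samples, as the failure bound
  \<open>0\<close> calls for.\<close>

lemma dimension_one_tyler:
  assumes n: "1 \<le> n" and S: "pos_def 1 S" "mat_trace S = 1"
    and x: "\<And>i. i < n \<Longrightarrow> x i \<in> carrier_vec 1" and nz: "\<And>i. i < n \<Longrightarrow> x i \<noteq> 0\<^sub>v 1"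
  shows "tyler_exists 1 n x \<and> op_norm (1\<^sub>m 1 - mat_sqrt S * mat_inv (tyler 1 n x) * mat_sqrt S) \<le> 0"
proof -
  have sq: "(v \<bullet> whiten S (x i))\<^sup>2 = v \<bullet> v" if "v \<in> carrier_vec 1" "i < n" for v i
  proof -
    have "whiten S (x i) \<in> carrier_vec 1" "whiten S (x i) \<bullet> whiten S (x i) = 1"
      using whiten_carrier[OF order_refl S(1) x[OF that(2)]] whiten_unit[OF order_refl S(1) x[OF that(2)] nz[OF that(2)]] by auto
    then have "dim_vec (whiten S (x i)) = 1" "whiten S (x i) $ 0 * whiten S (x i) $ 0 = 1"
      by (auto simp: scalar_prod_def)
    moreover have "dim_vec v = 1" using that by simp
    ultimately show ?thesis by (simp add: scalar_prod_def power2_eq_square algebra_simps)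
  qed
  have "tyler_exists 1 n x \<and> op_norm (1\<^sub>m 1 - mat_sqrt S * mat_inv (tyler 1 n x) * mat_sqrt S) \<le> 1 - 1"
  proof (rule whitened_samples_tyler[where d = 0 and a = 1 and k = 1])
    fix v :: "real vec" assume v: "v \<in> carrier_vec 1"
    show "\<bar>real 1 / real n * (\<Sum>i<n. (v \<bullet> whiten S (x i))\<^sup>2) - v \<bullet> v\<bar> \<le> 0 * (v \<bullet> v)"
      using n by (simp add: sq[OF v])
    have "{i \<in> {..<n}. 1 * (v \<bullet> v) \<le> real 1 * (v \<bullet> whiten S (x i))\<^sup>2} = {..<n}" using sq[OF v] by auto
    then show "3 / 4 * real n \<le> real (card {i \<in> {..<n}. 1 * (v \<bullet> v) \<le> real 1 * (v \<bullet> whiten S (x i))\<^sup>2})" by simp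
  qed (use n S x nz in auto)
  then show ?thesis by simp
qed

theorem theorem1p1:
  shows "\<exists>C c \<epsilon>\<^sub>0 :: real. C > 0 \<and> c > 0 \<and> \<epsilon>\<^sub>0 > 0 \<and>
    (\<forall>(p :: nat) (n :: nat) (\<epsilon> :: real) (\<Sigma> :: real mat) (D :: real vec measure).
       p \<ge> 1 \<longrightarrow> n \<ge> 1 \<longrightarrow> 0 < \<epsilon> \<longrightarrow> \<epsilon> \<le> \<epsilon>\<^sub>0 \<longrightarrow>
       centered_elliptical p \<Sigma> D \<longrightarrow>
       real n \<ge> C * real p * (ln (real p))\<^sup>2 / \<epsilon>\<^sup>2 \<longrightarrow>
       measure (\<Pi>\<^sub>M i\<in>{..<n}. D)
         {x \<in> space (\<Pi>\<^sub>M i\<in>{..<n}. D).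
            tyler_exists p n x \<and>
            op_norm (1\<^sub>m p - mat_sqrt \<Sigma> * mat_inv (tyler p n x) * mat_sqrt \<Sigma>) \<le> \<epsilon>}
         \<ge> 1 - failure_bound c p n \<epsilon>)"
proof -
  from good_samples obtain a K :: real where a: "0 < a" "a \<le> 1" and K: "1 \<le> K" and good: "\<forall>p n t S D. 1 \<le> p \<longrightarrow> 1 \<le> n \<longrightarrow> 0 < t \<longrightarrow> t \<le> 1 / 2 \<longrightarrow> centered_elliptical p S D \<longrightarrow>
    (\<exists>Z \<in> sets (\<Pi>\<^sub>M i\<in>{..<n}. D). emeasure (\<Pi>\<^sub>M i\<in>{..<n}. D) Z \<le> ennreal (K ^ p * (3 * exp (- (real n * t\<^sup>2 / 32)))) \<and>
      (\<forall>x \<in> space (\<Pi>\<^sub>M i\<in>{..<n}. D) - Z. (\<forall>i<n. x i \<noteq> 0\<^sub>v p) \<longrightarrow>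
        (\<forall>v \<in> carrier_vec p. \<bar>real p / real n * (\<Sum>i<n. (v \<bullet> whiten S (x i))\<^sup>2) - v \<bullet> v\<bar> \<le> 2 * t * (v \<bullet> v) \<and>
          3 / 4 * real n \<le> real (card {i \<in> {..<n}. a * (v \<bullet> v) \<le> real p * (v \<bullet> whiten S (x i))\<^sup>2}))))"
    by (elim exE conjE) (rule that)
  \<comment> \<open>With \<open>t = a \<epsilon> / 16\<close> the exponent \<open>n t^2 / 32\<close>
    is \<open>\<tau> n \<epsilon>^2\<close>.\<close>
  define \<tau> where "\<tau> = (a / 16)\<^sup>2 / 32"
  have \<tau>: "0 < \<tau>" using a by (simp add: \<tau>_def)
  \<comment> \<open>A lower bound for \<open>(ln p)^2\<close> when \<open>p >= 2\<close>; it trades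
    a sample size of order \<open>p / \<epsilon>^2\<close> for the logarithmic form.\<close>
  define l2 :: real where "l2 = (ln 2)\<^sup>2"
  have l2: "0 < l2" by (simp add: l2_def)
  \<comment> \<open>Chosen so that the entropy \<open>p ln (3 K)\<close> of the net takes up at most
    half of the exponent; the other half, rescaled by \<open>l2\<close>, gives
    \<open>c\<close>.\<close>
  define C where "C = 2 * ln (3 * K) / (\<tau> * l2)"
  define c where "c = \<tau> / 2 * l2"
  have l3K: "0 < ln (3 * K)" using K by simp
  have C: "0 < C" and c: "0 < c" using \<tau> l2 l3K by (auto simp: C_def c_def)
  have "measure (\<Pi>\<^sub>M i\<in>{..<n}. D)
         {x \<in> space (\<Pi>\<^sub>M i\<in>{..<n}. D).
            tyler_exists p n x \<and>
            op_norm (1\<^sub>m p - mat_sqrt \<Sigma> * mat_inv (tyler p n x) * mat_sqrt \<Sigma>) \<le> \<epsilon>}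
         \<ge> 1 - failure_bound c p n \<epsilon>"
    if p: "1 \<le> p" and n: "1 \<le> n" and \<epsilon>: "0 < \<epsilon>" "\<epsilon> \<le> 1" and D: "centered_elliptical p \<Sigma> D"
      and nC: "C * real p * (ln (real p))\<^sup>2 / \<epsilon>\<^sup>2 \<le> real n" for p n \<epsilon> \<Sigma> D
  proof -
    let ?Q = "\<Pi>\<^sub>M i\<in>{..<n}. D"
    define E where "E = {x \<in> space ?Q. tyler_exists p n x \<and>
      op_norm (1\<^sub>m p - mat_sqrt \<Sigma> * mat_inv (tyler p n x) * mat_sqrt \<Sigma>) \<le> \<epsilon>}"
    have S: "pos_def p \<Sigma>" "mat_trace \<Sigma> = real p" using D by (auto simp: centered_elliptical_def)
    interpret Q: prob_space ?Q by (intro prob_space_PiM elliptical_prob[OF p D])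
    \<comment> \<open>Without measurability the measure of \<open>E\<close> would be the default
      value \<open>0\<close>.\<close>
    have Em: "E \<in> sets ?Q" unfolding E_def
      by (rule tyler_event_measurable[OF elliptical_component[OF D] pos_def_sym[OF mat_sqrt(1)[OF p S(1)]]]) (use \<epsilon> in auto)
    have xc: "x i \<in> carrier_vec p" if "x \<in> space ?Q" "i < n" for x i
      using measurable_space[OF elliptical_component[OF D that(2)] that(1)] by simp
    have nz: "AE x in ?Q. \<forall>i<n. x i \<noteq> 0\<^sub>v p" by (rule elliptical_samples_nonzero[OF p D])
    have "1 - failure_bound c p n \<epsilon> \<le> measure ?Q E"
    proof (cases "p = 1")
      case True
      have "AE x in ?Q. x \<in> E"
        using nz AE_space
      proof eventually_elim
        case (elim x)
        have "tyler_exists 1 n x \<and> op_norm (1\<^sub>m 1 - mat_sqrt \<Sigma> * mat_inv (tyler 1 n x) * mat_sqrt \<Sigma>) \<le> 0"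
          by (rule dimension_one_tyler[OF n]) (use S xc[OF elim(2)] elim(1) True in auto)
        then show ?case using elim(2) True \<epsilon> by (simp add: E_def)
      qed
      then have "measure ?Q E = 1" using Em by (simp add: Q.prob_eq_1)
      then show ?thesis using True by (simp add: failure_bound_def)
    next
      case False
      then have p2: "2 \<le> p" using p by simp
      \<comment> \<open>With \<open>d = 2 t\<close> and \<open>k = 1 + \<epsilon>\<close> the
        requirement \<open>4 d k <= a (k - 1)\<close> reads
        \<open>1 + \<epsilon> <= 2\<close>.\<close>
      define t where "t = a * \<epsilon> / 16"
      have t: "0 < t" "t \<le> 1 / 2"
      proof -
        have "a * \<epsilon> \<le> 1 * 1" using a \<epsilon> by (intro mult_mono) auto
        then show "t \<le> 1 / 2" unfolding t_def by linarith
      qed (use a \<epsilon> in \<open>simp add: t_def\<close>)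
      obtain Z where Z: "Z \<in> sets ?Q" "emeasure ?Q Z \<le> ennreal (K ^ p * (3 * exp (- (real n * t\<^sup>2 / 32))))"
        and Zg: "\<And>x v. x \<in> space ?Q - Z \<Longrightarrow> \<forall>i<n. x i \<noteq> 0\<^sub>v p \<Longrightarrow> v \<in> carrier_vec p \<Longrightarrow>
          \<bar>real p / real n * (\<Sum>i<n. (v \<bullet> whiten \<Sigma> (x i))\<^sup>2) - v \<bullet> v\<bar> \<le> 2 * t * (v \<bullet> v) \<and>
          3 / 4 * real n \<le> real (card {i \<in> {..<n}. a * (v \<bullet> v) \<le> real p * (v \<bullet> whiten \<Sigma> (x i))\<^sup>2})"
        using good[rule_format, OF p n t D] by blast
      have sub: "AE x in ?Q. x \<in> space ?Q - Z \<longrightarrow> x \<in> E"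
        using nz
      proof eventually_elim
        case (elim x)
        show ?case
        proof
          assume x: "x \<in> space ?Q - Z"
          have "4 * (2 * t) * (1 + \<epsilon>) \<le> a * ((1 + \<epsilon>) - 1)"
          proof -
            have "a * \<epsilon> * (1 + \<epsilon>) \<le> a * \<epsilon> * 2" using a \<epsilon> by (intro mult_left_mono) auto
            moreover have "4 * (2 * t) * (1 + \<epsilon>) = a * \<epsilon> * (1 + \<epsilon>) / 2" unfolding t_def by (simp add: algebra_simps)
            moreover have "a * ((1 + \<epsilon>) - 1) = a * \<epsilon>" by simp
            ultimately show ?thesis by linarith
          qed
          then have "tyler_exists p n x \<and> op_norm (1\<^sub>m p - mat_sqrt \<Sigma> * mat_inv (tyler p n x) * mat_sqrt \<Sigma>) \<le> (1 + \<epsilon>) - 1"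
            using Zg[OF x elim] elim xc x \<epsilon> by (intro whitened_samples_tyler[OF p n S _ _ _ _ a(1), where d = "2 * t"]) auto
          then show "x \<in> E" using x by (simp add: E_def)
        qed
      qed
      let ?f = "K ^ p * (3 * exp (- (real n * t\<^sup>2 / 32)))"
      have f0: "0 \<le> ?f" using K by simp
      have "1 - ?f \<le> 1 - measure ?Q Z"
        using Z(2) f0 by (simp add: Q.emeasure_eq_measure)
      also have "\<dots> = measure ?Q (space ?Q - Z)" by (rule Q.prob_compl[OF Z(1), symmetric])
      also have "\<dots> \<le> measure ?Q E" using sub Em by (intro Q.finite_measure_mono_AE) auto
      finally have 1: "1 - ?f \<le> measure ?Q E" .
      have lnp: "l2 \<le> (ln (real p))\<^sup>2" unfolding l2_def using p2 by (intro power_mono ln_mono) auto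
      have "C * real p * l2 \<le> C * real p * (ln (real p))\<^sup>2" using C lnp by (intro mult_left_mono) auto
      also have "\<dots> \<le> real n * \<epsilon>\<^sup>2" using nC \<epsilon> by (simp add: divide_le_eq)
      finally have nl: "C * real p * l2 \<le> real n * \<epsilon>\<^sup>2" .
      have "2 * ln (3 * K) * real p = \<tau> * (C * real p * l2)" using \<tau> l2 by (simp add: C_def)
      also have "\<dots> \<le> \<tau> * (real n * \<epsilon>\<^sup>2)" using nl \<tau> by (intro mult_left_mono) auto
      finally have big: "real p * ln (3 * K) \<le> \<tau> / 2 * (real n * \<epsilon>\<^sup>2)" by (simp add: mult.commute)
      \<comment> \<open>The factor \<open>3\<close> stems from the three tails of each direction; it
        is absorbed into the base of the net bound.\<close>
      have "K ^ p * 3 \<le> (3 * K) ^ p"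
      proof -
        have "(3 :: real) ^ 1 \<le> 3 ^ p" using p by (intro power_increasing) auto
        then show ?thesis using K by (simp add: power_mult_distrib mult.commute)
      qed
      also have "(3 * K) ^ p = exp (real p * ln (3 * K))" using K by (simp add: exp_of_nat_mult)
      also have "\<dots> \<le> exp (\<tau> / 2 * (real n * \<epsilon>\<^sup>2))" using big by simp
      finally have K3: "K ^ p * 3 \<le> exp (\<tau> / 2 * (real n * \<epsilon>\<^sup>2))" .
      have tt: "real n * t\<^sup>2 / 32 = \<tau> * (real n * \<epsilon>\<^sup>2)" by (simp add: t_def \<tau>_def power_divide power_mult_distrib)
      have "?f = K ^ p * 3 * exp (- (\<tau> * (real n * \<epsilon>\<^sup>2)))" unfolding tt by simp
      also have "\<dots> \<le> exp (\<tau> / 2 * (real n * \<epsilon>\<^sup>2)) * exp (- (\<tau> * (real n * \<epsilon>\<^sup>2)))" using K3 by (intro mult_right_mono) auto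
      also have "\<dots> = exp (- (\<tau> / 2 * (real n * \<epsilon>\<^sup>2)))" by (simp add: exp_add[symmetric])
      \<comment> \<open>The decay obtained is stronger than claimed: division by
        \<open>(ln p)^2 >= l2\<close> only weakens the exponent, and \<open>c\<close> contains the
        matching factor \<open>l2\<close>.\<close>
      also have "\<dots> \<le> failure_bound c p n \<epsilon>"
      proof -
        have "0 < (ln (real p))\<^sup>2" using lnp l2 by linarith
        then have "c * real n * \<epsilon>\<^sup>2 / (ln (real p))\<^sup>2 \<le> c * real n * \<epsilon>\<^sup>2 / l2"
          using lnp l2 c by (intro divide_left_mono mult_pos_pos) auto
        also have "\<dots> = \<tau> / 2 * (real n * \<epsilon>\<^sup>2)" using l2 by (simp add: c_def)
        finally show ?thesis using False by (simp add: failure_bound_def)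
      qed
      finally show ?thesis using 1 by linarith
    qed
    then show ?thesis unfolding E_def .
  qed
  then show ?thesis using C c by (intro exI[of _ C] exI[of _ c] exI[of _ 1]) auto
qed

end
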